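(* On a closed orientable surface (Riemann surface) of genus $3$ there exists no regular tessellation of type $\{p,q\}$ for $$\{p,q\}\in\bigl\{\{4,5\},\ \{6,5\},\ \{6,9\},\ \{10,3\},\ \{10,5\},\ \{18,3\},\ \{30,3\}\bigr\}.$$ (Here each $\{p,q\}$ is an ordered pair.)
   Context: A tessellation (tiling) of a closed connected orientable surface $\Sigma$ is a finite connected graph embedded in $\Sigma$ such that every component of the complement (a face) is an open disc; multiple edges and loops are allowed. A face is a $p$-gon if its boundary walk has length $p$, with an edge counted twice if the face lies on both sides of it. The symmetry group of a tessellation is the group of automorphisms of the embedded graph induced by self-homeomorphisms of $\Sigma$ (possibly orientation-reversing) that preserve the graph. A flag is a mutually incident triple of vertex, edge and face, counted with multiplicity; equivalently, a half-edge together with a choice of one of its two sides, so that a tessellation with $E$ edges has $4E$ flags. The tessellation is regular if its symmetry group acts transitively on flags. A regular tessellation has type (Schläfli symbol) $\{p,q\}$ if every face is a $p$-gon and every vertex has valency $q$; the symbol is ordered. *)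

theory Defs
  imports "HOL-Analysis.Analysis"
begin

section \<open>Closed orientable surfaces\<close>

definition closed_surface :: "'a topology \<Rightarrow> bool" where
  "closed_surface X \<longleftrightarrow>
     topspace X \<noteq> {} \<and> connected_space X \<and> compact_space X \<and> Hausdorff_space X \<and>
     (\<forall>x\<in>topspace X. \<exists>U. openin X U \<and> x \<in> U \<and>
        subtopology X U homeomorphic_space top_of_set (ball (0::complex) 1))"

text \<open>An embedded Moebius band is given as a continuous map of a rectangle that identifies
  \<open>(0, t)\<close> with \<open>(1, - t)\<close> and makes no other identification; since the rectangle is compact and
  closed surfaces are Hausdorff, such a map embeds the quotient.\<close>

definition moebius_band_in :: "'a topology \<Rightarrow> (real \<times> real \<Rightarrow> 'a) \<Rightarrow> bool" where
  "moebius_band_in X m \<longleftrightarrow>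
     continuous_map (top_of_set ({0..1} \<times> {-1..1})) X m \<and>
     (\<forall>s\<in>{0..1}. \<forall>t\<in>{-1..1}. \<forall>s'\<in>{0..1}. \<forall>t'\<in>{-1..1}.
        m (s, t) = m (s', t') \<longleftrightarrow> (s = s' \<and> t = t') \<or> (\<bar>s - s'\<bar> = 1 \<and> t' = - t))"

definition orientable_surface :: "'a topology \<Rightarrow> bool" where
  "orientable_surface X \<longleftrightarrow> \<not> (\<exists>m. moebius_band_in X m)"

section \<open>Tessellations\<close>

text \<open>Every edge is given by a parametrization on the unit interval, which also fixes a direction
  of that edge; loops and multiple edges are allowed.\<close>

record 'a embedded_graph =
  gverts :: "'a set"
  gedges :: "(real \<Rightarrow> 'a) set"

definition gsupport :: "'a embedded_graph \<Rightarrow> 'a set" where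
  "gsupport \<Gamma> = gverts \<Gamma> \<union> (\<Union>e\<in>gedges \<Gamma>. e ` {0..1})"

definition graph_in :: "'a topology \<Rightarrow> 'a embedded_graph \<Rightarrow> bool" where
  "graph_in X \<Gamma> \<longleftrightarrow>
     finite (gverts \<Gamma>) \<and> gverts \<Gamma> \<noteq> {} \<and> gverts \<Gamma> \<subseteq> topspace X \<and> finite (gedges \<Gamma>) \<and>
     (\<forall>e\<in>gedges \<Gamma>. pathin X e \<and> e 0 \<in> gverts \<Gamma> \<and> e 1 \<in> gverts \<Gamma> \<and>
        inj_on e {0<..<1} \<and> e ` {0<..<1} \<inter> gverts \<Gamma> = {}) \<and>
     (\<forall>e\<in>gedges \<Gamma>. \<forall>e'\<in>gedges \<Gamma>. e \<noteq> e' \<longrightarrow> e ` {0<..<1} \<inter> e' ` {0<..<1} = {})"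

definition faces :: "'a topology \<Rightarrow> 'a embedded_graph \<Rightarrow> 'a set set" where
  "faces X \<Gamma> = connected_components_of (subtopology X (topspace X - gsupport \<Gamma>))"

definition tessellation :: "'a topology \<Rightarrow> 'a embedded_graph \<Rightarrow> bool" where
  "tessellation X \<Gamma> \<longleftrightarrow>
     graph_in X \<Gamma> \<and> connectedin X (gsupport \<Gamma>) \<and>
     (\<forall>C\<in>faces X \<Gamma>. subtopology X C homeomorphic_space top_of_set (ball (0::complex) 1))"

text \<open>The Euler characteristic of a closed surface is the common value of the alternating sum
  \<open>V - E + F\<close> over all its tessellations, and the genus \<open>g\<close> of a closed orientable surface is
  given by \<open>V - E + F = 2 - 2 * g\<close>.\<close>

definition has_euler_characteristic :: "'a topology \<Rightarrow> int \<Rightarrow> bool" where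
  "has_euler_characteristic X k \<longleftrightarrow>
     (\<exists>\<Gamma>. tessellation X \<Gamma>) \<and>
     (\<forall>\<Gamma>. tessellation X \<Gamma> \<longrightarrow>
        int (card (gverts \<Gamma>)) - int (card (gedges \<Gamma>)) + int (card (faces X \<Gamma>)) = k)"

definition closed_orientable_surface_of_genus :: "nat \<Rightarrow> 'a topology \<Rightarrow> bool" where
  "closed_orientable_surface_of_genus g X \<longleftrightarrow>
     closed_surface X \<and> orientable_surface X \<and> has_euler_characteristic X (2 - 2 * int g)"

section \<open>Boundary walks and valencies\<close>

text \<open>The \<open>p\<close> corners and \<open>p\<close> sides of the closed unit disc, regarded as a \<open>p\<close>-gon: side \<open>i\<close> is
  the arc \<open>polygon_side p i ` {0..1}\<close>.\<close>

definition polygon_side :: "nat \<Rightarrow> nat \<Rightarrow> real \<Rightarrow> complex" where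
  "polygon_side p i t = cis (2 * pi * (real i + t) / real p)"

text \<open>A traversal of an edge; \<open>True\<close> means against its given direction.\<close>

definition traverse :: "(real \<Rightarrow> 'a) \<Rightarrow> bool \<Rightarrow> real \<Rightarrow> 'a" where
  "traverse e b t = (if b then e (1 - t) else e t)"

text \<open>The boundary walk of a face is read off from a parametrization of the closed face by a
  polygon: a continuous map of the closed disc that is a homeomorphism from the open disc onto the
  face and runs through one edge of the graph on every side. An edge with the face on both sides
  occurs on two sides of the polygon.\<close>

definition polygon_param ::
    "'a topology \<Rightarrow> 'a embedded_graph \<Rightarrow> 'a set \<Rightarrow> nat \<Rightarrow> (complex \<Rightarrow> 'a) \<Rightarrow> bool" where
  "polygon_param X \<Gamma> C p \<phi> \<longleftrightarrow>
     p \<ge> 1 \<and>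
     continuous_map (top_of_set (cball 0 1)) X \<phi> \<and>
     homeomorphic_map (top_of_set (ball 0 1)) (subtopology X C) \<phi> \<and>
     (\<forall>i<p. \<exists>e\<in>gedges \<Gamma>. \<exists>b. \<forall>t\<in>{0..1}. \<phi> (polygon_side p i t) = traverse e b t)"

definition is_gon :: "'a topology \<Rightarrow> 'a embedded_graph \<Rightarrow> 'a set \<Rightarrow> nat \<Rightarrow> bool" where
  "is_gon X \<Gamma> C p \<longleftrightarrow> (\<exists>\<phi>. polygon_param X \<Gamma> C p \<phi>)"

definition valency :: "'a embedded_graph \<Rightarrow> 'a \<Rightarrow> nat" where
  "valency \<Gamma> v = card {e \<in> gedges \<Gamma>. e 0 = v} + card {e \<in> gedges \<Gamma>. e 1 = v}"

definition has_type :: "'a topology \<Rightarrow> 'a embedded_graph \<Rightarrow> nat \<Rightarrow> nat \<Rightarrow> bool" where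
  "has_type X \<Gamma> p q \<longleftrightarrow>
     (\<forall>C\<in>faces X \<Gamma>. is_gon X \<Gamma> C p) \<and> (\<forall>v\<in>gverts \<Gamma>. valency \<Gamma> v = q)"

section \<open>Flags, symmetries and regularity\<close>

text \<open>Given polygon parametrizations \<open>\<Phi> C\<close> with \<open>n C\<close> sides of all faces \<open>C\<close>, the flag
  \<open>(C, i, b)\<close> consists of the face \<open>C\<close>, the edge under side \<open>i\<close> of its polygon, and the vertex
  under the first (\<open>b = False\<close>) or last (\<open>b = True\<close>) corner of that side. Using positions on the
  boundary walk counts incident triples with multiplicity: a flag is a half-edge together with one
  of its two sides.\<close>

type_synonym 'a flag = "'a set \<times> nat \<times> bool"

definition flags :: "'a topology \<Rightarrow> 'a embedded_graph \<Rightarrow> ('a set \<Rightarrow> nat) \<Rightarrow> 'a flag set" where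
  "flags X \<Gamma> n = {(C, i, b). C \<in> faces X \<Gamma> \<and> i < n C}"

definition is_symmetry :: "'a topology \<Rightarrow> 'a embedded_graph \<Rightarrow> ('a \<Rightarrow> 'a) \<Rightarrow> bool" where
  "is_symmetry X \<Gamma> h \<longleftrightarrow>
     homeomorphic_map X X h \<and> h ` gverts \<Gamma> = gverts \<Gamma> \<and> h ` gsupport \<Gamma> = gsupport \<Gamma>"

text \<open>A symmetry \<open>h\<close> maps a face \<open>C\<close> onto the face \<open>h ` C\<close>, and this lifts to a homeomorphism
  \<open>g\<close> of the polygons. The image of a flag is found by following its side, traced from the corner
  of the flag, under \<open>g\<close>; the reparametrization \<open>\<tau>\<close> is needed as \<open>h\<close> need not respect the
  parametrizations of the edges.\<close>

definition maps_flag ::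
    "('a set \<Rightarrow> nat) \<Rightarrow> ('a set \<Rightarrow> complex \<Rightarrow> 'a) \<Rightarrow> ('a \<Rightarrow> 'a) \<Rightarrow> 'a flag \<Rightarrow> 'a flag \<Rightarrow> bool" where
  "maps_flag n \<Phi> h x y \<longleftrightarrow>
     (case x of (C, i, b) \<Rightarrow> case y of (D, j, c) \<Rightarrow>
        D = h ` C \<and>
        (\<exists>g \<tau>. homeomorphic_map (top_of_set (cball 0 1)) (top_of_set (cball 0 1)) g \<and>
               (\<forall>z\<in>cball 0 1. h (\<Phi> C z) = \<Phi> D (g z)) \<and>
               strict_mono_on {0..1} \<tau> \<and> \<tau> ` {0..1} = {0..1} \<and>
               (\<forall>t\<in>{0..1}. g (traverse (polygon_side (n C) i) b t) =
                            traverse (polygon_side (n D) j) c (\<tau> t))))"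

definition induces_on_flags ::
    "'a topology \<Rightarrow> 'a embedded_graph \<Rightarrow> ('a set \<Rightarrow> nat) \<Rightarrow> ('a set \<Rightarrow> complex \<Rightarrow> 'a) \<Rightarrow>
     ('a \<Rightarrow> 'a) \<Rightarrow> ('a flag \<Rightarrow> 'a flag) \<Rightarrow> bool" where
  "induces_on_flags X \<Gamma> n \<Phi> h \<pi> \<longleftrightarrow>
     (\<forall>x\<in>flags X \<Gamma> n. \<pi> x \<in> flags X \<Gamma> n \<and> maps_flag n \<Phi> h x (\<pi> x))"

text \<open>Polygon parametrizations of all faces are merely auxiliary: another choice relabels
  the flags equivariantly.\<close>

definition regular_tessellation :: "'a topology \<Rightarrow> 'a embedded_graph \<Rightarrow> bool" where
  "regular_tessellation X \<Gamma> \<longleftrightarrow>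
     tessellation X \<Gamma> \<and>
     (\<exists>n \<Phi>. (\<forall>C\<in>faces X \<Gamma>. polygon_param X \<Gamma> C (n C) (\<Phi> C)) \<and>
        (\<forall>x\<in>flags X \<Gamma> n. \<forall>y\<in>flags X \<Gamma> n.
           \<exists>h \<pi>. is_symmetry X \<Gamma> h \<and> induces_on_flags X \<Gamma> n \<Phi> h \<pi> \<and> \<pi> x = y))"

end

theory Submission
  imports Defs "HOL-Algebra.Group_Action" "HOL-Algebra.Multiplicative_Group" "HOL-Algebra.Sylow"
begin

text \<open>Invariance of domain shows that every edge of a tessellation lies under exactly two sides of the
  face polygons and that the flags at a vertex form a single cycle, so the flags carry three involutions
  \<open>r0\<close>, \<open>r1\<close>, \<open>r2\<close> (change the vertex, edge, face) under which they are connected. If the flags could not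
  be two-coloured compatibly with these involutions, a shortest orientation-reversing closed chain of
  faces would contain a Moebius band made of parallel strips. Hence on an orientable surface the even
  words in the involutions act on a regular tessellation as a group of order \<open>2 E\<close>, generated by \<open>x\<close> and
  \<open>y\<close> of orders \<open>p\<close> and \<open>q\<close> with \<open>(x y)\<^sup>2 = 1\<close>. For genus 3 the Euler characteristic determines \<open>E\<close>, and in each of
  the seven cases Sylow-type counting excludes such a group. Orientability is essential: types \<open>{4,5}\<close>
  and \<open>{10,3}\<close> do occur on the non-orientable surface with the same Euler characteristic.\<close>

section \<open>Conjugates of subgroups\<close>

text \<open>The symmetries are homeomorphisms and are never composed into a group. What is used of
  them is that the maps of flags they induce commute with \<open>r0\<close>, \<open>r1\<close>,
  \<open>r2\<close> and are transitive. A permutation commuting with a transitive family is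
  determined by its value at one flag, so the even words act freely, and counting the flags of a
  component gives group orders exactly: a face has \<open>2 p\<close> flags and a vertex
  \<open>2 q\<close>, half of them of each colour. The colouring is what separates even from odd
  words. Since orientability is given as the absence of an embedded band, a failure of the colouring
  has to be turned into an explicit map of a rectangle without unwanted identifications, which is
  why the chain of faces must visit no face twice. The local topology rests on two facts only,
  planar invariance of domain and connectedness of a punctured disc. The side numbers of the
  polygons in the definitions of regularity and of type come from separate choices and are
  reconciled by counting flags.\<close>

definition (in group) conj_sub :: "'a \<Rightarrow> 'a set \<Rightarrow> 'a set" where
  "conj_sub g H = (\<lambda>h. g \<otimes> h \<otimes> inv g) ` H"

context group
begin

lemma conj_sub_mult:
  assumes "g \<in> carrier G" "h \<in> carrier G" "H \<subseteq> carrier G"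
  shows "conj_sub (g \<otimes> h) H = conj_sub g (conj_sub h H)"
proof -
  have "g \<otimes> h \<otimes> k \<otimes> inv (g \<otimes> h) = g \<otimes> (h \<otimes> k \<otimes> inv h) \<otimes> inv g" if "k \<in> H" for k
  proof -
    have "k \<in> carrier G" using that assms by blast
    then show ?thesis using assms by (simp add: m_assoc inv_mult_group)
  qed
  then show ?thesis unfolding conj_sub_def image_image by (intro image_cong) auto
qed

lemma conj_sub_one: "H \<subseteq> carrier G \<Longrightarrow> conj_sub \<one> H = H"
  unfolding conj_sub_def by (force simp: image_iff)

lemma conj_sub_closed: "g \<in> carrier G \<Longrightarrow> H \<subseteq> carrier G \<Longrightarrow> conj_sub g H \<subseteq> carrier G"
  unfolding conj_sub_def by auto

lemma conj_sub_inj: "g \<in> carrier G \<Longrightarrow> H \<subseteq> carrier G \<Longrightarrow> inj_on (\<lambda>h. g \<otimes> h \<otimes> inv g) H"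
  by (rule inj_onI) (metis conjugation_is_inj subsetD)

lemma card_conj_sub: "g \<in> carrier G \<Longrightarrow> H \<subseteq> carrier G \<Longrightarrow> card (conj_sub g H) = card H"
  unfolding conj_sub_def by (rule card_image) (rule conj_sub_inj)

lemma conj_sub_inv:
  assumes "g \<in> carrier G" "H \<subseteq> carrier G" "conj_sub g H = K"
  shows "conj_sub (inv g) K = H"
  using assms conj_sub_mult[of "inv g" g H] conj_sub_one by simp

lemma conj_sub_eq_if_subset:
  assumes "g \<in> carrier G" "H \<subseteq> carrier G" "finite H" "conj_sub g H \<subseteq> H"
  shows "conj_sub g H = H"
  using assms by (simp add: card_conj_sub card_subset_eq)

lemma subgroup_conj_sub:
  assumes "g \<in> carrier G" "subgroup H G"
  shows "subgroup (conj_sub g H) G"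
proof -
  interpret H: subgroup H G by fact
  show ?thesis
  proof (rule subgroupI)
    show "conj_sub g H \<subseteq> carrier G" using assms conj_sub_closed H.subset by blast
    show "conj_sub g H \<noteq> {}" using H.one_closed unfolding conj_sub_def by blast
    fix a assume "a \<in> conj_sub g H"
    then obtain h where h: "h \<in> H" "a = g \<otimes> h \<otimes> inv g" unfolding conj_sub_def by blast
    have hc: "h \<in> carrier G" using h H.subset by blast
    have "inv a = g \<otimes> inv h \<otimes> inv g"
      using h hc assms by (simp add: inv_mult_group m_assoc)
    then show "inv a \<in> conj_sub g H" using h H.m_inv_closed unfolding conj_sub_def by blast
    fix b assume "b \<in> conj_sub g H"
    then obtain k where k: "k \<in> H" "b = g \<otimes> k \<otimes> inv g" unfolding conj_sub_def by blast
    have kc: "k \<in> carrier G" using k H.subset by blast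
    have "inv g \<otimes> (g \<otimes> (k \<otimes> inv g)) = k \<otimes> inv g"
      using kc assms by (simp add: m_assoc[symmetric])
    then have "a \<otimes> b = g \<otimes> (h \<otimes> k) \<otimes> inv g"
      using h k hc kc assms by (simp add: m_assoc)
    then show "a \<otimes> b \<in> conj_sub g H" using h k H.m_closed unfolding conj_sub_def by blast
  qed
qed

text \<open>The normalizer, written for arbitrary subsets so that it is literally the stabilizer of
  \<open>H\<close> under conjugation.\<close>

definition nrm :: "'a set \<Rightarrow> 'a set" where
  "nrm H = {g \<in> carrier G. conj_sub g H = H}"

definition conjugates :: "'a set \<Rightarrow> 'a set set" where
  "conjugates H = (\<lambda>g. conj_sub g H) ` carrier G"

text \<open>The known conjugation action is stated with cosets \<open>g <# H #> inv g\<close>;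
  rewriting it through \<open>conj_sub\<close> makes orbit-stabilizer available for
  \<open>conjugates\<close> and \<open>nrm\<close>.\<close>

lemma conj_sub_action:
  "group_action G {H. H \<subseteq> carrier G} (\<lambda>g. \<lambda>H \<in> {H. H \<subseteq> carrier G}. conj_sub g H)"
proof -
  have "(\<lambda>g. \<lambda>H \<in> {H. H \<subseteq> carrier G}. conj_sub g H) g
      = (\<lambda>g. \<lambda>H \<in> {H. H \<subseteq> carrier G}. g <# H #> inv g) g" for g
    by (auto simp: conj_sub_def l_coset_def r_coset_def fun_eq_iff restrict_def image_iff)
  then show ?thesis using action_by_conjugation_on_power_set by presburger
qed

lemma subgroup_nrm:
  assumes "H \<subseteq> carrier G" shows "subgroup (nrm H) G"
proof -
  have "nrm H = stabilizer G (\<lambda>g. \<lambda>H \<in> {H. H \<subseteq> carrier G}. conj_sub g H) H"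
    using assms by (auto simp: nrm_def stabilizer_def)
  then show ?thesis
    using group_action.stabilizer_subgroup[OF conj_sub_action] assms by auto
qed

lemma card_conjugates:
  assumes "H \<subseteq> carrier G"
  shows "card (conjugates H) * card (nrm H) = order G"
proof -
  have "nrm H = stabilizer G (\<lambda>g. \<lambda>H \<in> {H. H \<subseteq> carrier G}. conj_sub g H) H"
    using assms by (auto simp: nrm_def stabilizer_def)
  moreover have "conjugates H = orbit G (\<lambda>g. \<lambda>H \<in> {H. H \<subseteq> carrier G}. conj_sub g H) H"
    using assms by (auto simp: conjugates_def orbit_def)
  ultimately show ?thesis
    using group_action.orbit_stabilizer_theorem[OF conj_sub_action] assms by auto
qed

lemma conjugates_self: "H \<subseteq> carrier G \<Longrightarrow> H \<in> conjugates H"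
  unfolding conjugates_def using conj_sub_one by (metis imageI one_closed)

lemma subgroup_le_nrm:
  assumes "subgroup H G" "finite H" shows "H \<subseteq> nrm H"
proof
  interpret H: subgroup H G by fact
  fix g assume g: "g \<in> H"
  have "conj_sub g H \<subseteq> H" unfolding conj_sub_def using g by auto
  then show "g \<in> nrm H" using g assms conj_sub_eq_if_subset[of g H] H.subset unfolding nrm_def by auto
qed

lemma card_conjugates_1:
  assumes "H \<subseteq> carrier G" "card (conjugates H) = 1"
  shows "nrm H = carrier G"
proof -
  have "conjugates H = {H}"
    using assms conjugates_self by (metis card_1_singletonE singletonD)
  then show ?thesis unfolding conjugates_def nrm_def by auto
qed

text \<open>\<open>Q\<close> is a full Sylow \<open>l\<close>-subgroup, so \<open>nrm Q\<close>
  modulo \<open>Q\<close> has order prime to \<open>l\<close>. The image there of an element of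
  \<open>Z\<close> has order dividing both \<open>l\<close> and this number, hence is trivial, and
  the element lies in \<open>Q\<close>.\<close>

lemma prime_subgroup_unique:
  assumes fin: "finite (carrier G)" and Z: "subgroup Z G" "card Z = l" and Q: "subgroup Q G" "card Q = l"
    and l: "Factorial_Ring.prime l" "\<not> l\<^sup>2 dvd order G" and nZ: "Z \<subseteq> nrm Q"
  shows "Z = Q"
proof -
  interpret Q: subgroup Q G by fact
  interpret Z: subgroup Z G by fact
  let ?N = "nrm Q"
  have sN: "subgroup ?N G" using subgroup_nrm Q.subset by blast
  interpret N: subgroup ?N G by fact
  interpret NG: group "G\<lparr>carrier := ?N\<rparr>" using subgroup_imp_group sN by blast
  have finQ: "finite Q" using fin Q.subset finite_subset by blast
  have QN: "Q \<subseteq> ?N" using subgroup_le_nrm[OF Q(1) finQ] .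
  have sQN: "subgroup Q (G\<lparr>carrier := ?N\<rparr>)" using subgroup_incl Q(1) sN QN by blast
  have nor: "normal Q (G\<lparr>carrier := ?N\<rparr>)"
  proof (rule NG.normal_invI[OF sQN])
    fix x h assume x: "x \<in> carrier (G\<lparr>carrier := ?N\<rparr>)" "h \<in> Q"
    have "x \<in> carrier G" "conj_sub x Q = Q" using x unfolding nrm_def by auto
    moreover have "inv\<^bsub>G\<lparr>carrier := ?N\<rparr>\<^esub> x = inv x" using m_inv_consistent[OF sN] x by simp
    ultimately show "x \<otimes>\<^bsub>G\<lparr>carrier := nrm Q\<rparr>\<^esub> h \<otimes>\<^bsub>G\<lparr>carrier := nrm Q\<rparr>\<^esub> inv\<^bsub>G\<lparr>carrier := nrm Q\<rparr>\<^esub> x \<in> Q"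
      using x unfolding conj_sub_def by auto
  qed
  interpret nor: normal Q "G\<lparr>carrier := ?N\<rparr>" by fact
  let ?F = "(G\<lparr>carrier := ?N\<rparr>) Mod Q"
  interpret F: group ?F by (rule nor.factorgroup_is_group)
  have finN: "finite ?N" using fin N.subset finite_subset by blast
  let ?m = "order ?F"
  have "?m * card Q = card ?N"
    using NG.lagrange[OF sQN] finN unfolding order_def FactGroup_def by simp
  moreover have "card ?N dvd order G"
    using card_conjugates[OF Q.subset] by (metis dvd_triv_right)
  ultimately have "\<not> l dvd ?m" using l Q(2)
    by (metis dvd_trans mult_dvd_mono power2_eq_square dvd_refl)
  then have cop: "coprime ?m l" using l(1) by (metis coprime_commute prime_imp_coprime)
  have "z \<in> Q" if z: "z \<in> Z" for z
  proof -
    have zN: "z \<in> ?N" using z nZ by blast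
    have zG: "z \<in> carrier G" using z Z.subset by blast
    have hom: "(\<lambda>a. Q #>\<^bsub>G\<lparr>carrier := ?N\<rparr>\<^esub> a) \<in> hom (G\<lparr>carrier := ?N\<rparr>) ?F"
      by (rule nor.r_coset_hom_Mod)
    then interpret gh: group_hom "G\<lparr>carrier := ?N\<rparr>" ?F "(\<lambda>a. Q #>\<^bsub>G\<lparr>carrier := ?N\<rparr>\<^esub> a)"
      by unfold_locales
    have zcl: "Q #>\<^bsub>G\<lparr>carrier := ?N\<rparr>\<^esub> z \<in> carrier ?F" using zN gh.hom_closed by auto
    have finF: "finite (carrier ?F)" using finN unfolding FactGroup_def RCOSETS_def by auto
    have "z [^]\<^bsub>G\<lparr>carrier := Z\<rparr>\<^esub> l = \<one>\<^bsub>G\<lparr>carrier := Z\<rparr>\<^esub>"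
      using group.pow_order_eq_1[OF subgroup_imp_group[OF Z(1)]] z Z(2) unfolding order_def by auto
    then have "z [^] l = \<one>" using nat_pow_consistent[of z l Z] by simp
    then have "z [^]\<^bsub>G\<lparr>carrier := ?N\<rparr>\<^esub> l = \<one>" using nat_pow_consistent[of z l ?N] by simp
    then have "(Q #>\<^bsub>G\<lparr>carrier := ?N\<rparr>\<^esub> z) [^]\<^bsub>?F\<^esub> l = \<one>\<^bsub>?F\<^esub>"
      using gh.hom_nat_pow[of z l] zN gh.hom_one by simp
    then have "F.ord (Q #>\<^bsub>G\<lparr>carrier := ?N\<rparr>\<^esub> z) dvd l" using F.pow_eq_id zcl by blast
    moreover have "F.ord (Q #>\<^bsub>G\<lparr>carrier := ?N\<rparr>\<^esub> z) dvd ?m" using F.ord_dvd_group_order zcl finF by blast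
    ultimately have "F.ord (Q #>\<^bsub>G\<lparr>carrier := ?N\<rparr>\<^esub> z) = 1" using cop
      using coprime_common_divisor_nat by blast
    then have "Q #>\<^bsub>G\<lparr>carrier := ?N\<rparr>\<^esub> z = Q" using F.ord_eq_1[OF zcl] by simp
    moreover have "z \<in> Q #>\<^bsub>G\<lparr>carrier := ?N\<rparr>\<^esub> z" using NG.rcos_self[of z Q] zN sQN by simp
    ultimately show ?thesis by blast
  qed
  then have "Z \<subseteq> Q" by blast
  then show ?thesis using finQ Z(2) Q(2) by (simp add: card_subset_eq)
qed

text \<open>Third Sylow theorem for a Sylow subgroup of prime order: \<open>Z\<close> acts on its
  own conjugates, \<open>Z\<close> is the only fixed one, and every other orbit has \<open>l\<close>
  elements. The second claim makes the truncated subtraction in the first harmless.\<close>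

lemma card_conjugates_cong:
  assumes fin: "finite (carrier G)" and Z: "subgroup Z G" "card Z = l"
    and l: "Factorial_Ring.prime l" "\<not> l\<^sup>2 dvd order G"
  shows "l dvd card (conjugates Z) - 1" "card (conjugates Z) \<ge> 1"
proof -
  interpret Z: subgroup Z G by fact
  let ?\<phi> = "\<lambda>g. \<lambda>H \<in> {H. H \<subseteq> carrier G}. conj_sub g H"
  let ?Z = "G\<lparr>carrier := Z\<rparr>"
  let ?E = "{H. H \<subseteq> carrier G}"
  interpret A: group_action G ?E ?\<phi> by (rule conj_sub_action)
  interpret B: group_action ?Z ?E ?\<phi> by (rule A.induced_action[OF Z(1)])
  have finC: "finite (conjugates Z)" unfolding conjugates_def using fin by blast
  have subC: "Q \<subseteq> carrier G \<and> subgroup Q G \<and> card Q = l" if "Q \<in> conjugates Z" for Q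
    using that conj_sub_closed[OF _ Z.subset] subgroup_conj_sub[OF _ Z(1)] card_conj_sub[OF _ Z.subset] Z(2)
    unfolding conjugates_def by auto
  have ZC: "Z \<in> conjugates Z" using conjugates_self Z.subset by blast
  show "card (conjugates Z) \<ge> 1" using ZC finC by (metis One_nat_def Suc_leI card_gt_0_iff empty_iff)
  let ?P = "(\<lambda>Q. orbit ?Z ?\<phi> Q) ` (conjugates Z - {Z})"
  have orbC: "orbit ?Z ?\<phi> Q \<subseteq> conjugates Z" if Q: "Q \<in> conjugates Z" for Q
  proof
    fix R assume "R \<in> orbit ?Z ?\<phi> Q"
    then obtain g where g: "g \<in> Z" "R = conj_sub g Q" using subC[OF Q] unfolding orbit_def by auto
    obtain k where k: "k \<in> carrier G" "Q = conj_sub k Z" using Q unfolding conjugates_def by blast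
    have "R = conj_sub (g \<otimes> k) Z" using g k conj_sub_mult[of g k Z] Z.subset by auto
    then show "R \<in> conjugates Z" using g k Z.subset unfolding conjugates_def by auto
  qed
  have Zfix: "conj_sub g Z = Z" if "g \<in> Z" for g
    using subgroup_le_nrm[OF Z(1)] that fin Z.subset finite_subset unfolding nrm_def by blast
  have orbZ: "orbit ?Z ?\<phi> Z = {Z}"
  proof -
    have "orbit ?Z ?\<phi> Z = (\<lambda>g. conj_sub g Z) ` Z" using Z.subset unfolding orbit_def by auto
    also have "\<dots> = (\<lambda>g. Z) ` Z" using Zfix by (intro image_cong) auto
    also have "\<dots> = {Z}" using Z.one_closed by blast
    finally show ?thesis .
  qed
  have orbN: "orbit ?Z ?\<phi> Q \<subseteq> conjugates Z - {Z}" if Q: "Q \<in> conjugates Z - {Z}" for Q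
  proof -
    have "Z \<notin> orbit ?Z ?\<phi> Q"
    proof
      assume "Z \<in> orbit ?Z ?\<phi> Q"
      then have "Q \<in> orbit ?Z ?\<phi> Z" using B.orbit_sym[of Q Z] Q subC Z.subset by auto
      then show False using orbZ Q by auto
    qed
    then show ?thesis using orbC Q by blast
  qed
  have un: "\<Union>?P = conjugates Z - {Z}"
  proof
    show "\<Union>?P \<subseteq> conjugates Z - {Z}" using orbN by (simp add: UN_subset_iff)
    show "conjugates Z - {Z} \<subseteq> \<Union>?P"
    proof
      fix Q assume Q: "Q \<in> conjugates Z - {Z}"
      then have "Q \<in> orbit ?Z ?\<phi> Q" using B.orbit_refl[of Q] subC[of Q] by blast
      then show "Q \<in> \<Union>?P" using Q by (metis UN_I)
    qed
  qed
  have "l * card ?P = card (\<Union>?P)"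
  proof (rule card_partition)
    show "finite ?P" "finite (\<Union>?P)" using finC un by auto
    fix c assume "c \<in> ?P"
    then obtain Q where Q: "Q \<in> conjugates Z" "Q \<noteq> Z" "c = orbit ?Z ?\<phi> Q" by blast
    have "card c * card (stabilizer ?Z ?\<phi> Q) = l"
      using B.orbit_stabilizer_theorem[of Q] subC[OF Q(1)] Q(3) Z(2) unfolding order_def by auto
    \<comment> \<open>A conjugate fixed by \<open>Z\<close> would have \<open>Z\<close> in its
      normalizer and so be equal to \<open>Z\<close>.\<close>
    moreover have "card c \<noteq> 1"
    proof
      assume "card c = 1"
      moreover have "Q \<in> c" unfolding Q(3) by (rule B.orbit_refl) (use subC[OF Q(1)] in blast)
      ultimately have cQ: "c = {Q}" by (metis card_1_singletonE singletonD)
      have "conj_sub g Q = Q" if "g \<in> Z" for g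
      proof -
        have "conj_sub g Q \<in> c" unfolding Q(3) orbit_def using that subC[OF Q(1)] by force
        then show ?thesis using cQ by blast
      qed
      then have "Z \<subseteq> nrm Q" unfolding nrm_def using Z.subset by auto
      then show False using prime_subgroup_unique[OF fin Z _ _ l] subC[OF Q(1)] Q by auto
    qed
    ultimately show "card c = l" using l(1) using prime_nat_iff dvd_triv_left by metis
  next
    fix c d assume cd: "c \<in> ?P" "d \<in> ?P" "c \<noteq> d"
    obtain Q where Q: "Q \<in> conjugates Z - {Z}" "c = orbit ?Z ?\<phi> Q" using cd(1) by (rule imageE)
    obtain R where R: "R \<in> conjugates Z - {Z}" "d = orbit ?Z ?\<phi> R" using cd(2) by (rule imageE)
    show "c \<inter> d = {}"
    proof -
      have "c \<in> orbits ?Z ?E ?\<phi>" using Q subC[of Q] unfolding orbits_def by blast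
      moreover have "d \<in> orbits ?Z ?E ?\<phi>" using R subC[of R] unfolding orbits_def by blast
      ultimately show ?thesis using B.disjoint_union cd(3) by metis
    qed
  qed
  then have "l dvd card (conjugates Z - {Z})" using un by (metis dvd_triv_left)
  then show "l dvd card (conjugates Z) - 1" using ZC finC by simp
qed

end

section \<open>Counting elements through conjugates, and criteria for membership in subgroups and
  normalizers\<close>

context group
begin

lemma inv_mult_cancel:
  assumes "g \<in> carrier G" "h \<in> carrier G"
  shows "inv g \<otimes> (g \<otimes> h) = h" "g \<otimes> (inv g \<otimes> h) = h"
  using assms by (simp_all add: m_assoc[symmetric])

lemma card_subgroup_dvd:
  assumes "subgroup H G" "subgroup K G" "K \<subseteq> H"
  shows "card K dvd card H"
proof -
  have "subgroup K (G\<lparr>carrier := H\<rparr>)" using subgroup_incl assms by blast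
  from group.lagrange[OF subgroup_imp_group[OF assms(1)] this]
  have "card (rcosets\<^bsub>G\<lparr>carrier := H\<rparr>\<^esub> K) * card K = card H" by (simp add: order_def)
  then show ?thesis using dvd_triv_right[of "card K" "card (rcosets\<^bsub>G\<lparr>carrier := H\<rparr>\<^esub> K)"] by simp
qed

text \<open>Conjugates of prime order meet only in the identity, so the sets obtained from
  \<open>T\<close> by one chosen conjugator for each conjugate are disjoint. The equivariant map
  \<open>f\<close> allows counting not only the elements of the conjugates (\<open>f\<close> the
  identity) but also the elements whose square lies in one (\<open>f\<close> squaring, needed for
  type (10, 3)).\<close>

lemma card_Union_conjugates:
  assumes fin: "finite (carrier G)" and Z: "subgroup Z G" "card Z = l" "Factorial_Ring.prime l"
    and T: "\<And>g. g \<in> T \<Longrightarrow> g \<in> carrier G \<and> f g \<noteq> \<one>" "\<And>g. g \<in> T \<Longrightarrow> f g \<in> Z"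
    and f: "\<And>c g. c \<in> carrier G \<Longrightarrow> g \<in> carrier G \<Longrightarrow> f (c \<otimes> g \<otimes> inv c) = c \<otimes> f g \<otimes> inv c"
  shows "card (conjugates Z) * card T \<le> card {g \<in> carrier G. f g \<noteq> \<one> \<and> (\<exists>Q\<in>conjugates Z. f g \<in> Q)}"
proof -
  interpret Z: subgroup Z G by fact
  have finC: "finite (conjugates Z)" unfolding conjugates_def using fin by blast
  have TG: "T \<subseteq> carrier G" using T(1) by blast
  have "\<exists>c. c \<in> carrier G \<and> Q = conj_sub c Z" if "Q \<in> conjugates Z" for Q
    using that unfolding conjugates_def by blast
  then obtain c where c: "\<And>Q. Q \<in> conjugates Z \<Longrightarrow> c Q \<in> carrier G \<and> Q = conj_sub (c Q) Z" by metis
  let ?A = "\<lambda>Q. conj_sub (c Q) T"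
  have A: "g \<in> carrier G \<and> f g \<noteq> \<one> \<and> f g \<in> Q" if Q: "Q \<in> conjugates Z" and g: "g \<in> ?A Q" for Q g
  proof -
    obtain t where t: "t \<in> T" "g = c Q \<otimes> t \<otimes> inv (c Q)" using g unfolding conj_sub_def by blast
    have cq: "c Q \<in> carrier G" using c[OF Q] by blast
    have tG: "t \<in> carrier G" "f t \<in> Z" "f t \<in> carrier G" "f t \<noteq> \<one>" using t T Z.subset by auto
    have fg: "f g = c Q \<otimes> f t \<otimes> inv (c Q)" using f cq tG t by simp
    then have "f g \<in> conj_sub (c Q) Z" using tG unfolding conj_sub_def by blast
    moreover have "f g \<noteq> \<one>"
    proof
      assume "f g = \<one>"
      then have "c Q \<otimes> f t \<otimes> inv (c Q) = c Q \<otimes> \<one> \<otimes> inv (c Q)" using fg cq by simp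
      then show False using conjugation_is_inj cq tG by blast
    qed
    ultimately show ?thesis using c[OF Q] cq tG t by auto
  qed
  have meet: "Q = R" if "Q \<in> conjugates Z" "R \<in> conjugates Z" "h \<in> Q" "h \<in> R" "h \<noteq> \<one>" for Q R h
  proof -
    have sub: "subgroup Q G" "subgroup R G" "card Q = l" "card R = l"
      using that c subgroup_conj_sub[OF _ Z(1)] card_conj_sub[OF _ Z.subset] Z(2) by metis+
    have finQ: "finite Q" "finite R" using sub fin finite_subset subgroup.subset by metis+
    have "subgroup (Q \<inter> R) G" using sub subgroups_Inter_pair by blast
    then have "card (Q \<inter> R) dvd l"
      using card_subgroup_dvd[OF sub(1)] sub(3) by auto
    moreover have "{\<one>, h} \<subseteq> Q \<inter> R" using that sub subgroup.one_closed by auto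
    then have "card (Q \<inter> R) \<ge> 2" using that(5) finQ card_mono[of "Q \<inter> R" "{\<one>, h}"] by auto
    ultimately have "card (Q \<inter> R) = l" using Z(3) by (metis One_nat_def Suc_1 not_less_eq_eq order_refl prime_nat_iff)
    then have "Q \<inter> R = Q" "Q \<inter> R = R" using sub finQ card_subset_eq[of Q "Q \<inter> R"] card_subset_eq[of R "Q \<inter> R"] by auto
    then show ?thesis by blast
  qed
  have "card (conjugates Z) * card T = (\<Sum>Q\<in>conjugates Z. card (?A Q))"
    using card_conj_sub[OF _ TG] c by simp
  also have "\<dots> = card (\<Union>Q\<in>conjugates Z. ?A Q)"
  proof (rule card_UN_disjoint[symmetric])
    show "\<forall>Q\<in>conjugates Z. finite (?A Q)" unfolding conj_sub_def using fin TG finite_subset by blast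
    show "\<forall>i\<in>conjugates Z. \<forall>j\<in>conjugates Z. i \<noteq> j \<longrightarrow> conj_sub (c i) T \<inter> conj_sub (c j) T = {}"
    proof (intro ballI impI equals0I)
      fix Q R g assume QR: "Q \<in> conjugates Z" "R \<in> conjugates Z" "Q \<noteq> R" and "g \<in> ?A Q \<inter> ?A R"
      then have "f g \<noteq> \<one>" "f g \<in> Q" "f g \<in> R" using A[OF QR(1)] A[OF QR(2)] by auto
      then show False using meet[OF QR(1,2)] QR(3) by blast
    qed
  qed (rule finC)
  also have "\<dots> \<le> card {g \<in> carrier G. f g \<noteq> \<one> \<and> (\<exists>Q\<in>conjugates Z. f g \<in> Q)}"
  proof (rule card_mono)
    show "(\<Union>Q\<in>conjugates Z. ?A Q) \<subseteq> {g \<in> carrier G. f g \<noteq> \<one> \<and> (\<exists>Q\<in>conjugates Z. f g \<in> Q)}"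
    proof (intro UN_least subsetI CollectI)
      fix Q g assume Q: "Q \<in> conjugates Z" and "g \<in> ?A Q"
      from A[OF this] Q show "g \<in> carrier G \<and> f g \<noteq> \<one> \<and> (\<exists>Q\<in>conjugates Z. f g \<in> Q)" by (intro conjI bexI[of _ Q]) simp_all
    qed
    show "finite {g \<in> carrier G. f g \<noteq> \<one> \<and> (\<exists>Q\<in>conjugates Z. f g \<in> Q)}"
      by (rule finite_subset[OF _ fin]) blast
  qed
  finally show ?thesis .
qed

text \<open>For \<open>g\<close> outside \<open>H\<close>, the sets \<open>H\<close> and
  \<open>g H\<close> exhaust the group, and \<open>g g\<close> in \<open>g H\<close> would put
  \<open>g\<close> into \<open>H\<close>.\<close>

lemma index_two_square:
  assumes fin: "finite (carrier G)" and H: "subgroup H G" "2 * card H = order G" and g: "g \<in> carrier G"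
  shows "g \<otimes> g \<in> H"
proof (cases "g \<in> H")
  case True show ?thesis by (rule subgroup.m_closed[OF H(1) True True])
next
  case False
  interpret H: subgroup H G by fact
  have "inj_on (\<lambda>h. g \<otimes> h) H"
    by (intro inj_onI) (metis g inv_mult_cancel(1) H.mem_carrier)
  then have "card ((\<lambda>h. g \<otimes> h) ` H) = card H" by (rule card_image)
  moreover have dis: "(\<lambda>h. g \<otimes> h) ` H \<inter> H = {}"
  proof (rule ccontr)
    assume "\<not> ?thesis"
    then obtain h where h: "h \<in> H" "g \<otimes> h \<in> H" by blast
    have "(g \<otimes> h) \<otimes> inv h \<in> H" by (rule H.m_closed[OF h(2) H.m_inv_closed[OF h(1)]])
    moreover have "(g \<otimes> h) \<otimes> inv h = g" using h(1) g by (simp add: m_assoc inv_mult_cancel)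
    ultimately show False using False by simp
  qed
  moreover have "finite H" by (rule finite_subset[OF H.subset fin])
  ultimately have "card ((\<lambda>h. g \<otimes> h) ` H \<union> H) = order G" using H(2) by (simp add: card_Un_disjoint)
  moreover have "(\<lambda>h. g \<otimes> h) ` H \<union> H \<subseteq> carrier G" using g by auto
  ultimately have cov: "(\<lambda>h. g \<otimes> h) ` H \<union> H = carrier G"
    using fin card_subset_eq unfolding order_def by metis
  have "g \<otimes> g \<notin> (\<lambda>h. g \<otimes> h) ` H" using False g by auto
  then show ?thesis using cov g by blast
qed

lemma pow_mem_subgroup:
  assumes "subgroup H G" "h \<in> H" shows "h [^] (n::nat) \<in> H"
  using assms by (induction n) (auto simp: subgroup.one_closed subgroup.m_closed)

text \<open>With \<open>ord g = 2 k + 1\<close>, the element \<open>g\<close> equals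
  \<open>(g g)^(k + 1)\<close>.\<close>

lemma odd_ord_square_mem:
  assumes "subgroup H G" "g \<in> carrier G" "g \<otimes> g \<in> H" "odd (ord g)"
  shows "g \<in> H"
proof -
  obtain k where k: "ord g = 2 * k + 1" using assms(4) oddE by blast
  have "(g \<otimes> g) [^] (Suc k) \<in> H" by (rule pow_mem_subgroup) fact+
  moreover have "(g \<otimes> g) [^] (Suc k) = g [^] (2 * Suc k)"
    using assms(2) nat_pow_pow[of g 2 "Suc k"] by (simp add: numeral_2_eq_2)
  moreover have "g [^] (2 * Suc k) = g [^] ord g \<otimes> g" using k by simp
  ultimately show ?thesis using assms(2) by simp
qed

lemma ord_dvd_card:
  assumes "finite (carrier G)" "subgroup H G" "h \<in> H" shows "ord h dvd card H"
proof -
  have hG: "h \<in> carrier G" using assms subgroup.subset by blast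
  have "generate G {h} \<subseteq> H" using assms generate_subgroup_incl by blast
  moreover have "subgroup (generate G {h}) G" using generate_is_subgroup hG by blast
  ultimately have "card (generate G {h}) dvd card H"
    using card_subgroup_dvd[OF assms(2)] by blast
  then show ?thesis using generate_pow_card[OF hG] by simp
qed

text \<open>Conjugation by \<open>g\<close> is multiplicative, so it sends every power of
  \<open>a\<close> into the cyclic group once it does so for \<open>a\<close>; finiteness turns the
  inclusion into an equality.\<close>

lemma mem_nrm_generate:
  assumes fin: "finite (carrier G)" and a: "a \<in> carrier G" and g: "g \<in> carrier G"
    and m: "g \<otimes> a \<otimes> inv g \<in> generate G {a}"
  shows "g \<in> nrm (generate G {a})"
proof -
  let ?H = "generate G {a}"
  have H: "subgroup ?H G" using generate_is_subgroup a by blast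
  have HG: "?H \<subseteq> carrier G" using H subgroup.subset by blast
  have "conj_sub g ?H \<subseteq> ?H"
  proof
    fix b assume "b \<in> conj_sub g ?H"
    then obtain h where h: "h \<in> ?H" "b = g \<otimes> h \<otimes> inv g" unfolding conj_sub_def by blast
    have "ord a \<noteq> 0" using ord_ge_1[OF fin a] by simp
    then obtain k :: nat where k: "h = a [^] k" using h(1) generate_pow_nat[OF a] by blast
    have "g \<otimes> a [^] n \<otimes> inv g = (g \<otimes> a \<otimes> inv g) [^] n" for n :: nat
    proof (induction n)
      case (Suc n)
      have "g \<otimes> a [^] Suc n \<otimes> inv g = g \<otimes> a [^] n \<otimes> (inv g \<otimes> g) \<otimes> a \<otimes> inv g"
        using a g by (simp add: m_assoc inv_mult_cancel)
      also have "\<dots> = (g \<otimes> a [^] n \<otimes> inv g) \<otimes> (g \<otimes> a \<otimes> inv g)"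
        using a g by (simp add: m_assoc inv_mult_cancel)
      finally show ?case using Suc by simp
    qed (use g in auto)
    then show "b \<in> ?H" using h(2) k pow_mem_subgroup[OF H m] by simp
  qed
  then show ?thesis using conj_sub_eq_if_subset[OF g HG] fin finite_subset[OF HG] g unfolding nrm_def by blast
qed

lemma commute_mem_nrm:
  assumes fin: "finite (carrier G)" and a: "a \<in> carrier G" and g: "g \<in> carrier G" and c: "g \<otimes> a = a \<otimes> g"
  shows "g \<in> nrm (generate G {a})"
proof -
  have "g \<otimes> a \<otimes> inv g = a" using a g c by (simp add: m_assoc inv_mult_cancel)
  then show ?thesis using mem_nrm_generate[OF fin a g] generate.incl[of a "{a}" G] by simp
qed

end

section \<open>Finite quotients of triangle groups: \<open>x\<close> turns about a face,
  \<open>y\<close> about a vertex, \<open>x y\<close> about an edge\<close>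

locale rotation_group = group G for G (structure) +
  fixes x y :: 'a
  assumes fin: "finite (carrier G)" and xG[simp]: "x \<in> carrier G" and yG[simp]: "y \<in> carrier G"
    and gen: "carrier G = generate G {x, y}"
    and rel: "(x \<otimes> y) \<otimes> (x \<otimes> y) = \<one>"
begin

abbreviation "X \<equiv> generate G {x}"
abbreviation "Y \<equiv> generate G {y}"

lemma sX: "subgroup X G" and sY: "subgroup Y G"
  using generate_is_subgroup by auto

lemma xX: "x \<in> X" and yY: "y \<in> Y" by (simp_all add: generate.incl)

lemma card_X: "card X = ord x" and card_Y: "card Y = ord y" using generate_pow_card by auto

lemma XG: "X \<subseteq> carrier G" and YG: "Y \<subseteq> carrier G" using sX sY subgroup.subset by auto

text \<open>Left multiplication by a generator is injective and maps the finite set \<open>S\<close>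
  into itself, hence permutes it, so closure under the inverses of the generators is automatic.
  Besides subgroups this covers the union of cosets in \<open>order_if_Y_normal\<close>.\<close>

lemma closed_eq_carrier:
  assumes S: "S \<subseteq> carrier G" "\<one> \<in> S" and c: "\<And>s. s \<in> S \<Longrightarrow> x \<otimes> s \<in> S" "\<And>s. s \<in> S \<Longrightarrow> y \<otimes> s \<in> S"
  shows "S = carrier G"
proof -
  have finS: "finite S" using fin S finite_subset by blast
  have inv_cl: "inv a \<otimes> s \<in> S" if a: "a \<in> carrier G" "\<And>s. s \<in> S \<Longrightarrow> a \<otimes> s \<in> S" and s: "s \<in> S" for a s
  proof -
    have "inj_on (\<lambda>s. a \<otimes> s) S" using a S by (intro inj_onI) (metis inv_mult_cancel(1) subsetD)
    moreover have "(\<lambda>s. a \<otimes> s) ` S \<subseteq> S" using a by auto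
    ultimately have "(\<lambda>s. a \<otimes> s) ` S = S" using finS endo_inj_surj by blast
    then obtain s' where "s' \<in> S" "s = a \<otimes> s'" using s by blast
    then have "inv a \<otimes> s = s'" using a(1) S(1) inv_mult_cancel(1) by blast
    then show ?thesis using \<open>s' \<in> S\<close> by simp
  qed
  have "g \<otimes> s \<in> S" if "g \<in> generate G {x, y}" "s \<in> S" for g s
    using that
  proof (induction g arbitrary: s rule: generate.induct)
    case one then show ?case using S by auto
  next
    case (incl h) then show ?case using c by auto
  next
    case (inv h)
    then consider "h = x" | "h = y" by blast
    then show ?case
    proof cases
      case 1 show ?thesis unfolding 1 by (rule inv_cl[OF xG c(1) inv.prems])
    next
      case 2 show ?thesis unfolding 2 by (rule inv_cl[OF yG c(2) inv.prems])
    qed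
  next
    case (eng h1 h2)
    have "h1 \<in> carrier G" "h2 \<in> carrier G" "s \<in> carrier G" using eng.hyps eng.prems gen S(1) by auto
    then have "h1 \<otimes> h2 \<otimes> s = h1 \<otimes> (h2 \<otimes> s)" by (rule m_assoc)
    then show ?case using eng.IH(1)[OF eng.IH(2)[OF eng.prems]] by simp
  qed
  then have "g \<in> S" if "g \<in> carrier G" for g using that gen S(2) r_one by metis
  then show ?thesis using S by blast
qed

lemma subgroup_eq_carrier:
  assumes "subgroup H G" "x \<in> H" "y \<in> H" shows "H = carrier G"
  using assms by (intro closed_eq_carrier) (auto simp: subgroup.subset subgroup.one_closed subgroup.m_closed)

lemma y_x: "y \<otimes> x = inv x \<otimes> inv y"
proof -
  have "y \<otimes> x = inv x \<otimes> ((x \<otimes> y) \<otimes> (x \<otimes> y)) \<otimes> inv y" by (simp add: m_assoc inv_mult_cancel)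
  then show ?thesis using rel by simp
qed

text \<open>Modulo \<open>Y\<close>, which both generators normalize, the relation
  \<open>x y x y = 1\<close> becomes \<open>x x = 1\<close>, so \<open>G\<close> is covered by
  \<open>Y\<close> and \<open>x Y\<close>.\<close>

lemma order_if_Y_normal:
  assumes "x \<in> nrm Y" shows "order G \<le> 2 * ord y"
proof -
  interpret Y: subgroup Y G by (rule sY)
  have cx: "x \<otimes> h \<otimes> inv x \<in> Y" if "h \<in> Y" for h
    using assms that unfolding nrm_def conj_sub_def by auto
  have cx': "inv x \<otimes> h \<otimes> x \<in> Y" if "h \<in> Y" for h
    using assms that conj_sub_inv[OF xG YG] unfolding nrm_def conj_sub_def by force
  have "x \<otimes> x = inv (x \<otimes> y \<otimes> inv x) \<otimes> ((x \<otimes> y) \<otimes> (x \<otimes> y)) \<otimes> inv y"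
    by (simp add: m_assoc inv_mult_group inv_mult_cancel)
  then have "x \<otimes> x = inv (x \<otimes> y \<otimes> inv x) \<otimes> inv y" using rel by simp
  then have xx: "x \<otimes> x \<in> Y" using cx yY Y.m_closed Y.m_inv_closed by metis
  have "Y \<union> (\<lambda>h. x \<otimes> h) ` Y = carrier G"
  proof (rule closed_eq_carrier)
    show "\<one> \<in> Y \<union> (\<lambda>h. x \<otimes> h) ` Y" using Y.one_closed by blast
    fix s assume "s \<in> Y \<union> (\<lambda>h. x \<otimes> h) ` Y"
    then obtain h where h: "h \<in> Y" "s = h \<or> s = x \<otimes> h" by blast
    have hG: "h \<in> carrier G" using h by auto
    have "x \<otimes> (x \<otimes> h) = (x \<otimes> x) \<otimes> h" using hG by (simp add: m_assoc inv_mult_cancel)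
    then show "x \<otimes> s \<in> Y \<union> (\<lambda>h. x \<otimes> h) ` Y" using h xx Y.m_closed by auto
    have "y \<otimes> (x \<otimes> h) = x \<otimes> ((inv x \<otimes> y \<otimes> x) \<otimes> h)" using hG by (simp add: m_assoc[symmetric])
    then show "y \<otimes> s \<in> Y \<union> (\<lambda>h. x \<otimes> h) ` Y" using h cx'[OF yY] yY Y.m_closed by auto
  qed auto
  then have "order G \<le> card Y + card ((\<lambda>h. x \<otimes> h) ` Y)" unfolding order_def by (metis card_Un_le)
  also have "\<dots> \<le> card Y + card Y"
    using card_image_le[of Y] fin finite_subset[OF YG] by simp
  finally show ?thesis using card_Y by simp
qed

lemma Y_normal_bound:
  assumes "card (conjugates Y) = 1" shows "order G \<le> 2 * ord y"
  using card_conjugates_1[OF YG assms] order_if_Y_normal by simp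

text \<open>The number of conjugates divides the index of \<open>Y\<close> because \<open>Y\<close>
  lies in its own normalizer.\<close>

lemma Y_prime:
  assumes "Factorial_Ring.prime (ord y)" "\<not> (ord y)\<^sup>2 dvd order G"
  shows "ord y dvd card (conjugates Y) - 1" "card (conjugates Y) \<ge> 1"
    "card (conjugates Y) dvd order G div ord y"
proof -
  show "ord y dvd card (conjugates Y) - 1" "card (conjugates Y) \<ge> 1"
    using card_conjugates_cong[OF fin sY card_Y assms] .
  have "ord y dvd card (nrm Y)"
    using ord_dvd_card[OF fin subgroup_nrm[OF YG]] subgroup_le_nrm[OF sY finite_subset[OF YG fin]] yY by blast
  then obtain m where "card (nrm Y) = ord y * m" by (rule dvdE)
  then have "order G = ord y * (card (conjugates Y) * m)" using card_conjugates[OF YG] by (simp add: mult.left_commute)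
  then show "card (conjugates Y) dvd order G div ord y"
    using prime_gt_0_nat[OF assms(1)] by simp
qed

text \<open>The nontrivial elements of the conjugates of \<open>Y\<close> leave no room outside a subgroup \<open>K\<close> whose
  order is prime to that of \<open>Y\<close>, so \<open>K\<close> contains both \<open>x\<close> and \<open>x y\<close>.\<close>

lemma frobenius_complement_False:
  assumes l: "Factorial_Ring.prime (ord y)" "odd (ord y)" "coprime (ord x) (ord y)"
    and K: "subgroup K G" "coprime (card K) (ord y)"
    and n: "card K + card (conjugates Y) * (ord y - 1) = order G"
  shows False
proof -
  interpret K: subgroup K G by fact
  let ?T = "{g \<in> carrier G. g \<noteq> \<one> \<and> (\<exists>Q\<in>conjugates Y. g \<in> Q)}"
  have "card (Y - {\<one>}) = ord y - 1"
    using card_Y finite_subset[OF YG fin] subgroup.one_closed[OF sY] by simp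
  moreover have "card (conjugates Y) * card (Y - {\<one>}) \<le> card ?T"
    by (rule card_Union_conjugates[OF fin sY card_Y l(1)]) (use YG in blast)+
  ultimately have T: "card (conjugates Y) * (ord y - 1) \<le> card ?T" by simp
  have ordT: "ord g = ord y" if g: "g \<in> ?T" for g
  proof -
    from g obtain Q where "Q \<in> conjugates Y" "g \<in> Q" by blast
    then obtain c where c: "c \<in> carrier G" "g \<in> conj_sub c Y" unfolding conjugates_def by blast
    have "ord g dvd ord y"
      using ord_dvd_card[OF fin subgroup_conj_sub[OF c(1) sY] c(2)] card_conj_sub[OF c(1) YG] card_Y by simp
    moreover have "ord g \<noteq> 1" using g ord_eq_1 by auto
    ultimately show ?thesis using l(1) by (auto simp: prime_nat_iff)
  qed
  have KT: "K \<inter> ?T = {}"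
  proof (rule ccontr)
    assume "\<not> ?thesis"
    then obtain g where g: "g \<in> K" "g \<in> ?T" by blast
    then have "ord y dvd card K" using ordT[OF g(2)] ord_dvd_card[OF fin K(1) g(1)] by simp
    then have "ord y = 1" using K(2) coprime_common_divisor_nat[of "card K" "ord y" "ord y"] by simp
    then show False using l(1) by simp
  qed
  have "card (K \<union> ?T) = card K + card ?T"
    using KT fin finite_subset[OF K.subset fin] by (intro card_Un_disjoint) auto
  then have "card (K \<union> ?T) \<ge> order G" using T n by linarith
  moreover have "K \<union> ?T \<subseteq> carrier G" by auto
  ultimately have cov: "K \<union> ?T = carrier G" using card_seteq[OF fin] unfolding order_def by blast
  \<comment> \<open>\<open>K\<close> and the elements of order \<open>ord y\<close> already account
    for the whole group, so any other order forces membership in \<open>K\<close>.\<close>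
  have inK: "g \<in> K" if "g \<in> carrier G" "ord g \<noteq> ord y" for g
  proof -
    have "g \<notin> ?T" using ordT that(2) by blast
    then show ?thesis using cov that(1) by blast
  qed
  have "x \<in> K"
  proof (rule inK)
    show "ord x \<noteq> ord y" using l(1,3) by auto
  qed simp
  moreover have "x \<otimes> y \<in> K"
  proof (rule inK)
    have "ord (x \<otimes> y) dvd 2" using rel pow_eq_id[of "x \<otimes> y" 2] by (simp add: numeral_2_eq_2)
    then show "ord (x \<otimes> y) \<noteq> ord y" using l(1,2) primes_dvd_imp_eq[OF l(1) two_is_prime_nat] by auto
  qed simp
  ultimately have "inv x \<otimes> (x \<otimes> y) \<in> K" by blast
  then have "y \<in> K" by (simp add: m_assoc[symmetric])
  then have "ord y dvd card K" using ord_dvd_card[OF fin K(1)] by simp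
  then have "ord y = 1" using K(2) coprime_common_divisor_nat[of "card K" "ord y" "ord y"] by simp
  then show False using l(1) by simp
qed

section \<open>Exclusion of the seven types, each at its own group order\<close>

lemma no_4_5: assumes "ord x = 4" "ord y = 5" "order G = 80" shows False
proof -
  let ?n = "card (conjugates Y)"
  have n: "5 dvd ?n - 1" "?n \<ge> 1" "?n dvd 16" using Y_prime assms by auto
  have "?n \<le> 16" using n(3) by (rule dvd_imp_le) simp
  then have "?n \<in> {1..16}" using n by simp
  moreover have "{1..16} = {1,2,3,4,5,6,7,8,9,10,11,12,13,14,15,16::nat}" by (auto; presburger)
  ultimately have "?n = 1 \<or> ?n = 16" using n by auto
  moreover have "?n \<noteq> 1" using Y_normal_bound assms by auto
  moreover obtain K where "subgroup K G" "card K = 2 ^ 4"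
    using sylow_thm[OF two_is_prime_nat group_axioms, of 4 5] assms fin by auto
  moreover have "coprime (4::nat) 5" "coprime (16::nat) 5" by (simp_all add: coprime_iff_gcd_eq_1 gcd_non_0_nat)
  \<comment> \<open>Sixteen conjugates contain \<open>16 * 4 = 64\<close> elements of order 5, and a
    Sylow 2-subgroup of order 16 fills the remaining places among 80.\<close>
  ultimately show False using frobenius_complement_False[of K] assms by auto
qed

text \<open>Six subgroups of order 5 leave exactly \<open>30 - 24 = 6\<close> elements, the size of
  the cyclic group \<open>X\<close>, so \<open>X\<close> takes the role of the complement
  \<open>K\<close>.\<close>

lemma no_6_5: assumes "ord x = 6" "ord y = 5" "order G = 30" shows False
proof -
  let ?n = "card (conjugates Y)"
  have n: "5 dvd ?n - 1" "?n \<ge> 1" "?n dvd 6" using Y_prime assms by auto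
  have "?n \<le> 6" using n(3) by (rule dvd_imp_le) simp
  then have "?n \<in> {1..6}" using n by simp
  moreover have "{1..6} = {1,2,3,4,5,6::nat}" by (auto; presburger)
  ultimately have "?n = 1 \<or> ?n = 6" using n by auto
  moreover have "?n \<noteq> 1" using Y_normal_bound assms by auto
  moreover have "coprime (6::nat) 5" by (simp add: coprime_iff_gcd_eq_1 gcd_non_0_nat)
  ultimately show False using frobenius_complement_False[OF _ _ _ sX] card_X assms by auto
qed

text \<open>Only 1 divides 4 and is congruent to 1 modulo 5, so \<open>Y\<close> is normal and
  \<open>G\<close> has at most 10 elements.\<close>

lemma no_10_5: assumes "ord y = 5" "order G = 20" shows False
proof -
  let ?n = "card (conjugates Y)"
  have n: "5 dvd ?n - 1" "?n \<ge> 1" "?n dvd 4" using Y_prime assms by auto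
  have "?n \<le> 4" using n(3) by (rule dvd_imp_le) simp
  then have "?n \<in> {1..4}" using n by simp
  moreover have "{1..4} = {1,2,3,4::nat}" by (auto; presburger)
  ultimately have "?n = 1" using n by auto
  then show False using Y_normal_bound assms by auto
qed

text \<open>\<open>X\<close> has index two and \<open>y\<close> odd order, so \<open>y\<close> lies
  in \<open>X\<close> and \<open>X\<close> is everything, although it has half the order.\<close>

lemma no_18_3: assumes "ord x = 18" "ord y = 3" "order G = 36" shows False
proof -
  have "2 * card X = order G" using card_X assms by simp
  from index_two_square[OF fin sX this yG] have "y \<in> X"
    by (rule odd_ord_square_mem[OF sX yG]) (simp add: assms)
  then have "X = carrier G" using subgroup_eq_carrier[OF sX xX] by simp
  then show False using card_X assms unfolding order_def by simp
qed

text \<open>\<open>X\<close> is the whole group, so \<open>x\<close> and \<open>y\<close> commute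
  and \<open>Y\<close> is normal, which bounds the order by 6.\<close>

lemma no_30_3: assumes "ord x = 30" "ord y = 3" "order G = 30" shows False
proof -
  have "X = carrier G" using card_subset_eq[OF fin XG] card_X assms unfolding order_def by simp
  then have "y \<in> X" by simp
  then obtain k :: nat where "y = x [^] k" using generate_pow_nat[OF xG] assms(1) by auto
  then have "x \<otimes> y = y \<otimes> x" using nat_pow_Suc2[OF xG, of k] nat_pow_Suc[of x k] by simp
  then have "x \<in> nrm Y" using commute_mem_nrm[OF fin yG xG] by blast
  then show False using order_if_Y_normal assms by simp
qed

text \<open>By \<open>y_x\<close>, the conjugate \<open>x y (inv x) = x (y x) inv (x x)\<close>
  equals \<open>(inv y) inv (x x)\<close>. The two factors commute, so powers distribute. This
  confronts the powers of \<open>y\<close> with those of \<open>x x\<close>.\<close>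

lemma conj_pow_if_square_commutes:
  assumes "(x \<otimes> x) \<otimes> y = y \<otimes> (x \<otimes> x)"
  shows "x \<otimes> y [^] n \<otimes> inv x = inv y [^] n \<otimes> inv (x \<otimes> x) [^] (n::nat)"
proof -
  define z where "z = x \<otimes> x"
  have zG: "z \<in> carrier G" and zy: "z \<otimes> y = y \<otimes> z" unfolding z_def using assms by auto
  have "x \<otimes> y \<otimes> inv x = (x \<otimes> (y \<otimes> x)) \<otimes> inv z"
    unfolding z_def by (simp add: m_assoc inv_mult_group inv_mult_cancel)
  then have xyx: "x \<otimes> y \<otimes> inv x = inv y \<otimes> inv z" unfolding y_x using zG by (simp add: inv_mult_cancel)
  have com: "inv y \<otimes> inv z = inv z \<otimes> inv y" using zy zG by (simp add: inv_mult_group[symmetric])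
  have "x \<otimes> y [^] n \<otimes> inv x = (x \<otimes> y \<otimes> inv x) [^] n"
  proof (induction n)
    case (Suc n)
    have "x \<otimes> y [^] Suc n \<otimes> inv x = (x \<otimes> y [^] n \<otimes> inv x) \<otimes> (x \<otimes> y \<otimes> inv x)"
      by (simp add: m_assoc inv_mult_cancel)
    then show ?case using Suc by simp
  qed simp
  also have "\<dots> = inv y [^] n \<otimes> inv z [^] n"
    unfolding xyx by (rule pow_mult_distrib) (use com zG in auto)
  finally show ?thesis unfolding z_def .
qed

text \<open>\<open>Y\<close> has index two, so \<open>z = x x\<close> is a power \<open>y^k\<close>
  and commutes with \<open>x\<close> and \<open>y\<close>. From \<open>z^3 = 1\<close> follows
  \<open>3 dvd k\<close>, hence \<open>z^k = 1\<close>, and conjugation by \<open>x\<close> sends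
  \<open>z = y^k\<close> to \<open>inv z\<close> as well as to \<open>z\<close>. Thus
  \<open>z^2 = z^3 = 1\<close>, so \<open>x x = 1\<close>, against \<open>ord x = 6\<close>.\<close>

lemma no_6_9: assumes "ord x = 6" "ord y = 9" "order G = 18" shows False
proof -
  have "2 * card Y = order G" using card_Y assms by simp
  from index_two_square[OF fin sY this xG] obtain k :: nat where k: "x \<otimes> x = y [^] k"
    using generate_pow_nat[OF yG] assms(2) by auto
  define z where "z = x \<otimes> x"
  have zG: "z \<in> carrier G" unfolding z_def by simp
  have x6: "z [^] (3::nat) = \<one>"
    using nat_pow_pow[of x 2 3] pow_ord_eq_1[OF xG] assms(1) by (simp add: z_def numeral_2_eq_2)
  then have "y [^] (k * 3) = \<one>" using k nat_pow_pow[OF yG] by (simp add: z_def)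
  then have "9 dvd k * 3" using pow_eq_id[OF yG] assms(2) by simp
  then have "3 dvd k" by presburger
  then obtain j where j: "k = 3 * j" by (rule dvdE)
  have zy: "(x \<otimes> x) \<otimes> y = y \<otimes> (x \<otimes> x)"
    using k nat_pow_Suc2[OF yG, of k] nat_pow_Suc[of y k] by simp
  have zk: "z = y [^] k" using k unfolding z_def .
  have "z [^] k = \<one>" using x6 nat_pow_pow[OF zG, of 3 j] j by simp
  then have "inv z [^] k = \<one>" using nat_pow_inv[OF zG, of k] by simp
  then have "x \<otimes> z \<otimes> inv x = inv y [^] k"
    using conj_pow_if_square_commutes[OF zy, of k] zk[symmetric] by (simp add: z_def)
  moreover have "x \<otimes> z \<otimes> inv x = z" unfolding z_def by (simp add: m_assoc)
  ultimately have "z = inv z" using nat_pow_inv[OF yG, of k] zk by simp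
  then have "z \<otimes> z = \<one>" using r_inv[OF zG] by simp
  then have "y [^] (k + k) = \<one>" using zk nat_pow_mult[OF yG, of k k] by simp
  then have "9 dvd k + k" using pow_eq_id[OF yG] assms(2) by simp
  then have "9 dvd k" by presburger
  then have "x \<otimes> x = \<one>" using k pow_eq_id[OF yG] assms(2) by simp
  then have "ord x dvd 2" using pow_eq_id[OF xG, of 2] by (simp add: numeral_2_eq_2)
  then show False using assms(1) by auto
qed

end

lemma (in group) conj_pow_iterate:
  assumes a: "a \<in> carrier G" and b: "b \<in> carrier G" and k: "a \<otimes> b \<otimes> inv a = b [^] k"
  shows "a [^] m \<otimes> b \<otimes> inv (a [^] m) = b [^] (k ^ m :: nat)"
proof (induction m)
  case (Suc m)
  have pw: "a \<otimes> b [^] n \<otimes> inv a = b [^] (k * n)" for n :: nat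
  proof (induction n)
    case (Suc n)
    have "a \<otimes> b [^] Suc n \<otimes> inv a = (a \<otimes> b [^] n \<otimes> inv a) \<otimes> (a \<otimes> b \<otimes> inv a)"
      using a b by (simp add: m_assoc inv_mult_cancel)
    then show ?case using Suc k b by (simp add: nat_pow_mult add.commute)
  qed (use a in simp)
  have "a [^] Suc m \<otimes> b \<otimes> inv (a [^] Suc m) = a \<otimes> (a [^] m \<otimes> b \<otimes> inv (a [^] m)) \<otimes> inv a"
    using a b by (simp only: nat_pow_Suc2) (simp add: m_assoc inv_mult_group)
  then show ?case using Suc pw by simp
qed (use b in simp)

text \<open>Conjugation by \<open>a\<close> raises \<open>b\<close> to some power \<open>k\<close>,
  and \<open>a^m = 1\<close> forces \<open>k^m = 1\<close> modulo \<open>ord b\<close>. By the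
  arithmetic premise \<open>ar\<close> only \<open>k = 1\<close> is possible, so the action is
  trivial.\<close>

lemma (in group) commute_if_normalizes:
  assumes fin: "finite (carrier G)" and a: "a \<in> carrier G" and b: "b \<in> carrier G"
    and n: "a \<in> nrm (generate G {b})" and m: "a [^] (m::nat) = \<one>"
    and ar: "\<And>k :: nat. k < ord b \<Longrightarrow> k ^ m mod ord b = 1 mod ord b \<Longrightarrow> k = 1"
  shows "a \<otimes> b = b \<otimes> a"
proof -
  have "a \<otimes> b \<otimes> inv a \<in> generate G {b}"
    using n generate.incl[of b "{b}" G] unfolding nrm_def conj_sub_def by blast
  moreover have ob: "ord b \<noteq> 0" using ord_ge_1[OF fin b] by simp
  ultimately obtain k' :: nat where k': "a \<otimes> b \<otimes> inv a = b [^] k'" using generate_pow_nat[OF b] by blast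
  define k where "k = k' mod ord b"
  have "b [^] k' = b [^] (ord b * (k' div ord b)) \<otimes> b [^] k"
    using b unfolding k_def by (simp add: nat_pow_mult)
  moreover have "b [^] (ord b * (k' div ord b)) = \<one>" using pow_eq_id[OF b] by simp
  ultimately have k: "a \<otimes> b \<otimes> inv a = b [^] k" using k' b by simp
  have "b [^] (k ^ m) = b" using conj_pow_iterate[OF a b k, of m] m b by simp
  have "k ^ m mod ord b = 1 mod ord b"
  proof (cases "k ^ m")
    case 0
    have "b = \<one>" using \<open>b [^] (k ^ m) = b\<close> unfolding 0 by simp
    then show ?thesis using b by (simp add: ord_id)
  next
    case (Suc l)
    then have "b [^] l \<otimes> b \<otimes> inv b = b \<otimes> inv b" using \<open>b [^] (k ^ m) = b\<close> by simp
    then have "b [^] l = \<one>" using b by (simp add: m_assoc)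
    then have "ord b dvd l" using pow_eq_id[OF b] by simp
    then show ?thesis using Suc by (metis mod_Suc_eq One_nat_def dvd_imp_mod_0)
  qed
  then have "k = 1" using ar[of k] ob unfolding k_def by simp
  then have "a \<otimes> b \<otimes> inv a = b" using k b by simp
  then have "a \<otimes> b \<otimes> inv a \<otimes> a = b \<otimes> a" by simp
  then show ?thesis using a b by (simp add: m_assoc)
qed

context rotation_group
begin

text \<open>Let \<open>z = x x\<close>, of order 5. If \<open>z\<close> commuted with
  \<open>y\<close>, conjugating \<open>y^3 = 1\<close> by \<open>x\<close> would give
  \<open>z^3 = 1\<close>. This excludes that the group of \<open>z\<close> is normal and that
  \<open>Y\<close> has four conjugates, which leaves six and ten conjugates. But then there are
  \<open>10 * 2\<close> elements of order 3 and \<open>6 * 8\<close> of order 5 or 10, more than 60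
  in all.\<close>

lemma no_10_3: assumes ox: "ord x = 10" and oy: "ord y = 3" and oG: "order G = 60" shows False
proof -
  define z where "z = x \<otimes> x"
  have zG: "z \<in> carrier G" unfolding z_def by simp
  have zx2: "z = x [^] (2::nat)" unfolding z_def by (simp add: numeral_2_eq_2)
  have oz: "ord z = 5" unfolding zx2 using ord_pow[OF xG, of 2] ox by simp
  have y3: "y [^] (3::nat) = \<one>" using pow_ord_eq_1[OF yG] oy by simp
  have z5: "z [^] (5::nat) = \<one>" using pow_ord_eq_1[OF zG] oz by simp
  have nocom: "z \<otimes> y \<noteq> y \<otimes> z"
  proof
    assume "z \<otimes> y = y \<otimes> z"
    then have "(x \<otimes> x) \<otimes> y = y \<otimes> (x \<otimes> x)" unfolding z_def .
    from conj_pow_if_square_commutes[OF this, of 3] have "inv z [^] (3::nat) = \<one>"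
      using y3 nat_pow_inv[OF yG, of 3] unfolding z_def by simp
    then have "z [^] (3::nat) = \<one>" using nat_pow_inv[OF zG, of 3] zG by (simp add: inv_eq_1_iff)
    then show False using pow_eq_id[OF zG, of 3] oz by simp
  qed
  let ?Z = "generate G {z}"
  have sZ: "subgroup ?Z G" using generate_is_subgroup zG by blast
  have ZG: "?Z \<subseteq> carrier G" using sZ subgroup.subset by blast
  have cZ: "card ?Z = 5" using generate_pow_card[OF zG] oz by simp
  have p5: "Factorial_Ring.prime (5::nat)" "\<not> (5::nat)\<^sup>2 dvd order G" using oG by auto
  let ?n = "card (conjugates ?Z)"
  \<comment> \<open>Since \<open>x\<close> itself normalizes the group of \<open>z\<close>, ten
    divides the order of the normalizer and at most six conjugates remain.\<close>
  have "x \<in> nrm ?Z" by (rule commute_mem_nrm[OF fin zG xG]) (simp add: z_def m_assoc)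
  then have "10 dvd card (nrm ?Z)" using ord_dvd_card[OF fin subgroup_nrm[OF ZG]] ox by metis
  then obtain m where m: "card (nrm ?Z) = 10 * m" by (rule dvdE)
  have "?n * (10 * m) = 60" using card_conjugates[OF ZG] oG m by simp
  then have "6 = ?n * m" by (simp add: mult.commute)
  then have "?n dvd 6" by (rule dvdI)
  then have "?n \<le> 6" by (rule dvd_imp_le) simp
  have "?n \<noteq> 1"
  proof
    assume "?n = 1"
    then have "y \<in> nrm ?Z" using card_conjugates_1[OF ZG] by simp
    then have "y \<otimes> z = z \<otimes> y"
    proof (rule commute_if_normalizes[OF fin yG zG _ y3])
      fix k :: nat assume "k < ord z" "k ^ 3 mod ord z = 1 mod ord z"
      then have "k = 0 \<or> k = 1 \<or> k = 2 \<or> k = 3 \<or> k = 4" "k ^ 3 mod 5 = 1" using oz by auto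
      then show "k = 1" by auto
    qed
    then show False using nocom by simp
  qed
  moreover have "5 dvd ?n - 1" "?n \<ge> 1" using card_conjugates_cong[OF fin sZ cZ p5] .
  ultimately have n6: "?n = 6" using \<open>?n \<le> 6\<close> by presburger
  let ?n3 = "card (conjugates Y)"
  have n3: "3 dvd ?n3 - 1" "?n3 \<ge> 1" "?n3 dvd 20" using Y_prime oy oG by auto
  have "?n3 \<le> 20" using n3(3) by (rule dvd_imp_le) simp
  then have "?n3 \<in> {1..20}" using n3 by simp
  moreover have "{1..20} = {1,2,3,4,5,6,7,8,9,10,11,12,13,14,15,16,17,18,19,20::nat}" by (auto; presburger)
  ultimately have "?n3 = 1 \<or> ?n3 = 4 \<or> ?n3 = 10" using n3 by auto
  moreover have "?n3 \<noteq> 1" using Y_normal_bound oy oG by auto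
  moreover have "?n3 \<noteq> 4"
  proof
    \<comment> \<open>A group of order 5 acting on four conjugates fixes each of them, in particular
      \<open>Y\<close>; and an element of order 5 acts trivially on a group of order 3.\<close>
    assume n4: "?n3 = 4"
    let ?\<phi> = "\<lambda>g. \<lambda>H \<in> {H. H \<subseteq> carrier G}. conj_sub g H"
    let ?GZ = "G\<lparr>carrier := ?Z\<rparr>"
    interpret B: group_action ?GZ "{H. H \<subseteq> carrier G}" ?\<phi>
      by (rule group_action.induced_action[OF conj_sub_action sZ])
    have "card (orbit ?GZ ?\<phi> Y) * card (stabilizer ?GZ ?\<phi> Y) = 5"
      using B.orbit_stabilizer_theorem[of Y] YG cZ unfolding order_def by simp
    then have "card (orbit ?GZ ?\<phi> Y) dvd 5" by (metis dvd_triv_left)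
    then have "card (orbit ?GZ ?\<phi> Y) = 1 \<or> card (orbit ?GZ ?\<phi> Y) = 5" using p5(1) by (auto simp: prime_nat_iff)
    moreover have "orbit ?GZ ?\<phi> Y \<subseteq> conjugates Y"
      using YG ZG unfolding orbit_def conjugates_def by auto
    then have "card (orbit ?GZ ?\<phi> Y) \<le> 4"
      using card_mono[of "conjugates Y" "orbit ?GZ ?\<phi> Y"] n4 card.infinite[of "conjugates Y"] by fastforce
    ultimately have "card (orbit ?GZ ?\<phi> Y) = 1" by linarith
    then obtain P where P: "orbit ?GZ ?\<phi> Y = {P}" by (rule card_1_singletonE)
    have "Y \<in> orbit ?GZ ?\<phi> Y" by (rule B.orbit_refl) (use YG in simp)
    moreover have "conj_sub z Y \<in> orbit ?GZ ?\<phi> Y"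
      using YG generate.incl[of z "{z}" G] unfolding orbit_def by force
    ultimately have "z \<in> nrm Y" using P zG unfolding nrm_def by simp
    then have "z \<otimes> y = y \<otimes> z"
    proof (rule commute_if_normalizes[OF fin zG yG _ z5])
      fix k :: nat assume "k < ord y" "k ^ 5 mod ord y = 1 mod ord y"
      then have "k = 0 \<or> k = 1 \<or> k = 2" "k ^ 5 mod 3 = 1" using oy by auto
      then show "k = 1" by auto
    qed
    then show False using nocom by simp
  qed
  moreover have "?n3 \<noteq> 10"
  proof
    assume n10: "?n3 = 10"
    let ?T3 = "{g \<in> carrier G. g \<noteq> \<one> \<and> (\<exists>Q\<in>conjugates Y. g \<in> Q)}"
    let ?T5 = "{g \<in> carrier G. g \<otimes> g \<noteq> \<one> \<and> (\<exists>Q\<in>conjugates ?Z. g \<otimes> g \<in> Q)}"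
    have "card (Y - {\<one>}) = 2"
      using card_Y finite_subset[OF YG fin] subgroup.one_closed[OF sY] oy by simp
    moreover have "card (conjugates Y) * card (Y - {\<one>}) \<le> card ?T3"
      by (rule card_Union_conjugates[OF fin sY card_Y]) (use YG oy in auto)
    ultimately have T3: "20 \<le> card ?T3" using n10 by simp
    \<comment> \<open>All exponents modulo 10 except 0 and 5: exactly these powers of
      \<open>x\<close> have a nontrivial square.\<close>
    let ?I = "{1,2,3,4,6,7,8,9::nat}"
    let ?U = "(\<lambda>i. x [^] i) ` ?I"
    have "card ?U = card ?I"
    proof (rule card_image, rule inj_on_subset[OF ord_inj[OF xG]])
      show "?I \<subseteq> {0..ord x - 1}" using ox by auto
    qed
    moreover have "?n * card ?U \<le> card ?T5"
    proof (rule card_Union_conjugates[OF fin sZ cZ p5(1)])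
      fix g assume "g \<in> ?U"
      then obtain i where i: "i \<in> ?I" "g = x [^] i" by blast
      have g2: "g \<otimes> g = x [^] (2 * i)" using i(2) by (simp add: nat_pow_mult mult_2)
      have "\<not> 10 dvd 2 * i" using i(1) by auto
      then show "g \<in> carrier G \<and> g \<otimes> g \<noteq> \<one>" using g2 i(2) pow_eq_id[OF xG] ox by simp
      have "g \<otimes> g = z [^] i" unfolding g2 zx2 using nat_pow_pow[OF xG] by simp
      then show "g \<otimes> g \<in> ?Z" using pow_mem_subgroup[OF sZ] generate.incl[of z "{z}" G] by simp
    next
      fix c g assume "c \<in> carrier G" "g \<in> carrier G"
      then show "(c \<otimes> g \<otimes> inv c) \<otimes> (c \<otimes> g \<otimes> inv c) = c \<otimes> (g \<otimes> g) \<otimes> inv c"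
        by (simp add: m_assoc inv_mult_cancel)
    qed
    ultimately have T5: "48 \<le> card ?T5" using n6 by simp
    \<comment> \<open>A common element would satisfy \<open>g^9 = 1\<close> and
      \<open>g^10 = 1\<close>.\<close>
    have "?T3 \<inter> ?T5 = {}"
    proof (rule ccontr)
      assume "\<not> ?thesis"
      then obtain g Q R where g: "g \<in> carrier G" "g \<otimes> g \<noteq> \<one>" "Q \<in> conjugates Y" "g \<in> Q"
        "R \<in> conjugates ?Z" "g \<otimes> g \<in> R" by blast
      obtain c d where c: "c \<in> carrier G" "Q = conj_sub c Y" and d: "d \<in> carrier G" "R = conj_sub d ?Z"
        using g unfolding conjugates_def by blast
      have "ord g dvd 3" using ord_dvd_card[OF fin subgroup_conj_sub[OF c(1) sY]] c g card_conj_sub[OF c(1) YG] card_Y oy by simp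
      then have "g [^] (9::nat) = \<one>" using pow_eq_id[OF g(1), of 9] dvd_trans[of "ord g" 3 9] by simp
      moreover have "ord (g \<otimes> g) dvd 5" using ord_dvd_card[OF fin subgroup_conj_sub[OF d(1) sZ]] d g card_conj_sub[OF d(1) ZG] cZ by simp
      then have "(g \<otimes> g) [^] (5::nat) = \<one>" using pow_eq_id[of "g \<otimes> g" 5] g(1) by simp
      then have "g [^] (10::nat) = \<one>" using nat_pow_pow[OF g(1), of 2 5] g(1) by (simp add: numeral_2_eq_2)
      moreover have "g [^] (10::nat) = g [^] (9::nat) \<otimes> g" using nat_pow_Suc[of g 9] by simp
      ultimately have "g = \<one>" using g(1) by simp
      then show False using g by simp
    qed
    then have "card (?T3 \<union> ?T5) = card ?T3 + card ?T5"
      by (intro card_Un_disjoint) (auto intro: finite_subset[OF _ fin])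
    moreover have "card (?T3 \<union> ?T5) \<le> order G"
      unfolding order_def by (rule card_mono[OF fin]) blast
    ultimately show False using T3 T5 oG by linarith
  qed
  ultimately show False by blast
qed

end

section \<open>The rotation group of a regular set of flags\<close>

text \<open>The combinatorial residue of a regular tessellation of an orientable surface.
  Connectedness is stated as indecomposability and symmetries appear only as maps commuting with the
  involutions, so that no topology occurs in the group theory.\<close>

locale regular_flags =
  fixes \<Omega> :: "'b set" and r0 r1 r2 :: "'b \<Rightarrow> 'b" and \<kappa> :: "'b \<Rightarrow> bool"
  assumes finO: "finite \<Omega>"
    and r_closed: "w \<in> \<Omega> \<Longrightarrow> r0 w \<in> \<Omega>" "w \<in> \<Omega> \<Longrightarrow> r1 w \<in> \<Omega>" "w \<in> \<Omega> \<Longrightarrow> r2 w \<in> \<Omega>"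
    and r_invol: "w \<in> \<Omega> \<Longrightarrow> r0 (r0 w) = w" "w \<in> \<Omega> \<Longrightarrow> r1 (r1 w) = w" "w \<in> \<Omega> \<Longrightarrow> r2 (r2 w) = w"
    and r02: "w \<in> \<Omega> \<Longrightarrow> r0 (r2 w) = r2 (r0 w)"
    and r_\<kappa>: "w \<in> \<Omega> \<Longrightarrow> \<kappa> (r0 w) \<noteq> \<kappa> w" "w \<in> \<Omega> \<Longrightarrow> \<kappa> (r1 w) \<noteq> \<kappa> w" "w \<in> \<Omega> \<Longrightarrow> \<kappa> (r2 w) \<noteq> \<kappa> w"
    and conn: "A \<subseteq> \<Omega> \<Longrightarrow> A \<noteq> {} \<Longrightarrow> (\<And>w. w \<in> A \<Longrightarrow> r0 w \<in> A \<and> r1 w \<in> A \<and> r2 w \<in> A) \<Longrightarrow> A = \<Omega>"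
    and transitive: "v \<in> \<Omega> \<Longrightarrow> w \<in> \<Omega> \<Longrightarrow>
      \<exists>\<pi>. (\<forall>u\<in>\<Omega>. \<pi> u \<in> \<Omega> \<and> \<pi> (r0 u) = r0 (\<pi> u) \<and> \<pi> (r1 u) = r1 (\<pi> u) \<and> \<pi> (r2 u) = r2 (\<pi> u)) \<and> \<pi> v = w"
begin

abbreviation "B \<equiv> BijGroup \<Omega>"

text \<open>Restricted to \<open>\<Omega>\<close> because the elements of \<open>BijGroup\<close>
  are extensional.\<close>

definition rt :: "('b \<Rightarrow> 'b) \<Rightarrow> ('b \<Rightarrow> 'b) \<Rightarrow> 'b \<Rightarrow> 'b" where
  "rt r s = (\<lambda>w\<in>\<Omega>. r (s w))"

definition auts :: "('b \<Rightarrow> 'b) set" where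
  "auts = {\<pi>. \<forall>u\<in>\<Omega>. \<pi> u \<in> \<Omega> \<and> \<pi> (r0 u) = r0 (\<pi> u) \<and> \<pi> (r1 u) = r1 (\<pi> u) \<and> \<pi> (r2 u) = r2 (\<pi> u)}"

text \<open>An ambient subgroup that contains all even words in the involutions and still acts
  freely, so that freeness is proved once for all generated subgroups.\<close>

definition K :: "('b \<Rightarrow> 'b) set" where
  "K = {f \<in> Bij \<Omega>. \<forall>w\<in>\<Omega>. \<kappa> (f w) = \<kappa> w \<and> (\<forall>\<pi>\<in>auts. f (\<pi> w) = \<pi> (f w))}"

sublocale B: group B by (rule group_BijGroup)

lemma B_mult: "f \<in> Bij \<Omega> \<Longrightarrow> g \<in> Bij \<Omega> \<Longrightarrow> f \<otimes>\<^bsub>B\<^esub> g = (\<lambda>w\<in>\<Omega>. f (g w))"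
  by (simp add: BijGroup_def compose_def)

lemma B_carrier: "carrier B = Bij \<Omega>" and B_one: "\<one>\<^bsub>B\<^esub> = (\<lambda>w\<in>\<Omega>. w)"
  by (simp_all add: BijGroup_def)

lemma Bij_mem: "f \<in> Bij \<Omega> \<Longrightarrow> w \<in> \<Omega> \<Longrightarrow> f w \<in> \<Omega>"
  using Bij_imp_funcset by blast

lemma rs_mem:
  assumes "r \<in> {r0, r1, r2}" "w \<in> \<Omega>" shows "r w \<in> \<Omega>" "r (r w) = w" "\<kappa> (r w) \<noteq> \<kappa> w"
    "\<pi> \<in> auts \<Longrightarrow> \<pi> (r w) = r (\<pi> w)"
  using assms r_closed r_invol r_\<kappa> unfolding auts_def by auto

lemma rt_Bij:
  assumes "r \<in> {r0, r1, r2}" "s \<in> {r0, r1, r2}" shows "rt r s \<in> Bij \<Omega>"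
proof -
  have "bij_betw (rt r s) \<Omega> \<Omega>"
    by (rule bij_betw_byWitness[where f' = "rt s r"])
       (use rs_mem[OF assms(1)] rs_mem[OF assms(2)] in \<open>auto simp: rt_def\<close>)
  then show ?thesis unfolding Bij_def by (simp add: rt_def)
qed

lemma rt_mult:
  assumes "r \<in> {r0, r1, r2}" "s \<in> {r0, r1, r2}" "t \<in> {r0, r1, r2}" "u \<in> {r0, r1, r2}"
  shows "rt r s \<otimes>\<^bsub>B\<^esub> rt t u = (\<lambda>w\<in>\<Omega>. r (s (t (u w))))"
  unfolding B_mult[OF rt_Bij[OF assms(1,2)] rt_Bij[OF assms(3,4)]]
  by (rule restrict_ext) (use rs_mem(1)[OF assms(3)] rs_mem(1)[OF assms(4)] in \<open>simp add: rt_def\<close>)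

lemma inv_rt:
  assumes "r \<in> {r0, r1, r2}" "s \<in> {r0, r1, r2}" shows "inv\<^bsub>B\<^esub> (rt r s) = rt s r"
proof (rule B.inv_equality)
  show "rt s r \<otimes>\<^bsub>B\<^esub> rt r s = \<one>\<^bsub>B\<^esub>"
    unfolding rt_mult[OF assms(2,1) assms] B_one
    by (rule restrict_ext) (use rs_mem[OF assms(1)] rs_mem[OF assms(2)] in simp)
qed (use rt_Bij assms in \<open>simp_all add: B_carrier\<close>)

lemma rt_K:
  assumes "r \<in> {r0, r1, r2}" "s \<in> {r0, r1, r2}" shows "rt r s \<in> K"
proof -
  have "\<pi> w \<in> \<Omega>" if "\<pi> \<in> auts" "w \<in> \<Omega>" for \<pi> w using that unfolding auts_def by blast
  then show ?thesis
    unfolding K_def using rt_Bij[OF assms] rs_mem[OF assms(1)] rs_mem[OF assms(2)] by (auto simp: rt_def)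
qed

lemma subgroup_K: "subgroup K B"
proof (rule B.subgroupI)
  show "K \<subseteq> carrier B" unfolding K_def B_carrier by blast
  show "K \<noteq> {}" using rt_K by blast
  have aut: "\<pi> w \<in> \<Omega>" if "\<pi> \<in> auts" "w \<in> \<Omega>" for \<pi> w using that unfolding auts_def by blast
  fix f assume f: "f \<in> K"
  then have fB: "f \<in> Bij \<Omega>" unfolding K_def by blast
  define fi where "fi = inv\<^bsub>B\<^esub> f"
  have iB: "fi \<in> Bij \<Omega>" using fB B.inv_closed unfolding B_carrier fi_def by blast
  have "(fi \<otimes>\<^bsub>B\<^esub> f) w = w" "(f \<otimes>\<^bsub>B\<^esub> fi) w = w" if "w \<in> \<Omega>" for w
    using that fB B.l_inv[of f] B.r_inv[of f] unfolding B_carrier fi_def by (simp_all add: B_one)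
  then have i: "fi (f w) = w" "f (fi w) = w" if "w \<in> \<Omega>" for w
    using that B_mult[OF iB fB] B_mult[OF fB iB] by simp_all
  have "fi \<in> K" unfolding K_def
  proof (intro CollectI conjI ballI iB)
    fix w assume w: "w \<in> \<Omega>"
    have iw: "fi w \<in> \<Omega>" using Bij_mem[OF iB w] .
    show "\<kappa> (fi w) = \<kappa> w" using f iw i(2)[OF w] unfolding K_def by force
    fix \<pi> assume p: "\<pi> \<in> auts"
    have "f (\<pi> (fi w)) = \<pi> w" using f iw i(2)[OF w] p unfolding K_def by force
    then show "fi (\<pi> w) = \<pi> (fi w)" using i(1)[OF aut[OF p iw]] by simp
  qed
  then show "inv\<^bsub>B\<^esub> f \<in> K" unfolding fi_def .
  fix g assume g: "g \<in> K"
  then have gB: "g \<in> Bij \<Omega>" unfolding K_def by blast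
  have "f \<otimes>\<^bsub>B\<^esub> g \<in> Bij \<Omega>" using fB gB B.m_closed unfolding B_carrier by blast
  then show "f \<otimes>\<^bsub>B\<^esub> g \<in> K"
    using f g Bij_mem[OF gB] aut unfolding K_def by (auto simp: B_mult[OF fB gB])
qed

text \<open>Some automorphism carries \<open>w\<close> to any given flag, and both maps commute with
  it.\<close>

lemma K_free:
  assumes f: "f \<in> K" "g \<in> K" and w: "w \<in> \<Omega>" and eq: "f w = g w"
  shows "f = g"
proof
  fix v
  show "f v = g v"
  proof (cases "v \<in> \<Omega>")
    case True
    then obtain \<pi> where p: "\<pi> \<in> auts" "\<pi> w = v" using transitive[OF w True] unfolding auts_def by blast
    have "f (\<pi> w) = \<pi> (f w)" "g (\<pi> w) = \<pi> (g w)" using f w p(1) unfolding K_def by auto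
    then show ?thesis using eq p(2) by simp
  next
    case False
    have ext: "f \<in> extensional \<Omega>" "g \<in> extensional \<Omega>" using f Bij_imp_extensional unfolding K_def by auto
    show ?thesis unfolding ext(1)[THEN extensional_arb, OF False] ext(2)[THEN extensional_arb, OF False] ..
  qed
qed

text \<open>As the action is free, the generated group \<open>H\<close> corresponds bijectively to
  the orbit \<open>S\<close> of \<open>w\<close>. All flags of \<open>S\<close> have the colour of
  \<open>w\<close>, and those of its image under \<open>r1\<close> the other colour; together they
  are closed under \<open>R\<close>, hence fill the component \<open>T\<close>. Applied to all
  flags, to a face and to a vertex, this turns flag counts into group orders.\<close>

lemma card_component:
  assumes W: "W = (\<lambda>(r, s). rt r s) ` P" "P \<subseteq> {r0, r1, r2} \<times> {r0, r1, r2}"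
    and R: "R \<subseteq> {r0, r1, r2}" "\<And>r. r \<in> R \<Longrightarrow> rt r r1 \<in> generate B W \<and> rt r1 r \<in> generate B W"
    and T: "T \<subseteq> \<Omega>" "w \<in> T" "\<And>u r. r \<in> R \<Longrightarrow> u \<in> T \<Longrightarrow> r u \<in> T" "\<And>u. u \<in> T \<Longrightarrow> r1 u \<in> T"
    and WT: "\<And>r s u. (r, s) \<in> P \<Longrightarrow> u \<in> T \<Longrightarrow> r (s u) \<in> T \<and> s (r u) \<in> T"
    and minimal: "\<And>A. A \<subseteq> T \<Longrightarrow> w \<in> A \<Longrightarrow> (\<And>u r. r \<in> R \<Longrightarrow> u \<in> A \<Longrightarrow> r u \<in> A) \<Longrightarrow> A = T"
  shows "card T = 2 * card (generate B W)"
proof -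
  let ?H = "generate B W"
  define S where "S = (\<lambda>f. f w) ` ?H"
  have w: "w \<in> \<Omega>" using T by blast
  have WB: "W \<subseteq> carrier B" using W rt_Bij unfolding B_carrier by fast
  have sH: "subgroup ?H B" by (rule B.generate_is_subgroup[OF WB])
  have HK: "?H \<subseteq> K" by (rule B.generate_subgroup_incl[OF _ subgroup_K]) (use W rt_K in fast)
  have HB: "f \<in> Bij \<Omega>" if "f \<in> ?H" for f using that HK unfolding K_def by blast
  have inj: "inj_on (\<lambda>f. f w) ?H" by (rule inj_onI, rule K_free[OF _ _ w]) (use HK in auto)
  have S\<Omega>: "u \<in> \<Omega>" if "u \<in> S" for u using Bij_mem[OF HB w] that unfolding S_def by (elim imageE) simp
  have \<kappa>S: "\<kappa> u = \<kappa> w" if u: "u \<in> S" for u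
  proof -
    obtain f where "f \<in> ?H" "u = f w" using u unfolding S_def by (rule imageE)
    then show ?thesis using HK w unfolding K_def by auto
  qed
  have finS: "finite S" by (rule finite_subset[OF _ finO]) (use S\<Omega> in blast)
  have dis: "S \<inter> r1 ` S = {}"
  proof (intro equals0I)
    fix u assume u: "u \<in> S \<inter> r1 ` S"
    then obtain v where v: "v \<in> S" "u = r1 v" by blast
    show False using r_\<kappa>(2)[OF S\<Omega>[OF v(1)]] \<kappa>S[of u] \<kappa>S[OF v(1)] v(2) u by simp
  qed
  have "inj_on r1 S" by (rule inj_on_inverseI[of _ r1]) (use r_invol(2) S\<Omega> in blast)
  then have "card (S \<union> r1 ` S) = 2 * card S"
    using dis finS by (simp add: card_Un_disjoint card_image)
  moreover have "card S = card ?H" using card_image[OF inj] unfolding S_def .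
  ultimately have cS: "card (S \<union> r1 ` S) = 2 * card ?H" by simp
  have oneH: "\<one>\<^bsub>B\<^esub> \<in> ?H" by (rule generate.one)
  have wS: "w \<in> S" using imageI[OF oneH, of "\<lambda>f. f w"] w by (simp add: B_one S_def)
  have HS: "f u \<in> S" if f: "f \<in> ?H" and u: "u \<in> S" for f u
  proof -
    obtain g where g: "g \<in> ?H" "u = g w" using u unfolding S_def by (rule imageE)
    have "f \<otimes>\<^bsub>B\<^esub> g \<in> ?H" by (rule subgroup.m_closed[OF sH f g(1)])
    then have "(f \<otimes>\<^bsub>B\<^esub> g) w \<in> S" unfolding S_def by (rule imageI)
    moreover have "(f \<otimes>\<^bsub>B\<^esub> g) w = f u" using g w B_mult[OF HB[OF f] HB[OF g(1)]] by simp
    ultimately show ?thesis by simp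
  qed
  have RS: "r u \<in> S \<union> r1 ` S" if r: "r \<in> R" and u: "u \<in> S \<union> r1 ` S" for r u
    using u
  proof
    assume u: "u \<in> S"
    then have u\<Omega>: "u \<in> \<Omega>" by (rule S\<Omega>)
    \<comment> \<open>The even word \<open>r1 r\<close> keeps \<open>u\<close> inside
      \<open>S\<close>, and \<open>r u\<close> is \<open>r1\<close> applied to the result.\<close>
    have "rt r1 r u \<in> S" by (rule HS) (use R(2)[OF r] u in simp_all)
    then have "r1 (r u) \<in> S" using u\<Omega> by (simp add: rt_def)
    moreover have "r u \<in> \<Omega>" using rs_mem(1)[OF _ u\<Omega>] R(1) r by blast
    then have "r u = r1 (r1 (r u))" using r_invol(2) by simp
    ultimately have "r u \<in> r1 ` S" by (rule rev_image_eqI)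
    then show ?thesis ..
  next
    assume "u \<in> r1 ` S"
    then obtain v where v: "v \<in> S" "u = r1 v" by blast
    have "rt r r1 v \<in> S" by (rule HS) (use R(2)[OF r] v in simp_all)
    then show ?thesis using v(2) S\<Omega>[OF v(1)] by (simp add: rt_def)
  qed
  have HT: "f u \<in> T" if "f \<in> ?H" "u \<in> T" for f u
    using that
  proof (induction f arbitrary: u rule: generate.induct)
    case one then show ?case using T(1) by (auto simp: B_one)
  next
    case (incl h)
    from incl.hyps obtain r s where h: "h = rt r s" "(r, s) \<in> P" unfolding W(1) by auto
    have "r (s u) \<in> T" using WT[OF h(2) incl.prems] by blast
    moreover have "h u = r (s u)" using h(1) T(1) incl.prems by (auto simp: rt_def)
    ultimately show ?case by simp
  next
    case (inv h)
    from inv.hyps obtain r s where h: "h = rt r s" "(r, s) \<in> P" unfolding W(1) by auto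
    have rs: "r \<in> {r0, r1, r2}" "s \<in> {r0, r1, r2}" using W(2) h(2) by blast+
    have "s (r u) \<in> T" using WT[OF h(2) inv.prems] by blast
    moreover have "(inv\<^bsub>B\<^esub> h) u = s (r u)" using inv_rt[OF rs] h(1) T(1) inv.prems by (auto simp: rt_def)
    ultimately show ?case by simp
  next
    case (eng f g)
    have "(f \<otimes>\<^bsub>B\<^esub> g) u = f (g u)" using B_mult[OF HB[OF eng.hyps(1)] HB[OF eng.hyps(2)]] eng.prems T(1) by auto
    then show ?case using eng by simp
  qed
  have "S \<subseteq> T" unfolding S_def using HT[OF _ T(2)] by (rule image_subsetI)
  then have ST: "S \<union> r1 ` S \<subseteq> T" using T(4) by blast
  have "S \<union> r1 ` S = T"
  proof (rule minimal[OF ST])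
    show "w \<in> S \<union> r1 ` S" using wS by blast
  qed (rule RS)
  then show ?thesis using cS by simp
qed

text \<open>The rotation group: its elements are the words of even length in \<open>r0\<close>, \<open>r1\<close>, \<open>r2\<close>.\<close>

definition Rot :: "('b \<Rightarrow> 'b) monoid" where
  "Rot = B\<lparr>carrier := generate B {rt r0 r1, rt r1 r2}\<rparr>"

lemma gens_B: "{rt r0 r1, rt r1 r2} \<subseteq> carrier B"
  using rt_Bij unfolding B_carrier by simp

lemma sub_Rot: "subgroup (generate B {rt r0 r1, rt r1 r2}) B"
  by (rule B.generate_is_subgroup[OF gens_B])

lemma generate_Rot: "W \<subseteq> generate B {rt r0 r1, rt r1 r2} \<Longrightarrow> generate Rot W = generate B W"
  unfolding Rot_def using B.generate_consistent[OF _ sub_Rot] by simp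

lemma rotation_group_Rot: "rotation_group Rot (rt r0 r1) (rt r1 r2)"
proof -
  have inc: "{rt r0 r1, rt r1 r2} \<subseteq> generate B {rt r0 r1, rt r1 r2}" by (intro subsetI generate.incl)
  interpret R: group Rot unfolding Rot_def by (rule B.subgroup_imp_group[OF sub_Rot])
  show ?thesis
  proof unfold_locales
    have "carrier Rot \<subseteq> Bij \<Omega>" using subgroup.subset[OF sub_Rot] by (simp add: Rot_def B_carrier)
    moreover have "Bij \<Omega> \<subseteq> (\<Pi>\<^sub>E w\<in>\<Omega>. \<Omega>)" unfolding PiE_def using Bij_imp_extensional Bij_imp_funcset by blast
    ultimately have "carrier Rot \<subseteq> (\<Pi>\<^sub>E w\<in>\<Omega>. \<Omega>)" by (rule subset_trans)
    then show "finite (carrier Rot)" by (rule finite_subset) (simp add: finite_PiE finO)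
    show "rt r0 r1 \<in> carrier Rot" "rt r1 r2 \<in> carrier Rot" using inc by (simp_all add: Rot_def)
    show "carrier Rot = generate Rot {rt r0 r1, rt r1 r2}" using generate_Rot[OF inc] by (simp add: Rot_def)
    \<comment> \<open>The inner \<open>r1 r1\<close> cancels, so the product is the half-turn
      \<open>r0 r2\<close> about an edge, an involution because \<open>r0\<close> and
      \<open>r2\<close> commute.\<close>
    have xy: "rt r0 r1 \<otimes>\<^bsub>B\<^esub> rt r1 r2 = rt r0 r2"
      by (subst rt_mult) (auto simp: rt_def r_closed r_invol intro!: restrict_ext)
    have "rt r0 r2 \<otimes>\<^bsub>B\<^esub> rt r0 r2 = \<one>\<^bsub>B\<^esub>"
      by (subst rt_mult) (auto simp: B_one r_closed r_invol r02 intro!: restrict_ext)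
    then show "rt r0 r1 \<otimes>\<^bsub>Rot\<^esub> rt r1 r2 \<otimes>\<^bsub>Rot\<^esub> (rt r0 r1 \<otimes>\<^bsub>Rot\<^esub> rt r1 r2) = \<one>\<^bsub>Rot\<^esub>"
      using xy by (simp add: Rot_def)
  qed
qed

lemma ord_Rot:
  assumes "g \<in> {rt r0 r1, rt r1 r2}"
  shows "group.ord Rot g = card (generate B {g})"
proof -
  interpret R: rotation_group Rot "rt r0 r1" "rt r1 r2" by (rule rotation_group_Rot)
  have "g \<in> carrier Rot" using assms R.xG R.yG by blast
  moreover have "{g} \<subseteq> generate B {rt r0 r1, rt r1 r2}" using assms by (auto intro: generate.incl)
  ultimately show ?thesis using R.generate_pow_card[of g] generate_Rot[of "{g}"] by simp
qed

lemma order_Rot: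
  assumes "\<Omega> \<noteq> {}" shows "card \<Omega> = 2 * order Rot"
proof -
  obtain w where w: "w \<in> \<Omega>" using assms by blast
  let ?W = "{rt r0 r1, rt r1 r2}"
  have inc: "rt r0 r1 \<in> generate B ?W" "rt r1 r2 \<in> generate B ?W" by (simp_all add: generate.incl)
  have inv: "rt r1 r0 \<in> generate B ?W" "rt r2 r1 \<in> generate B ?W"
    using generate.inv[of "rt r0 r1" ?W B] generate.inv[of "rt r1 r2" ?W B] inv_rt by simp_all
  have "rt r1 r1 = \<one>\<^bsub>B\<^esub>" using r_invol by (auto simp: rt_def B_one fun_eq_iff restrict_def)
  then have one: "rt r1 r1 \<in> generate B ?W" using generate.one by metis
  have "card \<Omega> = 2 * card (generate B ?W)"
  proof (rule card_component[where R = "{r0, r1, r2}" and w = w and P = "{(r0, r1), (r1, r2)}"])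
    show "rt r r1 \<in> generate B ?W \<and> rt r1 r \<in> generate B ?W" if "r \<in> {r0, r1, r2}" for r
      using that inc inv one by blast
    show "A = \<Omega>" if "A \<subseteq> \<Omega>" "w \<in> A" "\<And>u r. r \<in> {r0, r1, r2} \<Longrightarrow> u \<in> A \<Longrightarrow> r u \<in> A" for A
      using conn[OF that(1)] that by blast
  qed (use w r_closed in auto)
  then show ?thesis by (simp add: order_def Rot_def)
qed

text \<open>\<open>a = r0\<close> gives the rotation about a face and \<open>a = r2\<close> the one
  about a vertex. In the generator \<open>r1 r2\<close> the involution \<open>a\<close> stands last,
  in \<open>r0 r1\<close> first; the inverse in the cyclic group supplies the other order of
  factors.\<close>

lemma ord_component:
  assumes a: "a \<in> {r0, r2}" and gW: "g = (if a = r0 then rt r0 r1 else rt r1 r2)"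
    and T: "T \<subseteq> \<Omega>" "w \<in> T" "\<And>u. u \<in> T \<Longrightarrow> a u \<in> T" "\<And>u. u \<in> T \<Longrightarrow> r1 u \<in> T"
    and minimal: "\<And>A. A \<subseteq> T \<Longrightarrow> w \<in> A \<Longrightarrow> (\<And>u. u \<in> A \<Longrightarrow> a u \<in> A \<and> r1 u \<in> A) \<Longrightarrow> A = T"
  shows "card T = 2 * group.ord Rot g"
proof -
  have g: "g = rt a r1 \<or> g = rt r1 a" using a gW by (auto split: if_splits)
  obtain r s where rs: "g = rt r s" "(r, s) = (a, r1) \<or> (r, s) = (r1, a)" using g by blast
  have rs3: "r \<in> {r0, r1, r2}" "s \<in> {r0, r1, r2}" using rs(2) a by auto
  have "rt r s \<in> generate B {g}" unfolding rs(1) by (simp add: generate.incl)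
  moreover have "rt s r \<in> generate B {g}" using generate.inv[of g "{g}" B] inv_rt[OF rs3] rs(1) by simp
  ultimately have both: "rt a r1 \<in> generate B {g}" "rt r1 a \<in> generate B {g}" using rs(2) by auto
  have "rt r1 r1 = \<one>\<^bsub>B\<^esub>" using r_invol by (auto simp: rt_def B_one fun_eq_iff restrict_def)
  then have one: "rt r1 r1 \<in> generate B {g}" using generate.one by metis
  have "card T = 2 * card (generate B {g})"
  proof (rule card_component[where R = "{a, r1}" and w = w and P = "{(r, s)}"])
    show "rt q r1 \<in> generate B {g} \<and> rt r1 q \<in> generate B {g}" if "q \<in> {a, r1}" for q
      using that both one by blast
    show "A = T" if "A \<subseteq> T" "w \<in> A" "\<And>u r. r \<in> {a, r1} \<Longrightarrow> u \<in> A \<Longrightarrow> r u \<in> A" for A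
      using minimal[OF that(1,2)] that(3) by blast
  qed (use T rs a in auto)
  moreover have "g \<in> {rt r0 r1, rt r1 r2}" using gW by simp
  ultimately show ?thesis using ord_Rot by simp
qed

text \<open>Substituting \<open>v = 2 E / q\<close> and \<open>f = 2 E / p\<close> into
  \<open>v - E + f = -4\<close> gives \<open>2 E = 8 p q / (p q - 2 p - 2 q)\<close>, which is 80,
  30, 18, 60, 20, 36 and 30 for the seven pairs in order.\<close>

lemma excluded_types:
  assumes "\<Omega> \<noteq> {}" "card \<Omega> = 4 * E" "p * f = 2 * E" "q * v = 2 * E" "int v - int E + int f = -4"
    and "group.ord Rot (rt r0 r1) = p" "group.ord Rot (rt r1 r2) = q"
    and "(p, q) \<in> {(4, 5), (6, 5), (6, 9), (10, 3), (10, 5), (18, 3), (30, 3)}"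
  shows False
proof -
  interpret R: rotation_group Rot "rt r0 r1" "rt r1 r2" by (rule rotation_group_Rot)
  have o: "order Rot = 2 * E" using order_Rot assms(1,2) by simp
  consider "p = 4" "q = 5" | "p = 6" "q = 5" | "p = 6" "q = 9" | "p = 10" "q = 3"
    | "p = 10" "q = 5" | "p = 18" "q = 3" | "p = 30" "q = 3" using assms(8) by auto
  then show False
  proof cases
    case 1 then have "order Rot = 80" using o assms(3-5) by auto
    then show ?thesis using R.no_4_5 assms(6,7) 1 by simp
  next
    case 2 then have "order Rot = 30" using o assms(3-5) by auto
    then show ?thesis using R.no_6_5 assms(6,7) 2 by simp
  next
    case 3 then have "order Rot = 18" using o assms(3-5) by auto
    then show ?thesis using R.no_6_9 assms(6,7) 3 by simp
  next
    case 4 then have "order Rot = 60" using o assms(3-5) by auto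
    then show ?thesis using R.no_10_3 assms(6,7) 4 by simp
  next
    case 5 then have "order Rot = 20" using o assms(3-5) by auto
    then show ?thesis using R.no_10_5 assms(6,7) 5 by simp
  next
    case 6 then have "order Rot = 36" using o assms(3-5) by auto
    then show ?thesis using R.no_18_3 assms(6,7) 6 by simp
  next
    case 7 then have "order Rot = 30" using o assms(3-5) by auto
    then show ?thesis using R.no_30_3 assms(6,7) 7 by simp
  qed
qed

end

section \<open>Charts of closed surfaces\<close>

lemma closed_surface_chart:
  assumes "closed_surface X" "v \<in> topspace X"
  obtains U h g where "openin X U" "v \<in> U"
    "continuous_map (subtopology X U) (top_of_set (ball (0::complex) 1)) h"
    "continuous_map (top_of_set (ball (0::complex) 1)) X g"
    "\<And>u. u \<in> U \<Longrightarrow> h u \<in> ball 0 1 \<and> g (h u) = u" "\<And>b. b \<in> ball 0 1 \<Longrightarrow> g b \<in> U \<and> h (g b) = b"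
proof -
  obtain U where U: "openin X U" "v \<in> U" "subtopology X U homeomorphic_space top_of_set (ball (0::complex) 1)"
    using assms unfolding closed_surface_def by blast
  obtain h g where hg: "homeomorphic_maps (subtopology X U) (top_of_set (ball (0::complex) 1)) h g"
    using U(3) unfolding homeomorphic_space_def by blast
  have top: "topspace (subtopology X U) = U" using openin_subset[OF U(1)] by auto
  show ?thesis
  proof (rule that[OF U(1,2), of h g])
    show "continuous_map (subtopology X U) (top_of_set (ball (0::complex) 1)) h"
      using hg unfolding homeomorphic_maps_def by blast
    show "continuous_map (top_of_set (ball (0::complex) 1)) X g"
      using hg unfolding homeomorphic_maps_def continuous_map_in_subtopology by blast
    show "h u \<in> ball 0 1 \<and> g (h u) = u" if "u \<in> U" for u
      using hg that top unfolding homeomorphic_maps_def continuous_map_def by fastforce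
    show "g b \<in> U \<and> h (g b) = b" if "b \<in> ball 0 1" for b
      using hg that top unfolding homeomorphic_maps_def continuous_map_def by fastforce
  qed
qed

text \<open>Openness is local: near a point of the image, \<open>f\<close> followed by a chart is an
  injective continuous map from an open planar set into the plane, to which planar invariance of
  domain applies.\<close>

lemma invariance_of_domain_surface:
  fixes f :: "complex \<Rightarrow> 'a"
  assumes X: "closed_surface X" and W: "open W" and f: "continuous_map (top_of_set W) X f" "inj_on f W"
  shows "openin X (f ` W)"
proof (subst openin_subopen, intro ballI)
  fix y assume "y \<in> f ` W"
  then obtain w where w: "w \<in> W" "y = f w" by blast
  have "y \<in> topspace X" using f(1) w unfolding continuous_map_def by auto
  then obtain U h g where U: "openin X U" "y \<in> U"
    and h: "continuous_map (subtopology X U) (top_of_set (ball (0::complex) 1)) h"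
    and hg: "\<And>u. u \<in> U \<Longrightarrow> h u \<in> ball 0 1 \<and> g (h u) = u"
    using closed_surface_chart[OF X] by metis
  define W' where "W' = {w \<in> W. f w \<in> U}"
  have "openin (top_of_set W) W'"
    using openin_continuous_map_preimage[OF f(1) U(1)] unfolding W'_def by simp
  then have oW': "open W'" using W openin_open_eq by blast
  have "continuous_map (top_of_set W') (subtopology X U) f"
    unfolding continuous_map_in_subtopology
  proof
    show "continuous_map (top_of_set W') X f"
      by (rule continuous_map_from_subtopology_mono[OF f(1)]) (auto simp: W'_def)
    show "f \<in> topspace (top_of_set W') \<rightarrow> U" by (auto simp: W'_def)
  qed
  then have "continuous_map (top_of_set W') (top_of_set (ball 0 1)) (h \<circ> f)"
    using h continuous_map_compose by blast
  then have "continuous_on W' (h \<circ> f)"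
    by (simp add: continuous_map_in_subtopology)
  moreover have "inj_on (h \<circ> f) W'"
  proof (rule inj_onI)
    fix a b assume ab: "a \<in> W'" "b \<in> W'" "(h \<circ> f) a = (h \<circ> f) b"
    have aU: "f a \<in> U" "f b \<in> U" "a \<in> W" "b \<in> W" using ab(1,2) unfolding W'_def by auto
    have "f a = f b" using hg[OF aU(1)] hg[OF aU(2)] ab(3) by (metis comp_apply)
    then show "a = b" using inj_onD[OF f(2)] aU(3,4) by blast
  qed
  ultimately have op: "open ((h \<circ> f) ` W')" using invariance_of_domain oW' by blast
  have "openin (subtopology X U) {u \<in> topspace (subtopology X U). h u \<in> (h \<circ> f) ` W'}"
  proof (rule openin_continuous_map_preimage[OF h])
    have "(h \<circ> f) ` W' \<subseteq> ball 0 1" using hg unfolding W'_def by auto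
    then show "openin (top_of_set (ball 0 1)) ((h \<circ> f) ` W')" using op by (simp add: openin_open_eq)
  qed
  moreover have "{u \<in> topspace (subtopology X U). h u \<in> (h \<circ> f) ` W'} = f ` W'"
  proof (intro equalityI subsetI)
    fix u assume "u \<in> {u \<in> topspace (subtopology X U). h u \<in> (h \<circ> f) ` W'}"
    then obtain w where w: "u \<in> U" "w \<in> W'" "h u = h (f w)" by auto
    then have "f w \<in> U" unfolding W'_def by blast
    then have "g (h (f w)) = f w" using hg by blast
    moreover have "g (h u) = u" using hg[OF w(1)] by blast
    ultimately have "u = f w" unfolding w(3) by simp
    then show "u \<in> f ` W'" using w(2) by blast
  next
    fix u assume "u \<in> f ` W'"
    then obtain w where w: "w \<in> W'" "u = f w" by blast
    then have "u \<in> U" unfolding W'_def by blast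
    then show "u \<in> {u \<in> topspace (subtopology X U). h u \<in> (h \<circ> f) ` W'}"
      using openin_subset[OF U(1)] w by auto
  qed
  ultimately have "openin X (f ` W')" using U(1) openin_open_subtopology by metis
  moreover have "y \<in> f ` W'" "f ` W' \<subseteq> f ` W" using w U unfolding W'_def by auto
  ultimately show "\<exists>T. openin X T \<and> y \<in> T \<and> T \<subseteq> f ` W" by blast
qed

text \<open>On the compact set \<open>D\<close> the map \<open>f\<close> is a homeomorphism onto its
  image, so an inverse chart followed by the inverse of \<open>f\<close> embeds an open planar set
  into \<open>D\<close>; its image is open and contains \<open>z\<close>. This shows later that a
  surface neighbourhood does not fit into a half-plane.\<close>

lemma interior_of_embedded_compact:
  fixes f :: "complex \<Rightarrow> 'a"
  assumes X: "closed_surface X" and D: "compact D" and f: "continuous_map (top_of_set D) X f" "inj_on f D"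
    and N: "openin X N" "N \<subseteq> f ` D" and z: "z \<in> D" "f z \<in> N"
  shows "z \<in> interior D"
proof -
  have fD: "f ` D \<subseteq> topspace X" using f(1) unfolding continuous_map_def by auto
  have "homeomorphic_map (top_of_set D) (subtopology X (f ` D)) f"
  proof (rule continuous_imp_homeomorphic_map)
    show "compact_space (top_of_set D)"
      by (rule compact_space_subtopology) (use D in simp)
    show "Hausdorff_space (subtopology X (f ` D))"
      using X Hausdorff_space_subtopology unfolding closed_surface_def by blast
    show "continuous_map (top_of_set D) (subtopology X (f ` D)) f"
      using f(1) by (simp add: continuous_map_in_subtopology)
    show "f ` topspace (top_of_set D) = topspace (subtopology X (f ` D))" using fD by auto
  qed (use f in simp)
  then obtain k where k: "homeomorphic_maps (top_of_set D) (subtopology X (f ` D)) f k"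
    using homeomorphic_map_maps by blast
  have kc: "continuous_map (subtopology X (f ` D)) (top_of_set D) k" and kf: "\<And>d. d \<in> D \<Longrightarrow> k (f d) = d"
    using k unfolding homeomorphic_maps_def by auto
  have "f z \<in> topspace X" using fD z by blast
  then obtain U h g where U: "openin X U" "f z \<in> U"
    and g: "continuous_map (top_of_set (ball (0::complex) 1)) X g"
    and hg: "\<And>u. u \<in> U \<Longrightarrow> h u \<in> ball 0 1 \<and> g (h u) = u" "\<And>b. b \<in> ball 0 1 \<Longrightarrow> g b \<in> U \<and> h (g b) = b"
    using closed_surface_chart[OF X] by metis
  define B where "B = {b \<in> ball 0 1. g b \<in> N}"
  have "openin (top_of_set (ball 0 1)) B"
    using openin_continuous_map_preimage[OF g N(1)] unfolding B_def by simp
  then have oB: "open B" by (simp add: openin_open_eq)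
  have "continuous_map (top_of_set B) (subtopology X (f ` D)) g"
    unfolding continuous_map_in_subtopology
  proof
    show "continuous_map (top_of_set B) X g"
      by (rule continuous_map_from_subtopology_mono[OF g]) (auto simp: B_def)
    show "g \<in> topspace (top_of_set B) \<rightarrow> f ` D" using N(2) by (auto simp: B_def)
  qed
  then have "continuous_map (top_of_set B) (top_of_set D) (k \<circ> g)"
    using kc continuous_map_compose by blast
  then have "continuous_on B (k \<circ> g)" and kgD: "(k \<circ> g) ` B \<subseteq> D"
    by (auto simp: continuous_map_in_subtopology)
  moreover have "inj_on (k \<circ> g) B"
  proof (rule inj_onI)
    fix a b assume ab: "a \<in> B" "b \<in> B" "(k \<circ> g) a = (k \<circ> g) b"
    have aB: "a \<in> ball 0 1" "b \<in> ball 0 1" "g a \<in> f ` D" "g b \<in> f ` D" using ab(1,2) N(2) unfolding B_def by auto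
    then obtain c where cd1: "c \<in> D" "g a = f c" by blast
    from aB(4) obtain d where "d \<in> D" "g b = f d" by blast
    note cd = cd1 this
    have "k (g a) = k (g b)" using ab(3) by simp
    then have "c = d" unfolding cd(2,4) kf[OF cd(1)] kf[OF cd(3)] .
    then have "g a = g b" using cd(2,4) by simp
    moreover have "h (g a) = a" "h (g b) = b" using hg(2) aB(1,2) by blast+
    ultimately show "a = b" by metis
  qed
  ultimately have "open ((k \<circ> g) ` B)" using invariance_of_domain oB by blast
  moreover have "z \<in> (k \<circ> g) ` B"
  proof (rule image_eqI)
    show "z = (k \<circ> g) (h (f z))" using hg(1)[OF U(2)] kf[OF z(1)] by simp
    show "h (f z) \<in> B" using hg(1)[OF U(2)] z(2) unfolding B_def by simp
  qed
  ultimately show ?thesis using kgD interior_maximal by blast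
qed

text \<open>The image of a small round disc in a chart. It serves at vertices, where the sectors
  around a point must not split into two separate groups.\<close>

lemma connected_punctured_nhd:
  assumes X: "closed_surface X" and N: "openin X N" "v \<in> N"
  obtains N' where "openin X N'" "v \<in> N'" "N' \<subseteq> N" "connectedin X (N' - {v})"
proof -
  have "v \<in> topspace X" using N openin_subset by blast
  then obtain U h g where U: "openin X U" "v \<in> U"
    and g: "continuous_map (top_of_set (ball (0::complex) 1)) X g"
    and hg: "\<And>u. u \<in> U \<Longrightarrow> h u \<in> ball 0 1 \<and> g (h u) = u" "\<And>b. b \<in> ball 0 1 \<Longrightarrow> g b \<in> U \<and> h (g b) = b"
    using closed_surface_chart[OF X] by metis
  define B where "B = {b \<in> ball 0 1. g b \<in> N}"
  have "openin (top_of_set (ball 0 1)) B"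
    using openin_continuous_map_preimage[OF g N(1)] unfolding B_def by simp
  then have oB: "open B" by (simp add: openin_open_eq)
  have "h v \<in> B" using hg(1)[OF U(2)] N unfolding B_def by simp
  then obtain r where r: "r > 0" "ball (h v) r \<subseteq> B" using oB open_contains_ball by blast
  have sub: "ball (h v) r \<subseteq> ball 0 1" using r unfolding B_def by blast
  have gr: "continuous_map (top_of_set (ball (h v) r)) X g"
    by (rule continuous_map_from_subtopology_mono[OF g sub])
  have inj: "inj_on g (ball (h v) r)"
  proof (rule inj_onI)
    fix a b assume ab: "a \<in> ball (h v) r" "b \<in> ball (h v) r" "g a = g b"
    have "h (g a) = a" "h (g b) = b" using hg(2) sub ab(1,2) by blast+
    then show "a = b" unfolding ab(3) by (rule trans[OF sym])
  qed
  show ?thesis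
  proof (rule that[of "g ` ball (h v) r"])
    show "openin X (g ` ball (h v) r)" by (rule invariance_of_domain_surface[OF X _ gr inj]) simp
    show "v \<in> g ` ball (h v) r"
      by (rule image_eqI[of _ _ "h v"]) (use r hg(1)[OF U(2)] in auto)
    show "g ` ball (h v) r \<subseteq> N" using r unfolding B_def by blast
    have "connected (ball (h v) r - {h v})" by (rule connected_punctured_ball) simp
    then have "connectedin (top_of_set (ball (h v) r)) (ball (h v) r - {h v})"
      by (simp add: connectedin_subtopology)
    then have "connectedin X (g ` (ball (h v) r - {h v}))" by (rule connectedin_continuous_map_image[OF gr])
    moreover have "g ` (ball (h v) r - {h v}) = g ` ball (h v) r - {v}"
    proof -
      have "g (h v) = v" using hg(1)[OF U(2)] by simp
      moreover have "h v \<in> ball (h v) r" using r by simp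
      ultimately show ?thesis using inj_on_image_set_diff[OF inj, of "ball (h v) r" "{h v}"] by simp
    qed
    ultimately show "connectedin X (g ` ball (h v) r - {v})" by simp
  qed
qed

section \<open>The sides of a polygon\<close>

lemma traverse_traverse [simp]: "traverse (traverse e b) c = traverse e (b \<noteq> c)"
  by (auto simp: traverse_def fun_eq_iff)

lemma traverse_flip: "traverse e (\<not> b) t = traverse e b (1 - t)"
  by (simp add: traverse_def)

lemma cis_eq_iff: "cis a = cis b \<longleftrightarrow> (\<exists>n::int. a = b + 2 * pi * n)"
  unfolding sin_cos_eq_iff[of a b, symmetric] by (auto simp: complex_eq_iff)

lemma polygon_side_eq_iff:
  assumes "p \<ge> 1"
  shows "polygon_side p i s = polygon_side p j t \<longleftrightarrow> (\<exists>k::int. real i + s = real j + t + real p * k)"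
proof -
  have "2 * pi * (real i + s) / real p = 2 * pi * (real j + t) / real p + 2 * pi * k
      \<longleftrightarrow> real i + s = real j + t + real p * k" for k :: int
  proof -
    have "2 * pi * (real i + s) / real p = 2 * pi * (real j + t) / real p + 2 * pi * k
      \<longleftrightarrow> (2 * pi) * ((real i + s) / real p) = (2 * pi) * ((real j + t) / real p + k)"
      by (simp add: distrib_left)
    also have "\<dots> \<longleftrightarrow> (real i + s) / real p = (real j + t) / real p + k"
      by (subst mult_cancel_left) simp
    also have "\<dots> \<longleftrightarrow> real i + s = real j + t + real p * k" using assms by (simp add: field_simps)
    finally show ?thesis .
  qed
  then show ?thesis unfolding polygon_side_def cis_eq_iff by simp
qed

text \<open>The positions \<open>i + s\<close> and \<open>j + t\<close> agree modulo
  \<open>p\<close> and \<open>s - t\<close> lies in [-1, 1], so it is -1, 0 or 1, and the nonzero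
  cases are common corners. The successor modulo \<open>p\<close> keeps this true for polygons with
  one or two sides.\<close>

lemma polygon_side_eqD:
  assumes p: "p \<ge> 1" and ij: "i < p" "j < p" and st: "s \<in> {0..1}" "t \<in> {0..1}"
    and eq: "polygon_side p i s = polygon_side p j t"
  shows "(i = j \<and> s = t) \<or> (s = 1 \<and> t = 0 \<and> j = (i + 1) mod p) \<or> (s = 0 \<and> t = 1 \<and> i = (j + 1) mod p)"
proof -
  obtain k :: int where k: "real i + s = real j + t + real p * k"
    using eq polygon_side_eq_iff[OF p] by blast
  have d: "s - t = real_of_int (int j - int i + int p * k)" using k by simp
  have "\<bar>s - t\<bar> \<le> 1" using st by auto
  then have "\<bar>int j - int i + int p * k\<bar> \<le> 1" using d by linarith
  then consider "int j - int i + int p * k = 0" | "int j - int i + int p * k = 1" | "int j - int i + int p * k = -1"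
    by linarith
  then show ?thesis
  proof cases
    case 1
    then have st0: "s = t" using d by simp
    have "int i = int j + int p * k" using 1 by simp
    then have "int i mod int p = int j mod int p" by simp
    then have "i = j" using ij by simp
    then show ?thesis using st0 by simp
  next
    case 2
    then have "s = 1" "t = 0" using d st by auto
    moreover have "int j = (int i + 1) + int p * (- k)" using 2 by simp
    then have "int j mod int p = (int i + 1) mod int p" by (metis mod_mult_self2)
    then have "int j = int ((i + 1) mod p)" using ij by (simp add: zmod_int add.commute)
    ultimately show ?thesis by simp
  next
    case 3
    then have "s = 0" "t = 1" using d st by auto
    moreover have "int i = (int j + 1) + int p * k" using 3 by simp
    then have "int i mod int p = (int j + 1) mod int p" by (metis mod_mult_self2)
    then have "int i = int ((j + 1) mod p)" using ij by (simp add: zmod_int add.commute)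
    ultimately show ?thesis by simp
  qed
qed

lemma polygon_side_corner:
  assumes "p \<ge> 1" shows "polygon_side p i 1 = polygon_side p ((i + 1) mod p) 0"
proof -
  have "real i + 1 = real ((i + 1) mod p) + 0 + real p * of_int (int ((i + 1) div p))"
    by (metis add_0_right add.commute mult_div_mod_eq of_int_of_nat_eq of_nat_1 of_nat_add of_nat_mult)
  then show ?thesis using polygon_side_eq_iff[OF assms] by blast
qed

lemma norm_polygon_side [simp]: "norm (polygon_side p i t) = 1"
  by (simp add: polygon_side_def)

lemma continuous_on_polygon_side [continuous_intros]:
  assumes "continuous_on S f" shows "continuous_on S (\<lambda>z. polygon_side p i (f z))"
  unfolding polygon_side_def cis_conv_exp using assms by (cases "p = 0") (auto intro!: continuous_intros)

lemma sphere_polygon_side: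
  assumes p: "p \<ge> 1" and z: "norm z = 1"
  obtains i t where "i < p" "t \<in> {0..<1}" "z = polygon_side p i t"
proof -
  define u where "u = Arg2pi z * p / (2 * pi)"
  have "z = cis (Arg2pi z)" using z complex_norm_eq_1_exp[of z] by (simp add: cis_conv_exp mult.commute)
  have u: "0 \<le> u" "u < p" using Arg2pi[of z] p by (auto simp: u_def field_simps)
  define i where "i = nat \<lfloor>u\<rfloor>"
  have i: "real i \<le> u" "u < real i + 1" using u(1) unfolding i_def by linarith+
  have "i < p" using i(1) u(2) by linarith
  moreover have "u - real i \<in> {0..<1}" using i by auto
  moreover have "polygon_side p i (u - real i) = cis (Arg2pi z)"
    using p by (simp add: polygon_side_def u_def)
  ultimately show ?thesis using that \<open>z = cis (Arg2pi z)\<close> by metis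
qed

lemma cball_polygon_side:
  assumes p: "p \<ge> 1" and z: "norm z \<le> 1"
  obtains r i t where "r \<in> {0..1}" "i < p" "t \<in> {0..<1}" "z = r *\<^sub>R polygon_side p i t"
proof (cases "z = 0")
  case True
  then show ?thesis using that[of 0 0 0] p by simp
next
  case False
  then have "norm (sgn z) = 1" by (simp add: norm_sgn)
  then obtain i t where "i < p" "t \<in> {0..<1}" "sgn z = polygon_side p i t" using sphere_polygon_side[OF p] by metis
  moreover have "z = norm z *\<^sub>R sgn z" by (simp add: sgn_div_norm False)
  ultimately show ?thesis using that[of "norm z" i t] z by auto
qed

section \<open>Flags of a tessellation\<close>

text \<open>The polygons \<open>n\<close> and \<open>\<Phi>\<close> are parameters because the same
  tessellation is finally used with two families: the one from regularity and one with constant side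
  number \<open>p\<close>.\<close>

locale tess =
  fixes X :: "'a topology" and \<Gamma> :: "'a embedded_graph" and n :: "'a set \<Rightarrow> nat" and \<Phi> :: "'a set \<Rightarrow> complex \<Rightarrow> 'a"
  assumes surf: "closed_surface X" and tes: "tessellation X \<Gamma>"
    and par: "C \<in> faces X \<Gamma> \<Longrightarrow> polygon_param X \<Gamma> C (n C) (\<Phi> C)"
begin

abbreviation "V \<equiv> gverts \<Gamma>"
abbreviation "Ed \<equiv> gedges \<Gamma>"
abbreviation "F \<equiv> faces X \<Gamma>"
abbreviation "ps C i \<equiv> polygon_side (n C) i"

lemma hausdorff: "Hausdorff_space X" and connected_X: "connected_space X"
  using surf unfolding closed_surface_def by auto

lemma finite_V: "finite V" and finite_Ed: "finite Ed" and V_sub: "V \<subseteq> topspace X"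
  using tes unfolding tessellation_def graph_in_def by auto

lemma edge:
  assumes "e \<in> Ed"
  shows "pathin X e" "e 0 \<in> V" "e 1 \<in> V" "inj_on e {0<..<1}" "t \<in> {0<..<1} \<Longrightarrow> e t \<notin> V"
proof -
  have "\<forall>e\<in>Ed. pathin X e \<and> e 0 \<in> V \<and> e 1 \<in> V \<and> inj_on e {0<..<1} \<and> e ` {0<..<1} \<inter> V = {}"
    using tes unfolding tessellation_def graph_in_def by blast
  from bspec[OF this assms] show "pathin X e" "e 0 \<in> V" "e 1 \<in> V" "inj_on e {0<..<1}"
    "t \<in> {0<..<1} \<Longrightarrow> e t \<notin> V" by blast+
qed

lemma traverse_end: "e \<in> Ed \<Longrightarrow> traverse e b 0 \<in> V"
  using edge by (simp add: traverse_def)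

lemma traverse_V_iff:
  assumes "e \<in> Ed" "t \<in> {0..1}" shows "traverse e b t \<in> V \<longleftrightarrow> t = 0 \<or> t = 1"
  using edge(2,3)[OF assms(1)] edge(5)[OF assms(1), of t] edge(5)[OF assms(1), of "1 - t"] assms(2)
  unfolding traverse_def by (cases "t = 0"; cases "t = 1") (auto split: if_splits)

lemma edges_disjoint: "e \<in> Ed \<Longrightarrow> e' \<in> Ed \<Longrightarrow> s \<in> {0<..<1} \<Longrightarrow> t \<in> {0<..<1} \<Longrightarrow> e s = e' t \<Longrightarrow> e = e' \<and> s = t"
proof -
  assume a: "e \<in> Ed" "e' \<in> Ed" "s \<in> {0<..<1}" "t \<in> {0<..<1}" "e s = e' t"
  have "\<forall>e\<in>Ed. \<forall>e'\<in>Ed. e \<noteq> e' \<longrightarrow> e ` {0<..<1} \<inter> e' ` {0<..<1} = {}"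
    using tes unfolding tessellation_def graph_in_def by blast
  then have "e = e'" using a by blast
  then show ?thesis using inj_onD[OF edge(4)[OF a(1)]] a by blast
qed

lemma traverse_eqD:
  assumes e: "e \<in> Ed" "e' \<in> Ed" and t: "t \<in> {0<..<1}" "t' \<in> {0..1}" and eq: "traverse e b t = traverse e' b' t'"
  shows "e = e' \<and> t' \<in> {0<..<1} \<and> t' = (if b = b' then t else 1 - t)"
proof -
  have "traverse e b t \<notin> V" using traverse_V_iff[OF e(1)] t by auto
  then have t': "t' \<in> {0<..<1}" using traverse_V_iff[OF e(2) t(2)] t(2) eq by auto
  define s s' where "s = (if b then 1 - t else t)" and "s' = (if b' then 1 - t' else t')"
  have "s \<in> {0<..<1}" "s' \<in> {0<..<1}" using t t' by (auto simp: s_def s'_def)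
  moreover have "e s = e' s'" using eq by (simp add: s_def s'_def traverse_def split: if_splits)
  ultimately have "e = e' \<and> s = s'" using edges_disjoint[OF e] by blast
  then show ?thesis using t' by (auto simp: s_def s'_def split: if_splits)
qed

lemma edge_subset: "e \<in> Ed \<Longrightarrow> t \<in> {0..1} \<Longrightarrow> traverse e b t \<in> gsupport \<Gamma> \<inter> topspace X"
proof -
  assume e: "e \<in> Ed" and t: "t \<in> {0..1}"
  have "e s \<in> topspace X" if "s \<in> {0..1}" for s
    using edge(1)[OF e] that unfolding pathin_def continuous_map_def by auto
  moreover have "e s \<in> gsupport \<Gamma>" if "s \<in> {0..1}" for s
    using e that unfolding gsupport_def by blast
  ultimately show ?thesis using t unfolding traverse_def by auto
qed

lemma support_cases:
  assumes "x \<in> gsupport \<Gamma>"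
  obtains "x \<in> V" | e t where "e \<in> Ed" "t \<in> {0<..<1}" "x = e t"
proof -
  consider "x \<in> V" | e t where "e \<in> Ed" "t \<in> {0..1}" "x = e t" using assms unfolding gsupport_def by blast
  then show ?thesis
  proof cases
    case (2 e t)
    show ?thesis
    proof (cases "t = 0 \<or> t = 1")
      case True then show ?thesis using 2 edge[OF 2(1)] that(1) by auto
    next
      case False then show ?thesis using 2 that(2)[of e t] by auto
    qed
  qed (use that in blast)
qed

lemma face_sub: "C \<in> F \<Longrightarrow> C \<subseteq> topspace X - gsupport \<Gamma>"
  using connected_components_of_subset unfolding faces_def by fastforce

lemma faces_disjoint: "C \<in> F \<Longrightarrow> D \<in> F \<Longrightarrow> x \<in> C \<Longrightarrow> x \<in> D \<Longrightarrow> C = D"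
  using pairwiseD[OF pairwise_disjoint_connected_components_of, of C "subtopology X (topspace X - gsupport \<Gamma>)" D]
  unfolding faces_def disjnt_iff by blast

lemma faces_cover: "x \<in> topspace X \<Longrightarrow> x \<notin> gsupport \<Gamma> \<Longrightarrow> \<exists>C\<in>F. x \<in> C"
  using Union_connected_components_of[of "subtopology X (topspace X - gsupport \<Gamma>)"]
  unfolding faces_def by auto

lemma n_ge_1: "C \<in> F \<Longrightarrow> n C \<ge> 1"
  using par unfolding polygon_param_def by blast

lemma \<Phi>_cont: "C \<in> F \<Longrightarrow> continuous_map (top_of_set (cball 0 1)) X (\<Phi> C)"
  using par unfolding polygon_param_def by blast

lemma \<Phi>_hom:
  assumes "C \<in> F"
  shows "\<Phi> C ` ball 0 1 = C" "inj_on (\<Phi> C) (ball 0 1)"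
proof -
  have h: "homeomorphic_map (top_of_set (ball 0 1)) (subtopology X C) (\<Phi> C)"
    using par[OF assms] unfolding polygon_param_def by blast
  have "topspace (subtopology X C) = C" using face_sub[OF assms] by auto
  then show "\<Phi> C ` ball 0 1 = C" "inj_on (\<Phi> C) (ball 0 1)"
    using homeomorphic_imp_surjective_map[OF h] homeomorphic_imp_injective_map[OF h] by simp_all
qed

lemma \<Phi>_ball: "C \<in> F \<Longrightarrow> z \<in> ball 0 1 \<Longrightarrow> \<Phi> C z \<in> C"
  using \<Phi>_hom(1) by blast

lemma \<Phi>_inj: "C \<in> F \<Longrightarrow> z \<in> ball 0 1 \<Longrightarrow> w \<in> ball 0 1 \<Longrightarrow> \<Phi> C z = \<Phi> C w \<Longrightarrow> z = w"
  using \<Phi>_hom(2) unfolding inj_on_def by blast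

definition side_spec :: "'a set \<Rightarrow> nat \<Rightarrow> (real \<Rightarrow> 'a) \<times> bool \<Rightarrow> bool" where
  "side_spec C i eb \<longleftrightarrow> fst eb \<in> Ed \<and> (\<forall>t\<in>{0..1}. \<Phi> C (ps C i t) = traverse (fst eb) (snd eb) t)"

text \<open>Edge and direction are the components of one and the same choice, so they always fit
  together.\<close>

definition sedge :: "'a set \<Rightarrow> nat \<Rightarrow> real \<Rightarrow> 'a" where "sedge C i = fst (SOME eb. side_spec C i eb)"
definition sdir :: "'a set \<Rightarrow> nat \<Rightarrow> bool" where "sdir C i = snd (SOME eb. side_spec C i eb)"

lemma side:
  assumes "C \<in> F" "i < n C"
  shows "sedge C i \<in> Ed" "t \<in> {0..1} \<Longrightarrow> \<Phi> C (ps C i t) = traverse (sedge C i) (sdir C i) t"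
proof -
  have "\<exists>e\<in>Ed. \<exists>b. \<forall>t\<in>{0..1}. \<Phi> C (ps C i t) = traverse e b t"
    using par[OF assms(1)] assms(2) unfolding polygon_param_def by blast
  then obtain e b where "side_spec C i (e, b)" unfolding side_spec_def by auto
  then have "side_spec C i (SOME eb. side_spec C i eb)" by (rule someI)
  then have *: "side_spec C i (sedge C i, sdir C i)" unfolding sedge_def sdir_def prod.collapse .
  then show "sedge C i \<in> Ed" "t \<in> {0..1} \<Longrightarrow> \<Phi> C (ps C i t) = traverse (sedge C i) (sdir C i) t"
    using *[unfolded side_spec_def fst_conv snd_conv] by blast+
qed

definition Fl :: "'a flag set" where "Fl = flags X \<Gamma> n"

text \<open>\<open>fpt x\<close> traces the side of the flag \<open>x\<close> from its corner, and \<open>half x\<close> is the half-edge below it.\<close>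

fun fpt :: "'a flag \<Rightarrow> real \<Rightarrow> complex" where "fpt (C, i, b) t = traverse (ps C i) b t"
fun half :: "'a flag \<Rightarrow> (real \<Rightarrow> 'a) \<times> bool" where "half (C, i, b) = (sedge C i, sdir C i \<noteq> b)"

abbreviation half_edge :: "'a flag \<Rightarrow> real \<Rightarrow> 'a" where
  "half_edge x \<equiv> traverse (fst (half x)) (snd (half x))"

lemma Fl_iff [simp]: "(C, i, b) \<in> Fl \<longleftrightarrow> C \<in> F \<and> i < n C" unfolding Fl_def flags_def by simp

lemma Fl_face: "x \<in> Fl \<Longrightarrow> fst x \<in> F" by (cases x) auto

lemma half_Ed: "x \<in> Fl \<Longrightarrow> fst (half x) \<in> Ed" by (cases x) (auto simp: side)

lemma \<Phi>_fpt:
  assumes "x \<in> Fl" "t \<in> {0..1}"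
  shows "\<Phi> (fst x) (fpt x t) = half_edge x t"
proof -
  obtain C i b where x: "x = (C, i, b)" by (cases x) auto
  show ?thesis using side(2)[of C i t] side(2)[of C i "1 - t"] assms unfolding x
    by (auto simp: traverse_def)
qed

lemma norm_fpt [simp]: "norm (fpt x t) = 1"
  by (cases x) (simp add: traverse_def)

lemma continuous_on_fpt [continuous_intros]:
  assumes "continuous_on S f" shows "continuous_on S (\<lambda>z. fpt x (f z))"
proof -
  obtain C i b where x: "x = (C, i, b)" by (cases x) auto
  show ?thesis using assms unfolding x by (cases b) (auto simp: traverse_def intro!: continuous_intros)
qed

lemma \<Phi>_sphere_in_support: "C \<in> F \<Longrightarrow> norm z = 1 \<Longrightarrow> \<Phi> C z \<in> gsupport \<Gamma>"
proof -
  assume C: "C \<in> F" and z: "norm z = 1"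
  obtain i t where "i < n C" "t \<in> {0..<1}" "z = ps C i t" using sphere_polygon_side[OF n_ge_1[OF C] z] .
  then show ?thesis using side[OF C] edge_subset by auto
qed

lemma \<Phi>_mem_face_iff:
  assumes "C \<in> F" "D \<in> F" "z \<in> cball 0 1"
  shows "\<Phi> C z \<in> D \<longleftrightarrow> C = D \<and> z \<in> ball 0 1"
proof (cases "z \<in> ball 0 1")
  case True
  then show ?thesis using \<Phi>_ball[OF assms(1)] faces_disjoint[OF assms(1,2)] by auto
next
  case False
  then have "norm z = 1" using assms(3) by auto
  then show ?thesis using \<Phi>_sphere_in_support[OF assms(1)] face_sub[OF assms(2)] False by auto
qed

lemma \<Phi>_eqD:
  assumes "C \<in> F" "D \<in> F" "z \<in> ball 0 1" "w \<in> cball 0 1" "\<Phi> C z = \<Phi> D w"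
  shows "C = D \<and> z = w"
proof -
  have "\<Phi> D w \<in> C" using \<Phi>_ball[OF assms(1,3)] assms(5) by simp
  then have "C = D" "w \<in> ball 0 1" using \<Phi>_mem_face_iff[OF assms(2,1,4)] by auto
  then show ?thesis using \<Phi>_inj assms by blast
qed

text \<open>Reading a side from its nearer end keeps the parameter at most 1/2. This cuts the
  polygon into sectors between its centre, a corner and the midpoint of a side, one for each
  flag.\<close>

lemma polygon_flag_coords:
  assumes C: "C \<in> F" and z: "z \<in> cball 0 1"
  obtains r i b t where "r \<in> {0..1}" "i < n C" "t \<in> {0..1/2}" "z = r *\<^sub>R fpt (C, i, b) t"
proof -
  obtain r i t where *: "r \<in> {0..1}" "i < n C" "t \<in> {0..<1}" "z = r *\<^sub>R ps C i t"
    using cball_polygon_side[OF n_ge_1[OF C]] z by (metis mem_cball_0)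
  show ?thesis
  proof (cases "t \<le> 1/2")
    case True then show ?thesis using that[of r i t False] * by (auto simp: traverse_def)
  next
    case False then show ?thesis using that[of r i "1 - t" True] * by (auto simp: traverse_def)
  qed
qed

fun r0 :: "'a flag \<Rightarrow> 'a flag" where "r0 (C, i, b) = (C, i, \<not> b)"
text \<open>The corner at the end of side \<open>i\<close> is the start of side
  \<open>i + 1\<close>, so the new flag sits at the opposite end of the neighbouring side. Adding
  \<open>n C\<close> before subtracting 1 avoids truncation at \<open>i = 0\<close>.\<close>

fun r1 :: "'a flag \<Rightarrow> 'a flag" where
  "r1 (C, i, b) = (C, if b then (i + 1) mod n C else (i + n C - 1) mod n C, \<not> b)"

lemma r0_Fl: "x \<in> Fl \<Longrightarrow> r0 x \<in> Fl" and r0_r0: "r0 (r0 x) = x" by (cases x, auto)+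

lemma r1_Fl: "x \<in> Fl \<Longrightarrow> r1 x \<in> Fl" by (cases x) (auto dest: n_ge_1)

lemma mod_pred_succ: "i < p \<Longrightarrow> ((i + p - 1) mod p + 1) mod p = i" "i < p \<Longrightarrow> ((i + 1) mod p + p - 1) mod p = (i::nat)"
proof -
  assume i: "i < p"
  have "((i + p - 1) mod p + 1) mod p = (i + p - 1 + 1) mod p" by (rule mod_add_left_eq)
  then show "((i + p - 1) mod p + 1) mod p = i" using i by simp
  have "((i + 1) mod p + p - 1) mod p = ((i + 1) mod p + (p - 1)) mod p" using i by simp
  also have "\<dots> = (i + 1 + (p - 1)) mod p" by (rule mod_add_left_eq)
  finally show "((i + 1) mod p + p - 1) mod p = i" using i by simp
qed

lemma r1_r1: "x \<in> Fl \<Longrightarrow> r1 (r1 x) = x"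
  by (cases x) (auto simp: mod_pred_succ[simplified])

lemma fst_r0 [simp]: "fst (r0 x) = fst x" and fst_r1 [simp]: "fst (r1 x) = fst x" by (cases x, auto)+

lemma fpt_eqD:
  assumes x: "x \<in> Fl" "y \<in> Fl" "fst x = fst y" and t: "t \<in> {0..1/2}" "t' \<in> {0..1/2}"
    and eq: "fpt x t = fpt y t'"
  shows "t = t' \<and> (x = y \<or> t = 0 \<and> y = r1 x \<or> t = 1/2 \<and> y = r0 x)"
proof -
  obtain C i b where xx: "x = (C, i, b)" by (cases x) auto
  obtain j c where yy: "y = (C, j, c)" using x(3) xx by (cases y) auto
  have i: "C \<in> F" "i < n C" "j < n C" using x xx yy by auto
  define s s' where "s = (if b then 1 - t else t)" and "s' = (if c then 1 - t' else t')"
  have s: "s \<in> {0..1}" "s' \<in> {0..1}" using t by (auto simp: s_def s'_def)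
  have "ps C i s = ps C j s'" using eq by (simp add: xx yy s_def s'_def traverse_def split: if_splits)
  from polygon_side_eqD[OF n_ge_1[OF i(1)] i(2,3) s this]
  consider "i = j" "s = s'" | "s = 1" "s' = 0" "j = (i + 1) mod n C" | "s = 0" "s' = 1" "i = (j + 1) mod n C" by blast
  then show ?thesis
  proof cases
    case 1 then show ?thesis using t by (cases b; cases c) (auto simp: xx yy s_def s'_def)
  next
    case 2
    then have "b" "t = 0" "\<not> c" "t' = 0" using t by (auto simp: s_def s'_def split: if_splits)
    then show ?thesis using 2 by (simp add: xx yy)
  next
    case 3
    then have "\<not> b" "t = 0" "c" "t' = 0" using t by (auto simp: s_def s'_def split: if_splits)
    moreover have "(i + n C - 1) mod n C = j" using 3 mod_pred_succ(2)[OF i(3)] by simp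
    ultimately show ?thesis by (simp add: xx yy)
  qed
qed

lemma fpt_r1: "x \<in> Fl \<Longrightarrow> fpt (r1 x) 0 = fpt x 0"
proof -
  assume x: "x \<in> Fl"
  obtain C i b where xx: "x = (C, i, b)" by (cases x) auto
  have i: "C \<in> F" "i < n C" using x xx by auto
  show ?thesis
    using polygon_side_corner[OF n_ge_1[OF i(1)], of i] polygon_side_corner[OF n_ge_1[OF i(1)], of "(i + n C - 1) mod n C"]
      mod_pred_succ(1)[OF i(2)]
    by (cases b) (auto simp: xx traverse_def)
qed

lemma fpt_r0: "fpt (r0 x) t = fpt x (1 - t)"
  by (cases x) (simp add: traverse_def)

lemma half_r0: "half (r0 x) = (fst (half x), \<not> snd (half x))"
  by (cases x) auto

end

section \<open>Two pages at every edge\<close>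

lemma continuous_map_interval_approach:
  assumes f: "continuous_map (top_of_set {0..1::real}) X f" and U: "openin X U" "f 0 \<in> U"
  obtains s where "s \<in> {0<..<1/3}" "f s \<in> U"
proof -
  have "openin (top_of_set {0..1}) {s \<in> {0..1}. f s \<in> U}"
    using openin_continuous_map_preimage[OF f U(1)] by simp
  moreover have "0 \<in> {s \<in> {0..1}. f s \<in> U}" using U(2) by simp
  ultimately obtain e where e: "e > 0" "\<And>s. s \<in> {0..1} \<Longrightarrow> dist s 0 < e \<Longrightarrow> s \<in> {s \<in> {0..1}. f s \<in> U}"
    unfolding openin_euclidean_subtopology_iff by blast
  define s where "s = min (e/2) (1/6)"
  have "s \<in> {0<..<1/3}" "s \<in> {0..1}" "dist s 0 < e" using e(1) by (auto simp: s_def min_def)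
  then show ?thesis using that[of s] e(2)[of s] by blast
qed

lemma card_le_2_if_no_three:
  assumes "\<And>x y z. x \<in> A \<Longrightarrow> y \<in> A \<Longrightarrow> z \<in> A \<Longrightarrow> x \<noteq> y \<Longrightarrow> x \<noteq> z \<Longrightarrow> y \<noteq> z \<Longrightarrow> False"
  shows "finite A \<and> card A \<le> 2"
proof -
  have "\<not> (\<exists>B. B \<subseteq> A \<and> card B = 3)"
  proof
    assume "\<exists>B. B \<subseteq> A \<and> card B = 3"
    then obtain B where B: "B \<subseteq> A" "card B = 3" by blast
    then obtain x y z where "B = {x, y, z}" "x \<noteq> y" "x \<noteq> z" "y \<noteq> z" by (auto simp: card_3_iff)
    then show False using assms[of x y z] B by blast
  qed
  then have fin: "finite A" by (metis infinite_arbitrarily_large)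
  then show ?thesis using \<open>\<not> _\<close> by (metis obtain_subset_with_card_n not_less_eq_eq eval_nat_numeral(3))
qed

context tess
begin

text \<open>A collar coordinate: \<open>t\<close> runs along the side and \<open>s\<close> is the
  depth into the face, with \<open>s = 0\<close> on the edge and \<open>s = 1\<close> at the
  centre.\<close>

definition page :: "'a flag \<Rightarrow> real \<Rightarrow> real \<Rightarrow> 'a" where
  "page x t s = \<Phi> (fst x) ((1 - s) *\<^sub>R fpt x t)"

lemma page_0: "x \<in> Fl \<Longrightarrow> t \<in> {0..1} \<Longrightarrow> page x t 0 = half_edge x t"
  unfolding page_def using \<Phi>_fpt by simp

lemma fpt_interior_eqD:
  assumes x: "x \<in> Fl" "y \<in> Fl" "fst x = fst y" and t: "t \<in> {0<..<1}" "t' \<in> {0..1}" and eq: "fpt x t = fpt y t'"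
  shows "(x = y \<and> t = t') \<or> (y = r0 x \<and> t' = 1 - t)"
proof -
  obtain C i b where xx: "x = (C, i, b)" by (cases x) auto
  obtain j c where yy: "y = (C, j, c)" using x(3) xx by (cases y) auto
  have i: "C \<in> F" "i < n C" "j < n C" using x xx yy by auto
  define s s' where "s = (if b then 1 - t else t)" and "s' = (if c then 1 - t' else t')"
  have s: "s \<in> {0..1}" "s' \<in> {0..1}" "s \<noteq> 0" "s \<noteq> 1" using t by (auto simp: s_def s'_def)
  have "ps C i s = ps C j s'" using eq by (simp add: xx yy s_def s'_def traverse_def split: if_splits)
  from polygon_side_eqD[OF n_ge_1[OF i(1)] i(2,3) s(1,2) this] have "i = j" "s = s'" using s by auto
  then show ?thesis by (cases b; cases c) (auto simp: xx yy s_def s'_def)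
qed

lemma page_face_iff:
  assumes "x \<in> Fl" "t \<in> {0..1}" "s \<in> {0..1}"
  shows "page x t s \<in> gsupport \<Gamma> \<longleftrightarrow> s = 0"
proof (cases "s = 0")
  case True
  then show ?thesis using page_0[OF assms(1,2)] edge_subset[OF half_Ed[OF assms(1)] assms(2)] by auto
next
  case False
  then have "(1 - s) *\<^sub>R fpt x t \<in> ball 0 1" using assms by simp
  then have "page x t s \<in> fst x" unfolding page_def using \<Phi>_ball[OF Fl_face[OF assms(1)]] by blast
  then show ?thesis using face_sub[OF Fl_face[OF assms(1)]] False by blast
qed

text \<open>At positive depth the point lies in an open face, where the polygon map is injective;
  norms give the depth and then the boundary point. The only ambiguity is reading the same side from
  its other end.\<close>

lemma page_eqD:
  assumes xy: "x \<in> Fl" "y \<in> Fl" and t: "t \<in> {0<..<1}" "t' \<in> {0<..<1}" and s: "s \<in> {0<..<1}" "s' \<in> {0..<1}"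
    and eq: "page x t s = page y t' s'"
  shows "s = s' \<and> (x = y \<and> t = t' \<or> y = r0 x \<and> t' = 1 - t)"
proof -
  have "(1 - s) *\<^sub>R fpt x t \<in> ball 0 1" "(1 - s') *\<^sub>R fpt y t' \<in> cball 0 1" using s by auto
  then have "fst x = fst y" and e: "(1 - s) *\<^sub>R fpt x t = (1 - s') *\<^sub>R fpt y t'"
    using \<Phi>_eqD[OF Fl_face[OF xy(1)] Fl_face[OF xy(2)]] eq unfolding page_def by blast+
  have "norm ((1 - s) *\<^sub>R fpt x t) = norm ((1 - s') *\<^sub>R fpt y t')" using e by (rule arg_cong)
  then have "s = s'" using s by auto
  then have "fpt x t = fpt y t'" using e s by auto
  then show ?thesis using fpt_interior_eqD[OF xy \<open>fst x = fst y\<close>] t \<open>s = s'\<close> by auto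
qed

text \<open>\<open>r0\<close> reverses the half-edge, so equal half-edges remove the ambiguity of
  \<open>page_eqD\<close>, and different pages can meet only along the edge.\<close>

lemma page_half_eqD:
  assumes xy: "x \<in> Fl" "y \<in> Fl" "half x = half y" and t: "t \<in> {0<..<1}" "t' \<in> {0<..<1}"
    and s: "s \<in> {0..<1}" "s' \<in> {0..<1}" and eq: "page x t s = page y t' s'"
  shows "s = s' \<and> t = t' \<and> (s = 0 \<or> x = y)"
proof (cases "s = 0")
  case True
  then have "page y t' s' \<in> gsupport \<Gamma>" using page_face_iff[OF xy(1), of t s] eq t s by auto
  then have "s' = 0" using page_face_iff[OF xy(2), of t' s'] t s by auto
  then have "half_edge x t = half_edge x t'"
    using eq True page_0[OF xy(1), of t] page_0[OF xy(2), of t'] t xy(3) by auto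
  from traverse_eqD[OF half_Ed[OF xy(1)] half_Ed[OF xy(1)] t(1) _ this] have "t = t'" using t(2) by simp
  then show ?thesis using True \<open>s' = 0\<close> by simp
next
  case False
  then have "s = s' \<and> (x = y \<and> t = t' \<or> y = r0 x \<and> t' = 1 - t)" using page_eqD[OF xy(1,2) t _ s(2) eq] s(1) by auto
  moreover have "y \<noteq> r0 x"
  proof
    assume "y = r0 x"
    then have "snd (half x) = (\<not> snd (half x))" using xy(3) half_r0[of x] by (metis snd_conv)
    then show False by simp
  qed
  ultimately show ?thesis by blast
qed

lemma continuous_map_page:
  assumes x: "x \<in> Fl" and f: "continuous_on S f" "continuous_on S g" and fg: "\<And>z. z \<in> S \<Longrightarrow> g z \<in> {0..1}"
  shows "continuous_map (top_of_set S) X (\<lambda>z. page x (f z) (g z))"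
proof -
  have "continuous_map (top_of_set S) (top_of_set (cball 0 1)) (\<lambda>z. (1 - g z) *\<^sub>R fpt x (f z))"
    unfolding continuous_map_in_subtopology
    using fg by (auto intro!: continuous_intros f)
  from continuous_map_compose[OF this \<Phi>_cont[OF Fl_face[OF x]]] show ?thesis
    by (simp add: page_def comp_def)
qed

text \<open>Two pages bound to the same half-edge form an open disc, by invariance of domain.\<close>

lemma open_double_page:
  assumes xy: "x \<in> Fl" "y \<in> Fl" "half x = half y" "x \<noteq> y"
  defines "W \<equiv> {z. 0 < Re z \<and> Re z < 1 \<and> -1 < Im z \<and> Im z < 1}"
  shows "openin X ((\<lambda>z. if 0 \<le> Im z then page x (Re z) (Im z) else page y (Re z) (- Im z)) ` W)"
proof (rule invariance_of_domain_surface[OF surf])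
  have "W = {z. 0 < Re z} \<inter> {z. Re z < 1} \<inter> {z. -1 < Im z} \<inter> {z. Im z < 1}" unfolding W_def by auto
  then show "open W" by (auto intro!: open_Int open_halfspace_Re_gt open_halfspace_Re_lt open_halfspace_Im_gt open_halfspace_Im_lt)
  show "continuous_map (top_of_set W) X (\<lambda>z. if 0 \<le> Im z then page x (Re z) (Im z) else page y (Re z) (- Im z))"
  proof (rule continuous_map_cases_le)
    show "continuous_map (top_of_set W) euclideanreal (\<lambda>z. 0)" by simp
    show "continuous_map (top_of_set W) euclideanreal Im" by (auto intro!: continuous_intros)
    show "continuous_map (subtopology (top_of_set W) {z \<in> topspace (top_of_set W). 0 \<le> Im z}) X (\<lambda>z. page x (Re z) (Im z))"
      unfolding subtopology_subtopology
      by (rule continuous_map_page[OF xy(1)]) (auto intro!: continuous_intros simp: W_def)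
    show "continuous_map (subtopology (top_of_set W) {z \<in> topspace (top_of_set W). Im z \<le> 0}) X (\<lambda>z. page y (Re z) (- Im z))"
      unfolding subtopology_subtopology
      by (rule continuous_map_page[OF xy(2)]) (auto intro!: continuous_intros simp: W_def)
    fix z assume "z \<in> topspace (top_of_set W)" "0 = Im z"
    then show "page x (Re z) (Im z) = page y (Re z) (- Im z)"
      using page_0[OF xy(1), of "Re z"] page_0[OF xy(2), of "Re z"] xy(3) by (auto simp: W_def)
  qed
  show "inj_on (\<lambda>z. if 0 \<le> Im z then page x (Re z) (Im z) else page y (Re z) (- Im z)) W"
  proof (rule inj_onI)
    fix z w assume zw: "z \<in> W" "w \<in> W" and
      eq: "(if 0 \<le> Im z then page x (Re z) (Im z) else page y (Re z) (- Im z)) =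
           (if 0 \<le> Im w then page x (Re w) (Im w) else page y (Re w) (- Im w))"
    define a b where "a = (if 0 \<le> Im z then x else y)" and "b = (if 0 \<le> Im w then x else y)"
    have eq': "page a (Re z) \<bar>Im z\<bar> = page b (Re w) \<bar>Im w\<bar>" using eq by (auto simp: a_def b_def)
    have ab: "a \<in> Fl" "b \<in> Fl" "half a = half b" using xy by (auto simp: a_def b_def)
    have "\<bar>Im z\<bar> = \<bar>Im w\<bar> \<and> Re z = Re w \<and> (\<bar>Im z\<bar> = 0 \<or> a = b)"
      by (rule page_half_eqD[OF ab _ _ _ _ eq']) (use zw in \<open>auto simp: W_def\<close>)
    then show "z = w" using xy(4) unfolding a_def b_def by (auto simp: complex_eq_iff split: if_splits)
  qed
qed

text \<open>Two pages already form a neighbourhood of the midpoint of the edge. The third page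
  approaches that midpoint, so it would meet one of them at positive depth.\<close>

lemma no_three_pages:
  assumes x: "x \<in> Fl" "y \<in> Fl" "z \<in> Fl" "half x = h" "half y = h" "half z = h" and d: "x \<noteq> y" "x \<noteq> z" "y \<noteq> z"
  shows False
proof -
  define W where "W = {z. 0 < Re z \<and> Re z < 1 \<and> -1 < Im z \<and> Im z < 1}"
  let ?Q = "\<lambda>z. if 0 \<le> Im z then page x (Re z) (Im z) else page y (Re z) (- Im z)"
  have op: "openin X (?Q ` W)" unfolding W_def by (rule open_double_page) (use x d in auto)
  have c: "continuous_map (top_of_set {0..1}) X (\<lambda>s. page z (1/2) s)"
    by (rule continuous_map_page[OF x(3)]) (auto intro!: continuous_intros)
  have "page z (1/2) 0 = page x (1/2) 0"
    using page_0[OF x(1), of "1/2"] page_0[OF x(3), of "1/2"] x by simp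
  then have "page z (1/2) 0 = ?Q (Complex (1/2) 0)" by simp
  moreover have "Complex (1/2) 0 \<in> W" unfolding W_def by simp
  ultimately have "page z (1/2) 0 \<in> ?Q ` W" by (rule image_eqI)
  then obtain s where s: "s \<in> {0<..<1/3}" "page z (1/2) s \<in> ?Q ` W"
    by (rule continuous_map_interval_approach[OF c op])
  then obtain w where w: "w \<in> W" "page z (1/2) s = ?Q w" by blast
  define a where "a = (if 0 \<le> Im w then x else y)"
  have a: "a \<in> Fl" "half z = half a" "page z (1/2) s = page a (Re w) \<bar>Im w\<bar>" using w(2) x by (auto simp: a_def)
  have "s = \<bar>Im w\<bar> \<and> 1/2 = Re w \<and> (s = 0 \<or> z = a)"
    by (rule page_half_eqD[OF x(3) a(1,2) _ _ _ _ a(3)]) (use s(1) w(1) in \<open>auto simp: W_def\<close>)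
  then show False using s(1) d unfolding a_def by (auto split: if_splits)
qed

lemma flags_over_half: "finite {x \<in> Fl. half x = h} \<and> card {x \<in> Fl. half x = h} \<le> 2"
proof (rule card_le_2_if_no_three)
  fix x y z assume "x \<in> {x \<in> Fl. half x = h}" "y \<in> {x \<in> Fl. half x = h}" "z \<in> {x \<in> Fl. half x = h}"
    "x \<noteq> y" "x \<noteq> z" "y \<noteq> z"
  then show False by (intro no_three_pages[of x y z h]) simp_all
qed

lemma finite_Fl: "finite Fl"
proof -
  have "Fl \<subseteq> (\<Union>h\<in>Ed \<times> UNIV. {x \<in> Fl. half x = h})"
  proof
    fix x assume x: "x \<in> Fl"
    then have "half x \<in> Ed \<times> UNIV" using half_Ed by (simp add: mem_Times_iff)
    then show "x \<in> (\<Union>h\<in>Ed \<times> UNIV. {x \<in> Fl. half x = h})" using x by (intro UN_I) simp_all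
  qed
  moreover have "finite (\<Union>h\<in>Ed \<times> UNIV. {x \<in> Fl. half x = h})"
    by (intro finite_UN_I) (simp_all add: finite_Ed flags_over_half)
  ultimately show ?thesis by (rule finite_subset)
qed

lemma finite_F: "finite F"
proof -
  have "F \<subseteq> fst ` Fl"
  proof
    fix C assume "C \<in> F"
    then have "(C, 0, False) \<in> Fl" using n_ge_1[of C] by simp
    then show "C \<in> fst ` Fl" by (metis fst_conv imageI)
  qed
  then show ?thesis using finite_Fl finite_surj by blast
qed

text \<open>An edge with at most one page would have a neighbourhood embedded in a closed half-plane.\<close>

lemma two_flags_over_half:
  assumes e: "e \<in> Ed"
  obtains x y where "x \<in> Fl" "y \<in> Fl" "x \<noteq> y" "half x = (e, b)" "half y = (e, b)"
proof (rule ccontr)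
  assume "\<not> thesis"
  then have one: "\<And>x y. x \<in> Fl \<Longrightarrow> y \<in> Fl \<Longrightarrow> half x = (e, b) \<Longrightarrow> half y = (e, b) \<Longrightarrow> x = y" using that by blast
  \<comment> \<open>The closed set \<open>K\<close> collects everything away from the middle half of
    \<open>e\<close>: the vertices, the other edges, the outer quarters of \<open>e\<close>, and all
    points of faces except those at depth below 1/2 over the middle half. Its complement is a
    neighbourhood of the midpoint \<open>m\<close>.\<close>
  define T where "T y = {w \<in> {0..1::real} \<times> {0..1::real}. fst (half y) = e \<longrightarrow> fst w \<le> 1/2 \<or> snd w \<le> 1/4 \<or> 3/4 \<le> snd w}" for y
  define J where "J e' = (if e' = e then {0..1/4} \<union> {3/4..1} else {0..1::real})" for e'
  have J: "t \<in> J e' \<longleftrightarrow> t \<in> {0..1} \<and> (e' = e \<longrightarrow> t \<le> 1/4 \<or> 3/4 \<le> t)" for t e' by (auto simp: J_def)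
  define K where "K = V \<union> (\<Union>e'\<in>Ed. e' ` J e')
     \<union> (\<Union>y\<in>Fl. (\<lambda>w. \<Phi> (fst y) (fst w *\<^sub>R fpt y (snd w))) ` T y)"
  define m where "m = traverse e b (1/2)"
  have KX: "closedin X K"
  proof -
    have "closedin X V" using closedin_Hausdorff_finite[OF hausdorff V_sub finite_V] .
    moreover have "closedin X (e' ` J e')" if e': "e' \<in> Ed" for e'
    proof -
      have "compactin (top_of_set {0..1}) (J e')"
        by (auto simp: compactin_subtopology J_def)
      then have "compactin X (e' ` J e')"
        using edge(1)[OF e'] image_compactin unfolding pathin_def by blast
      then show ?thesis using compactin_imp_closedin[OF hausdorff] by blast
    qed
    moreover have "closedin X ((\<lambda>w. \<Phi> (fst y) (fst w *\<^sub>R fpt y (snd w))) ` T y)" if y: "y \<in> Fl" for y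
    proof -
      have "T y = ({0..1} \<times> {0..1}) \<inter> (if fst (half y) = e then {w. fst w \<le> 1/2} \<union> {w. snd w \<le> 1/4} \<union> {w. 3/4 \<le> snd w} else UNIV)"
        unfolding T_def by auto
      moreover have "closed ({w. fst w \<le> 1/2} \<union> {w. snd w \<le> 1/4} \<union> {w :: real \<times> real. 3/4 \<le> snd w})"
        by (intro closed_Un closed_Collect_le continuous_intros)
      ultimately have cT: "compact (T y)"
        using compact_Int_closed[OF compact_Times[OF compact_Icc compact_Icc]] by auto
      have "continuous_map (top_of_set (T y)) (top_of_set (cball 0 1)) (\<lambda>w. fst w *\<^sub>R fpt y (snd w))"
        unfolding continuous_map_in_subtopology
        by (auto intro!: continuous_intros simp: T_def)
      from continuous_map_compose[OF this \<Phi>_cont[OF Fl_face[OF y]]]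
      have "continuous_map (top_of_set (T y)) X (\<lambda>w. \<Phi> (fst y) (fst w *\<^sub>R fpt y (snd w)))" by (simp add: comp_def)
      moreover have "compactin (top_of_set (T y)) (T y)" using cT by (simp add: compactin_subtopology)
      ultimately show ?thesis using image_compactin compactin_imp_closedin[OF hausdorff] by blast
    qed
    ultimately show ?thesis unfolding K_def
      by (intro closedin_Un closedin_Union) (use finite_Ed finite_Fl in auto)
  qed
  have mtop: "m \<in> topspace X" and mV: "m \<notin> V" and msup: "m \<in> gsupport \<Gamma>"
    using edge_subset[OF e, of "1/2" b] traverse_V_iff[OF e, of "1/2" b] unfolding m_def by auto
  have mK: "m \<notin> K"
  proof
    assume "m \<in> K"
    then consider e' where "e' \<in> Ed" "m \<in> e' ` J e'"
      | y where "y \<in> Fl" "m \<in> (\<lambda>w. \<Phi> (fst y) (fst w *\<^sub>R fpt y (snd w))) ` T y"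
      using mV unfolding K_def by blast
    then show False
    proof cases
      case (1 e')
      then obtain t where t: "t \<in> J e'" "m = e' t" by blast
      have "traverse e b (1/2) = traverse e' False t" using t(2) unfolding m_def by (simp add: traverse_def)
      moreover have "t \<in> {0..1}" using t(1) J by blast
      ultimately have "e = e' \<and> t = 1/2" using traverse_eqD[OF e 1(1), of "1/2" t b False] by (cases b) auto
      then show False using t(1) J[of t e'] by auto
    next
      case (2 y)
      then obtain w where "w \<in> T y" "m = \<Phi> (fst y) (fst w *\<^sub>R fpt y (snd w))" by blast
      then obtain r t where rt: "(r, t) \<in> T y" "m = \<Phi> (fst y) (r *\<^sub>R fpt y t)" by (cases w) auto
      note 2 = 2(1) rt
      have r: "r \<in> {0..1}" "t \<in> {0..1}" using 2(2) unfolding T_def by auto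
      have "r = 1"
      proof (rule ccontr)
        assume "r \<noteq> 1"
        then have "r *\<^sub>R fpt y t \<in> ball 0 1" using r by simp
        then have "m \<in> fst y" using 2 \<Phi>_ball[OF Fl_face[OF 2(1)]] by blast
        then show False using msup face_sub[OF Fl_face[OF 2(1)]] by blast
      qed
      then have "traverse e b (1/2) = half_edge y t"
        using 2(3) \<Phi>_fpt[OF 2(1) r(2)] unfolding m_def by simp
      from traverse_eqD[OF e half_Ed[OF 2(1)] _ r(2) this] have "e = fst (half y) \<and> t = 1/2" by auto
      then show False using 2(2) \<open>r = 1\<close> unfolding T_def by auto
    qed
  qed
  define N where "N = topspace X - K"
  have N: "openin X N" "m \<in> N" unfolding N_def using KX mtop mK by (auto simp: openin_diff)
  \<comment> \<open>What remains lies on \<open>e\<close> or on a page over \<open>e\<close>; a page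
    read in the wrong direction is replaced by that of \<open>r0 y\<close>.\<close>
  have Ncases: "(\<exists>t\<in>{1/4<..<3/4}. u = traverse e b t) \<or>
      (\<exists>x\<in>Fl. half x = (e, b) \<and> (\<exists>t\<in>{1/4<..<3/4}. \<exists>s\<in>{0..<1/2}. u = page x t s))" if u: "u \<in> N" for u
  proof (cases "u \<in> gsupport \<Gamma>")
    case True
    have "u \<notin> V" using u unfolding N_def K_def by blast
    then obtain e' t where et: "e' \<in> Ed" "t \<in> {0<..<1}" "u = e' t"
      using support_cases[OF True] by blast
    have uK: "u \<notin> (\<Union>e'\<in>Ed. e' ` J e')" using u unfolding N_def K_def by blast
    have "t \<notin> J e'" using uK et(1,3) by blast
    then have "e' = e" "t \<in> {1/4<..<3/4}" using J[of t e'] et(2) by auto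
    then have "u = traverse e b (if b then 1 - t else t)" "(if b then 1 - t else t) \<in> {1/4<..<3/4}"
      using et by (auto simp: traverse_def)
    then show ?thesis by blast
  next
    case False
    have "u \<in> topspace X" using u unfolding N_def by blast
    then obtain C where C: "C \<in> F" "u \<in> C" using faces_cover False by blast
    then obtain z where z: "z \<in> ball 0 1" "u = \<Phi> C z" using \<Phi>_hom(1)[OF C(1)] by blast
    then have "z \<in> cball 0 1" by auto
    from C(1) this obtain r i c t where
      rt: "r \<in> {0..1}" "i < n C" "t \<in> {0..1/2}" "z = r *\<^sub>R fpt (C, i, c) t"
      by (rule polygon_flag_coords)
    define y where "y = (C, i, c)"
    have y: "y \<in> Fl" "fst y = C" using C rt by (auto simp: y_def)
    have uy: "u = \<Phi> (fst y) (r *\<^sub>R fpt y t)" using z rt y by (simp add: y_def)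
    have "(r, t) \<notin> T y"
    proof
      assume "(r, t) \<in> T y"
      then have "u \<in> (\<lambda>w. \<Phi> (fst y) (fst w *\<^sub>R fpt y (snd w))) ` T y"
        by (rule rev_image_eqI) (simp add: uy)
      then show False using u y(1) unfolding N_def K_def by blast
    qed
    then have ye: "fst (half y) = e" "r > 1/2" "t \<in> {1/4<..<3/4}" using rt unfolding T_def by auto
    have r1: "r < 1"
    proof (rule ccontr)
      assume "\<not> r < 1"
      then have "norm z = 1" using rt(1) unfolding rt(4) by (simp del: fpt.simps)
      then show False using z by simp
    qed
    show ?thesis
    proof (cases "snd (half y) = b")
      case True
      then have "half y = (e, b)" using ye(1) by (simp add: prod_eq_iff)
      moreover have "u = page y t (1 - r)" using uy by (simp add: page_def)
      moreover have "1 - r \<in> {0..<1/2}" using r1 ye by auto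
      ultimately show ?thesis using y ye by blast
    next
      case False
      then have "half (r0 y) = (e, b)" using ye(1) half_r0[of y] by simp
      moreover have "u = page (r0 y) (1 - t) (1 - r)" using uy by (simp add: page_def fpt_r0)
      moreover have "1 - r \<in> {0..<1/2}" "1 - t \<in> {1/4<..<3/4}" using r1 ye by auto
      ultimately show ?thesis using r0_Fl[OF y(1)] by blast
    qed
  qed
  \<comment> \<open>With at most one page, \<open>N\<close> sits inside the embedded image of a set
    \<open>D\<close> in the closed upper half-plane, a segment or a rectangle, and \<open>m\<close>
    corresponds to a point on the boundary line, which cannot be interior to
    \<open>D\<close>.\<close>
  have half_plane: "Complex (1/2) 0 \<notin> interior D" if D: "D \<subseteq> {z. 0 \<le> Im z}" for D
  proof
    assume "Complex (1/2) 0 \<in> interior D"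
    then obtain d where d: "d > 0" "ball (Complex (1/2) 0) d \<subseteq> D" using mem_interior by blast
    have "Complex (1/2) (- d/2) \<in> ball (Complex (1/2) 0) d" using d(1) by (simp add: dist_norm cmod_def)
    then have "Complex (1/2) (- d/2) \<in> {z. 0 \<le> Im z}" using d(2) D by blast
    then show False using d(1) by simp
  qed
  show False
  proof (cases "\<exists>x\<in>Fl. half x = (e, b)")
    case False
    define D where "D = {z. Re z \<in> {1/4..3/4} \<and> Im z = 0}"
    have "D = cbox (Complex (1/4) 0) (Complex (3/4) 0)" unfolding D_def by (auto simp: in_cbox_complex_iff)
    then have "compact D" by simp
    have "continuous_map (top_of_set D) (top_of_set {0..1}) (\<lambda>z. if b then 1 - Re z else Re z)"
      unfolding continuous_map_in_subtopology by (auto simp: D_def intro!: continuous_intros)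
    from continuous_map_compose[OF this edge(1)[OF e, unfolded pathin_def]]
    have c: "continuous_map (top_of_set D) X (\<lambda>z. traverse e b (Re z))"
      by (cases b) (simp_all add: traverse_def comp_def)
    have inj: "inj_on (\<lambda>z. traverse e b (Re z)) D"
    proof (rule inj_onI)
      fix z w assume zw: "z \<in> D" "w \<in> D" "traverse e b (Re z) = traverse e b (Re w)"
      from traverse_eqD[OF e e _ _ zw(3)] zw(1,2) have "Re z = Re w" by (auto simp: D_def)
      then show "z = w" using zw(1,2) by (auto simp: D_def complex_eq_iff)
    qed
    have "Complex (1/2) 0 \<in> interior D"
    proof (rule interior_of_embedded_compact[OF surf \<open>compact D\<close> c inj N(1)])
      show "N \<subseteq> (\<lambda>z. traverse e b (Re z)) ` D"
      proof
        fix u assume "u \<in> N"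
        then obtain t where "t \<in> {1/4<..<3/4}" "u = traverse e b t" using Ncases False by blast
        then show "u \<in> (\<lambda>z. traverse e b (Re z)) ` D"
          by (intro image_eqI[of _ _ "Complex t 0"]) (auto simp: D_def)
      qed
    qed (use N(2) in \<open>auto simp: D_def m_def\<close>)
    moreover have "D \<subseteq> {z. 0 \<le> Im z}" unfolding D_def by auto
    ultimately show False using half_plane by blast
  next
    case True
    then obtain x where x: "x \<in> Fl" "half x = (e, b)" by blast
    define D where "D = {z. Re z \<in> {1/4..3/4} \<and> Im z \<in> {0..1/2}}"
    have "D = cbox (Complex (1/4) 0) (Complex (3/4) (1/2))" unfolding D_def by (auto simp: in_cbox_complex_iff)
    then have "compact D" by simp
    have c: "continuous_map (top_of_set D) X (\<lambda>z. page x (Re z) (Im z))"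
      by (rule continuous_map_page[OF x(1)]) (auto simp: D_def intro!: continuous_intros)
    have inj: "inj_on (\<lambda>z. page x (Re z) (Im z)) D"
    proof (rule inj_onI)
      fix z w assume zw: "z \<in> D" "w \<in> D" "page x (Re z) (Im z) = page x (Re w) (Im w)"
      have "Im z = Im w \<and> Re z = Re w \<and> (Im z = 0 \<or> x = x)"
        by (rule page_half_eqD[OF x(1) x(1) _ _ _ _ _ zw(3)]) (use zw in \<open>auto simp: D_def\<close>)
      then show "z = w" by (auto simp: complex_eq_iff)
    qed
    have edge0: "traverse e b t = page x t 0" if "t \<in> {1/4<..<3/4}" for t
      using page_0[OF x(1), of t] that x(2) by auto
    have "Complex (1/2) 0 \<in> interior D"
    proof (rule interior_of_embedded_compact[OF surf \<open>compact D\<close> c inj N(1)])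
      show "N \<subseteq> (\<lambda>z. page x (Re z) (Im z)) ` D"
      proof
        fix u assume "u \<in> N"
        from Ncases[OF this] consider t where "t \<in> {1/4<..<3/4}" "u = traverse e b t"
          | y t s where "y \<in> Fl" "half y = (e, b)" "t \<in> {1/4<..<3/4}" "s \<in> {0..<1/2}" "u = page y t s" by blast
        then obtain t s where ts: "t \<in> {1/4<..<3/4}" "s \<in> {0..<1/2::real}" "u = page x t s"
        proof cases
          case (1 t) then show ?thesis using that[of t 0] edge0[of t] by simp
        next
          case (2 y t s)
          have "y = x" by (rule one[OF 2(1) x(1) 2(2) x(2)])
          then show ?thesis using that[OF 2(3,4)] 2(5) by simp
        qed
        show "u \<in> (\<lambda>z. page x (Re z) (Im z)) ` D"
          by (rule image_eqI[of _ _ "Complex t s"]) (use ts in \<open>auto simp: D_def\<close>)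
      qed
      show "page x (Re (Complex (1/2) 0)) (Im (Complex (1/2) 0)) \<in> N" using edge0[of "1/2"] N(2) by (simp add: m_def)
    qed (simp add: D_def)
    moreover have "D \<subseteq> {z. 0 \<le> Im z}" unfolding D_def by auto
    ultimately show False using half_plane by blast
  qed
qed

lemma card_flags_over_half:
  assumes "e \<in> Ed" shows "card {x \<in> Fl. half x = (e, b)} = 2"
proof -
  obtain x y where "x \<in> Fl" "y \<in> Fl" "x \<noteq> y" "half x = (e, b)" "half y = (e, b)"
    using two_flags_over_half[OF assms] .
  then have "card {x, y} \<le> card {x \<in> Fl. half x = (e, b)}"
    by (intro card_mono) (use flags_over_half in auto)
  then show ?thesis using flags_over_half[of "(e, b)"] \<open>x \<noteq> y\<close> by simp
qed

text \<open>Not described through the face on the other side: when an edge lies twice on the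
  boundary walk of one face, both flags have that same face.\<close>

definition r2 :: "'a flag \<Rightarrow> 'a flag" where
  "r2 x = (THE y. y \<in> Fl \<and> half y = half x \<and> y \<noteq> x)"

lemma r2:
  assumes "x \<in> Fl"
  shows "r2 x \<in> Fl" "half (r2 x) = half x" "r2 x \<noteq> x"
    "z \<in> Fl \<Longrightarrow> half z = half x \<Longrightarrow> z = x \<or> z = r2 x"
proof -
  have "card {y \<in> Fl. half y = half x} = 2"
    using card_flags_over_half[OF half_Ed[OF assms], of "snd (half x)"] by simp
  then have "\<exists>a b. {y \<in> Fl. half y = half x} = {a, b} \<and> a \<noteq> b" by (simp only: card_2_iff)
  then obtain a b where ab: "{y \<in> Fl. half y = half x} = {a, b}" "a \<noteq> b" by (elim exE conjE)
  have "x \<in> {a, b}" using assms ab(1) by blast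
  then consider "x = a" | "x = b" by blast
  then obtain y where y: "{y \<in> Fl. half y = half x} = {x, y}" "y \<noteq> x"
  proof cases
    case 1 show ?thesis by (rule that[of b]) (use ab 1 in blast)+
  next
    case 2 show ?thesis by (rule that[of a]) (use ab 2 in blast)+
  qed
  have in_iff: "z \<in> Fl \<and> half z = half x \<longleftrightarrow> z = x \<or> z = y" for z using y(1) by blast
  have "r2 x = y" unfolding r2_def
  proof (rule the_equality)
    show "y \<in> Fl \<and> half y = half x \<and> y \<noteq> x" using in_iff[of y] y(2) by simp
    show "z = y" if "z \<in> Fl \<and> half z = half x \<and> z \<noteq> x" for z using in_iff[of z] that by simp
  qed
  then show "r2 x \<in> Fl" "half (r2 x) = half x" "r2 x \<noteq> x"
    "z \<in> Fl \<Longrightarrow> half z = half x \<Longrightarrow> z = x \<or> z = r2 x" for z using in_iff[of y] in_iff[of z] y(2) by simp_all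
qed

lemma r2_r2:
  assumes x: "x \<in> Fl" shows "r2 (r2 x) = x"
proof -
  have "x = r2 x \<or> x = r2 (r2 x)" by (rule r2(4)[OF r2(1)[OF x] x r2(2)[OF x, symmetric]])
  then show ?thesis using r2(3)[OF x] by (auto simp del: fpt.simps)
qed

lemma r0_r2:
  assumes x: "x \<in> Fl" shows "r0 (r2 x) = r2 (r0 x)"
proof -
  have "half (r0 (r2 x)) = half (r0 x)" using r2(2)[OF x] half_r0 by simp
  moreover have "r0 (r2 x) \<noteq> r0 x" using r2(3)[OF x] r0_r0 by metis
  ultimately show ?thesis using r2(4)[OF r0_Fl[OF x] r0_Fl[OF r2(1)[OF x]]] by blast
qed

section \<open>Connectivity of the flags\<close>

text \<open>Polar coordinates on the polygon of a flag: \<open>fst w\<close> is the radius, with 1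
  on the boundary, and \<open>snd w\<close> the position on the side measured from the
  corner.\<close>

definition cone :: "'a flag \<Rightarrow> real \<times> real \<Rightarrow> 'a" where
  "cone x w = \<Phi> (fst x) (fst w *\<^sub>R fpt x (snd w))"

definition vx :: "'a flag \<Rightarrow> 'a" where
  "vx x = half_edge x 0"

lemma vx_V: "x \<in> Fl \<Longrightarrow> vx x \<in> V"
  unfolding vx_def by (rule traverse_end[OF half_Ed])

lemma cone_1: "x \<in> Fl \<Longrightarrow> t \<in> {0..1} \<Longrightarrow> cone x (1, t) = half_edge x t"
  unfolding cone_def by (simp add: \<Phi>_fpt)

lemma cone_support_iff:
  assumes "x \<in> Fl" "r \<in> {0..1}" "t \<in> {0..1}" shows "cone x (r, t) \<in> gsupport \<Gamma> \<longleftrightarrow> r = 1"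
  using page_face_iff[OF assms(1,3), of "1 - r"] assms(2) unfolding cone_def page_def by simp

lemma vx_r1: "x \<in> Fl \<Longrightarrow> vx (r1 x) = vx x"
  using cone_1[of x 0] cone_1[OF r1_Fl, of x 0] fpt_r1[of x] unfolding vx_def cone_def by simp

lemma vx_r2: "x \<in> Fl \<Longrightarrow> vx (r2 x) = vx x"
  unfolding vx_def by (simp add: r2(2))

lemma closedin_cone:
  assumes x: "x \<in> Fl" and T: "compact T" "T \<subseteq> {0..1} \<times> {0..1}"
  shows "closedin X (cone x ` T)"
proof -
  have "continuous_map (top_of_set T) (top_of_set (cball 0 1)) (\<lambda>w. fst w *\<^sub>R fpt x (snd w))"
    unfolding continuous_map_in_subtopology
    using T(2) by (auto intro!: continuous_intros)
  from continuous_map_compose[OF this \<Phi>_cont[OF Fl_face[OF x]]]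
  have "continuous_map (top_of_set T) X (cone x)" by (simp add: comp_def cone_def[abs_def])
  moreover have "compactin (top_of_set T) T" using T(1) by (simp add: compactin_subtopology)
  ultimately show ?thesis using image_compactin compactin_imp_closedin[OF hausdorff] by blast
qed

text \<open>Edge points are reached through the pages of their edge. Vertices are set apart because
  nothing so far places a flag at each of them.\<close>

lemma topspace_cases:
  assumes u: "u \<in> topspace X" "u \<notin> V"
  obtains x r t where "x \<in> Fl" "r \<in> {0..1}" "t \<in> {0..1/2}" "u = cone x (r, t)"
proof -
  have "\<exists>C z. C \<in> F \<and> z \<in> cball 0 1 \<and> u = \<Phi> C z"
  proof (cases "u \<in> gsupport \<Gamma>")
    case True
    then obtain e t where et: "e \<in> Ed" "t \<in> {0<..<1}" "u = e t" using support_cases[OF True] u(2) by blast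
    obtain x y where x: "x \<in> Fl" "half x = (e, False)" using two_flags_over_half[OF et(1), of False] by blast
    have "\<Phi> (fst x) (fpt x t) = u" using \<Phi>_fpt[OF x(1), of t] et x(2) by (simp add: traverse_def)
    moreover have "fpt x t \<in> cball 0 1" by (simp del: fpt.simps)
    ultimately show ?thesis using Fl_face[OF x(1)] by blast
  next
    case False
    then obtain C where C: "C \<in> F" "u \<in> C" using faces_cover[OF u(1)] by blast
    then obtain z where "z \<in> ball 0 1" "u = \<Phi> C z" using \<Phi>_hom(1)[OF C(1)] by blast
    then show ?thesis using C(1) ball_subset_cball by blast
  qed
  then obtain C z where C: "C \<in> F" "z \<in> cball 0 1" "u = \<Phi> C z" by blast
  obtain r i b t where rt: "r \<in> {0..1}" "i < n C" "t \<in> {0..1/2}" "z = r *\<^sub>R fpt (C, i, b) t"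
    by (rule polygon_flag_coords[OF C(1,2)])
  show ?thesis
    by (rule that[of "(C, i, b)" r t]) (use rt C in \<open>simp_all add: cone_def\<close>)
qed

text \<open>With side parameters at most 1/3 the midpoints are out of reach, so \<open>r0\<close>
  cannot occur: inside a face only \<open>r1\<close> leads to a neighbouring sector, and along an
  edge only \<open>r2\<close>.\<close>

lemma cone_eq_cases:
  assumes w: "w \<in> Fl" "w' \<in> Fl" and r: "r \<in> {1/2..1}" "r' \<in> {1/2..1}" and t: "t \<in> {0..1/3}" "t' \<in> {0..1/3}"
    and eq: "cone w (r, t) = cone w' (r', t')"
  shows "cone w (r, t) = vx w \<or> w' = w \<or> w' = r1 w \<or> w' = r2 w"
proof (cases "r = 1")
  case False
  have t12: "t \<in> {0..1/2}" "t' \<in> {0..1/2}" using t by auto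
  have "r *\<^sub>R fpt w t \<in> ball 0 1" "r' *\<^sub>R fpt w' t' \<in> cball 0 1" using r False by (auto simp del: fpt.simps)
  then have *: "fst w = fst w' \<and> r *\<^sub>R fpt w t = r' *\<^sub>R fpt w' t'"
    using \<Phi>_eqD[OF Fl_face[OF w(1)] Fl_face[OF w(2)]] eq unfolding cone_def fst_conv snd_conv by blast
  then have "norm (r *\<^sub>R fpt w t) = norm (r' *\<^sub>R fpt w' t')" by simp
  then have "r = r'" using r by (simp del: fpt.simps)
  then have "fpt w t = fpt w' t'" using * r(1) by (auto simp del: fpt.simps)
  from fpt_eqD[OF w _ t12 this] * t show ?thesis by auto
next
  case True
  have r01: "r' \<in> {0..1}" "t' \<in> {0..1}" "t \<in> {0..1}" using r t by auto
  have "r' = 1" using cone_support_iff[OF w(1) _ r01(3), of r] cone_support_iff[OF w(2) r01(1,2)] eq True by simp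
  then have eq': "half_edge w t = half_edge w' t'"
    using eq cone_1[OF w(1) r01(3)] cone_1[OF w(2) r01(2)] True by simp
  show ?thesis
  proof (cases "t = 0")
    case t0: True
    then show ?thesis using cone_1[OF w(1), of 0] True unfolding vx_def by simp
  next
    case False
    then have "t \<in> {0<..<1}" using t by auto
    from traverse_eqD[OF half_Ed[OF w(1)] half_Ed[OF w(2)] this r01(2) eq']
    have "fst (half w) = fst (half w')" "snd (half w) = snd (half w')" using t by (auto split: if_splits)
    then have "half w' = half w" by (simp add: prod_eq_iff)
    then show ?thesis using r2(4)[OF w(1) w(2)] by blast
  qed
qed

text \<open>Otherwise the sectors at the vertex \<open>v\<close> would fall into two classes, those
  of flags in \<open>A\<close> and the rest. Both are closed, they are disjoint near
  \<open>v\<close> apart from \<open>v\<close> itself since neighbouring sectors are related by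
  \<open>r1\<close> or \<open>r2\<close>, and both reach every neighbourhood of \<open>v\<close>; so
  they would disconnect a punctured disc.\<close>

lemma vertex_connected:
  assumes A: "A \<subseteq> Fl" "\<And>w. w \<in> A \<Longrightarrow> r1 w \<in> A" "\<And>w. w \<in> A \<Longrightarrow> r2 w \<in> A"
    and x: "x \<in> A" and y: "y \<in> Fl" "vx y = vx x"
  shows "y \<in> A"
proof (rule ccontr)
  assume yA: "y \<notin> A"
  define v where "v = vx x"
  have xF: "x \<in> Fl" using A(1) x by blast
  define T where "T w = {p \<in> {0..1::real} \<times> {0..1/2::real}. vx w = v \<longrightarrow> fst p \<le> 1/2 \<or> 1/3 \<le> snd p}" for w :: "'a flag"
  define R where "R = {1/2..1::real} \<times> {0..1/3::real}"
  define A' B' where "A' = {w \<in> Fl. vx w = v \<and> w \<in> A}" and "B' = {w \<in> Fl. vx w = v \<and> w \<notin> A}"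
  \<comment> \<open>Everything except \<open>v\<close> and the truncated sectors
    \<open>r > 1/2\<close>, \<open>t < 1/3\<close> at \<open>v\<close>. The constants match
    \<open>R\<close>, so the points outside \<open>K\<close> other than \<open>v\<close> lie in
    \<open>P A'\<close> or \<open>P B'\<close>.\<close>
  define K where "K = (V - {v}) \<union> (\<Union>w\<in>Fl. cone w ` T w)"
  have cT: "compact (T w)" for w
  proof -
    have "T w = ({0..1} \<times> {0..1/2}) \<inter> (if vx w = v then {p. fst p \<le> 1/2} \<union> {p. 1/3 \<le> snd p} else UNIV)"
      unfolding T_def by auto
    moreover have "closed ({p. fst p \<le> 1/2} \<union> {p :: real \<times> real. 1/3 \<le> snd p})"
      by (intro closed_Un closed_Collect_le continuous_intros)
    ultimately show ?thesis
      using compact_Int_closed[OF compact_Times[OF compact_Icc compact_Icc]] by auto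
  qed
  have KX: "closedin X K"
  proof -
    have "closedin X (V - {v})" by (rule closedin_Hausdorff_finite[OF hausdorff]) (use V_sub finite_V in auto)
    moreover have "closedin X (cone w ` T w)" if "w \<in> Fl" for w
      by (rule closedin_cone[OF that cT]) (auto simp: T_def)
    ultimately show ?thesis unfolding K_def by (intro closedin_Un closedin_Union) (use finite_Fl in auto)
  qed
  have vV: "v \<in> V" using vx_V[OF xF] by (simp add: v_def)
  have vsup: "v \<in> gsupport \<Gamma>" using vV unfolding gsupport_def by blast
  have "v \<notin> K"
  proof
    assume "v \<in> K"
    then obtain w p where w: "w \<in> Fl" "p \<in> T w" "v = cone w p" unfolding K_def by blast
    obtain r t where p: "p = (r, t)" by (cases p)
    have rt: "r \<in> {0..1}" "t \<in> {0..1/2}" "vx w = v \<Longrightarrow> r \<le> 1/2 \<or> 1/3 \<le> t" using w(2) p unfolding T_def by auto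
    then have t1: "t \<in> {0..1}" by auto
    have "r = 1" using cone_support_iff[OF w(1) rt(1) t1] vsup w(3) p by simp
    then have vt: "v = half_edge w t" using cone_1[OF w(1) t1] w(3) p by simp
    then have "t = 0" using traverse_V_iff[OF half_Ed[OF w(1)] t1] vV rt(2) by auto
    then show False using rt(3) vt \<open>r = 1\<close> unfolding vx_def by simp
  qed
  then have N: "openin X (topspace X - K)" "v \<in> topspace X - K" using KX vV V_sub by auto
  obtain N' where N': "openin X N'" "v \<in> N'" "N' \<subseteq> topspace X - K" "connectedin X (N' - {v})"
    by (rule connected_punctured_nhd[OF surf N])
  define P where "P S = (\<Union>w\<in>S. cone w ` R)" for S
  have closedP: "closedin X (P S)" if "S \<subseteq> Fl" for S
    unfolding P_def
  proof (intro closedin_Union)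
    show "finite ((\<lambda>w. cone w ` R) ` S)" using finite_subset[OF that finite_Fl] by simp
    show "closedin X T" if T: "T \<in> (\<lambda>w. cone w ` R) ` S" for T
    proof -
      obtain w where w: "w \<in> S" "T = cone w ` R" using T by blast
      then have "w \<in> Fl" using \<open>S \<subseteq> Fl\<close> by blast
      show ?thesis unfolding w(2)
        by (rule closedin_cone[OF \<open>w \<in> Fl\<close>]) (auto simp: R_def intro!: compact_Times)
    qed
  qed
  have cov: "N' - {v} \<subseteq> P A' \<union> P B'"
  proof
    fix u assume u: "u \<in> N' - {v}"
    then have uK: "u \<in> topspace X" "u \<notin> K" using N'(3) by auto
    have "u \<notin> V" using uK(2) u unfolding K_def by blast
    obtain w r t where w: "w \<in> Fl" "r \<in> {0..1}" "t \<in> {0..1/2}" "u = cone w (r, t)"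
      by (rule topspace_cases[OF uK(1) \<open>u \<notin> V\<close>])
    have "(r, t) \<notin> T w" using uK(2) w(1,4) unfolding K_def by blast
    then have *: "vx w = v" "(r, t) \<in> R" using w(2,3) unfolding T_def R_def by auto
    then have "u \<in> cone w ` R" using w(4) by blast
    then show "u \<in> P A' \<union> P B'" using w(1) *(1) unfolding P_def A'_def B'_def by blast
  qed
  have dis: "P A' \<inter> P B' \<inter> (N' - {v}) = {}"
  proof (intro equals0I)
    fix u assume u: "u \<in> P A' \<inter> P B' \<inter> (N' - {v})"
    then obtain w p w' p' where w: "w \<in> A'" "p \<in> R" "u = cone w p" "w' \<in> B'" "p' \<in> R" "u = cone w' p'"
      unfolding P_def by blast
    obtain r t r' t' where p: "p = (r, t)" "p' = (r', t')" by (cases p, cases p')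
    have rt: "r \<in> {1/2..1}" "r' \<in> {1/2..1}" "t \<in> {0..1/3}" "t' \<in> {0..1/3}" using w p unfolding R_def by auto
    have wF: "w \<in> Fl" "w' \<in> Fl" "vx w = v" "w \<in> A" "w' \<notin> A" using w unfolding A'_def B'_def by auto
    have "cone w (r, t) = vx w \<or> w' = w \<or> w' = r1 w \<or> w' = r2 w"
      by (rule cone_eq_cases[OF wF(1,2) rt]) (use w p in simp)
    moreover have "cone w (r, t) \<noteq> vx w" using u w(3) p wF(3) by auto
    ultimately show False using A(2,3) wF(4,5) by blast
  qed
  \<comment> \<open>Each sector at \<open>v\<close> enters the punctured neighbourhood already along
    its edge, at a small parameter \<open>s\<close>.\<close>
  have ne: "P S \<inter> (N' - {v}) \<noteq> {}" if w: "w \<in> Fl" "vx w = v" "w \<in> S" for w S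
  proof -
    have c: "continuous_map (top_of_set {0..1}) X (\<lambda>t. page w t 0)"
      by (rule continuous_map_page[OF w(1)]) (auto intro!: continuous_intros)
    have "page w 0 0 \<in> N'" using page_0[OF w(1), of 0] w(2) N'(2) unfolding vx_def by simp
    then obtain s where s: "s \<in> {0<..<1/3}" "page w s 0 \<in> N'"
      by (rule continuous_map_interval_approach[OF c N'(1)])
    have pc: "page w s 0 = cone w (1, s)" unfolding page_def cone_def by simp
    have "page w s 0 = half_edge w s" by (rule page_0[OF w(1)]) (use s in auto)
    then have "page w s 0 \<notin> V" using traverse_V_iff[OF half_Ed[OF w(1)], of s] s(1) by auto
    then have "page w s 0 \<in> N' - {v}" using s(2) vV by blast
    moreover have "page w s 0 \<in> P S" unfolding P_def pc
      by (rule UN_I[OF w(3)], rule imageI) (use s(1) in \<open>auto simp: R_def\<close>)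
    ultimately show ?thesis by blast
  qed
  have "P A' \<inter> (N' - {v}) \<noteq> {}" by (rule ne[of x]) (use xF x in \<open>simp_all add: A'_def v_def\<close>)
  moreover have "P B' \<inter> (N' - {v}) \<noteq> {}" by (rule ne[of y]) (use y yA in \<open>simp_all add: B'_def v_def\<close>)
  moreover have "closedin X (P A')" "closedin X (P B')" by (rule closedP, auto simp: A'_def B'_def)+
  ultimately show False using N'(4) cov dis unfolding connectedin_closedin by blast
qed

text \<open>\<open>r0\<close> followed by \<open>r1\<close> advances by one side, so iterating runs
  through the whole boundary walk.\<close>

lemma face_connected:
  assumes A: "\<And>w. w \<in> A \<Longrightarrow> r0 w \<in> A" "\<And>w. w \<in> A \<Longrightarrow> r1 w \<in> A"
    and x: "(C, i, b) \<in> A" "i < n C" and y: "j < n C"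
  shows "(C, j, c) \<in> A"
proof -
  have "(C, i, False) \<in> A" using x(1) A(1)[OF x(1)] by (cases b) auto
  then have "(C, (i + k) mod n C, False) \<in> A" for k
  proof (induction k)
    case 0 then show ?case using x(2) by simp
  next
    case (Suc k)
    then have "(C, (i + k) mod n C, True) \<in> A" using A(1) by fastforce
    then have "(C, ((i + k) mod n C + 1) mod n C, False) \<in> A" using A(2) by fastforce
    then show ?case by (simp add: mod_Suc_eq)
  qed
  \<comment> \<open>The number of steps from side \<open>i\<close> to side \<open>j\<close>,
    increased by a full turn to avoid truncated subtraction.\<close>
  from this[of "j + n C - i"] have "(C, j, False) \<in> A" using x(2) y by simp
  then show ?thesis using A(1)[of "(C, j, False)"] by (cases c) auto
qed

text \<open>The closed faces of the flags in \<open>A\<close> and of the others form two closed sets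
  covering the connected space \<open>X\<close>. A common point lies in an open face, on an edge or
  at a vertex, and there the flags are linked by \<open>face_connected\<close>, by \<open>r2\<close>
  with \<open>r0\<close>, or by \<open>vertex_connected\<close>. The premise \<open>inc\<close>
  ensures that vertices are covered.\<close>

lemma flags_connected:
  assumes inc: "\<And>v. v \<in> V \<Longrightarrow> \<exists>x\<in>Fl. vx x = v"
    and A: "A \<subseteq> Fl" "A \<noteq> {}" "\<And>w. w \<in> A \<Longrightarrow> r0 w \<in> A" "\<And>w. w \<in> A \<Longrightarrow> r1 w \<in> A" "\<And>w. w \<in> A \<Longrightarrow> r2 w \<in> A"
  shows "A = Fl"
proof -
  have full: "y \<in> A" if h: "x \<in> A" "y \<in> Fl" "fst y = fst x" for x y
  proof -
    obtain C i b where x: "x = (C, i, b)" by (cases x)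
    obtain j c where y: "y = (C, j, c)" using h(3) x by (cases y) auto
    have "i < n C" "j < n C" using h(1,2) A(1) x y by auto
    then show ?thesis using face_connected[of A C i b j c] A(3,4) h(1) x y by blast
  qed
  define P where "P S = (\<Union>x\<in>S. cone x ` ({0..1} \<times> {0..1}))" for S
  have closedP: "closedin X (P S)" if "S \<subseteq> Fl" for S
    unfolding P_def
  proof (intro closedin_Union)
    show "finite ((\<lambda>w. cone w ` ({0..1} \<times> {0..1})) ` S)" using finite_subset[OF that finite_Fl] by simp
    show "closedin X T" if T: "T \<in> (\<lambda>w. cone w ` ({0..1} \<times> {0..1})) ` S" for T
    proof -
      obtain w where w: "w \<in> S" "T = cone w ` ({0..1} \<times> {0..1})" using T by blast
      then have "w \<in> Fl" using \<open>S \<subseteq> Fl\<close> by blast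
      show ?thesis unfolding w(2)
        by (rule closedin_cone[OF \<open>w \<in> Fl\<close>]) (auto intro!: compact_Times)
    qed
  qed
  have cov: "topspace X \<subseteq> P A \<union> P (Fl - A)"
  proof
    fix u assume u: "u \<in> topspace X"
    have "\<exists>x\<in>Fl. u \<in> cone x ` ({0..1} \<times> {0..1})"
    proof (cases "u \<in> V")
      case True
      then obtain x where x: "x \<in> Fl" "vx x = u" using inc by blast
      have "u = cone x (1, 0)" using cone_1[OF x(1), of 0] x(2) unfolding vx_def by simp
      moreover have "(1, 0) \<in> {0..1::real} \<times> {0..1::real}" by simp
      ultimately show ?thesis using x(1) by blast
    next
      case False
      obtain x r t where x: "x \<in> Fl" "r \<in> {0..1}" "t \<in> {0..1/2}" "u = cone x (r, t)"
        by (rule topspace_cases[OF u False])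
      then have "(r, t) \<in> {0..1::real} \<times> {0..1::real}" by simp
      then show ?thesis using x(1,4) by blast
    qed
    then show "u \<in> P A \<union> P (Fl - A)" unfolding P_def by blast
  qed
  have dis: "P A \<inter> P (Fl - A) = {}"
  proof (intro equals0I)
    fix u assume "u \<in> P A \<inter> P (Fl - A)"
    then obtain w p w' p' where w: "w \<in> A" "p \<in> {0..1} \<times> {0..1}" "u = cone w p"
       "w' \<in> Fl - A" "p' \<in> {0..1} \<times> {0..1}" "u = cone w' p'"
      unfolding P_def by blast
    obtain r t r' t' where p: "p = (r, t)" "p' = (r', t')" by (cases p, cases p')
    have rt: "r \<in> {0..1}" "t \<in> {0..1}" "r' \<in> {0..1}" "t' \<in> {0..1}" using w p by auto
    have wF: "w \<in> Fl" "w' \<in> Fl" "w' \<notin> A" using w A(1) by auto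
    have eq: "cone w (r, t) = cone w' (r', t')" using w p by simp
    show False
    proof (cases "r = 1")
      case False
      have "r *\<^sub>R fpt w t \<in> ball 0 1" "r' *\<^sub>R fpt w' t' \<in> cball 0 1" using rt False by (auto simp del: fpt.simps)
      then have "fst w = fst w'"
        using \<Phi>_eqD[OF Fl_face[OF wF(1)] Fl_face[OF wF(2)]] eq unfolding cone_def fst_conv snd_conv by blast
      then show False using full[OF w(1) wF(2)] wF(3) by simp
    next
      case True
      have "r' = 1" using cone_support_iff[OF wF(1) rt(1,2)] cone_support_iff[OF wF(2) rt(3,4)] eq True by simp
      then have eq': "half_edge w t = half_edge w' t'"
        using eq cone_1[OF wF(1) rt(2)] cone_1[OF wF(2) rt(4)] True by simp
      show False
      proof (cases "t = 0 \<or> t = 1")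
        case False
        then have "t \<in> {0<..<1}" using rt by auto
        from traverse_eqD[OF half_Ed[OF wF(1)] half_Ed[OF wF(2)] this rt(4) eq']
        have "fst (half w) = fst (half w')" by blast
        then have "half w' = half w \<or> half (r0 w') = half w" by (auto simp: prod_eq_iff half_r0 simp del: fpt.simps half.simps)
        then have "w' \<in> A \<or> r0 w' \<in> A"
          using r2(4)[OF wF(1) wF(2)] r2(4)[OF wF(1) r0_Fl[OF wF(2)]] w(1) A(5)[OF w(1)] by auto
        then have "w' \<in> A" using A(3)[of "r0 w'"] r0_r0[of w'] by auto
        then show False using wF(3) by blast
      next
        case True
        define a where "a = (if t = 0 then w else r0 w)"
        have a: "a \<in> A" "vx a = half_edge w t"
          using True w(1) A(3)[OF w(1)] by (auto simp: a_def vx_def half_r0 traverse_def simp del: half.simps)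
        have "half_edge w t \<in> V"
          using traverse_V_iff[OF half_Ed[OF wF(1)] rt(2)] True by blast
        then have t': "t' = 0 \<or> t' = 1" using traverse_V_iff[OF half_Ed[OF wF(2)] rt(4)] eq' by simp
        define c where "c = (if t' = 0 then w' else r0 w')"
        have c: "c \<in> Fl" "vx c = half_edge w' t'"
          using t' wF(2) r0_Fl[OF wF(2)] by (auto simp: c_def vx_def half_r0 traverse_def simp del: half.simps)
        have "c \<in> A" by (rule vertex_connected[OF A(1,4,5) a(1) c(1)]) (use a(2) c(2) eq' in simp_all)
        then have "w' \<in> A" using A(3)[OF \<open>c \<in> A\<close>] r0_r0[of w'] by (auto simp: c_def split: if_splits)
        then show False using wF(3) by blast
      qed
    qed
  qed
  have Pne: "P S \<noteq> {}" if "S \<noteq> {}" for S :: "'a flag set" using that unfolding P_def by auto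
  have "P (Fl - A) = {}"
  proof (rule ccontr)
    assume "P (Fl - A) \<noteq> {}"
    moreover have "closedin X (P A)" "closedin X (P (Fl - A))" by (rule closedP, use A(1) in blast)+
    ultimately show False using connected_X cov dis Pne[OF A(2)] unfolding connected_space_closedin by blast
  qed
  then show ?thesis using Pne[of "Fl - A"] A(1) by blast
qed

end

section \<open>Flag counts and symmetries\<close>

lemma strict_mono_unit_interval:
  fixes \<tau> :: "real \<Rightarrow> real"
  assumes m: "strict_mono_on {0..1} \<tau>" and s: "\<tau> ` {0..1} = {0..1}"
  shows "\<tau> 0 = 0" "t \<in> {0..1} \<Longrightarrow> \<tau> t \<in> {0..1}" "t \<in> {0<..<1} \<Longrightarrow> \<tau> t \<in> {0<..<1}"
proof -
  have r: "\<tau> t \<in> {0..1}" if "t \<in> {0..1}" for t using s that by blast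
  then show "t \<in> {0..1} \<Longrightarrow> \<tau> t \<in> {0..1}" .
  have "0 \<in> \<tau> ` {0..1}" using s by simp
  then obtain u where u: "u \<in> {0..1}" "\<tau> u = 0" by (metis imageE)
  show "\<tau> 0 = 0"
  proof (cases "u = 0")
    case False
    then have "\<tau> 0 < \<tau> u" using strict_mono_onD[OF m, of 0 u] u(1) by simp
    then show ?thesis using r[of 0] u(2) by simp
  qed (use u in simp)
  show "\<tau> t \<in> {0<..<1}" if t: "t \<in> {0<..<1}"
  proof -
    have "\<tau> 0 < \<tau> t" "\<tau> t < \<tau> 1" using t by (auto intro!: strict_mono_onD[OF m])
    then show ?thesis using r[of 0] r[of 1] by simp
  qed
qed

context tess
begin

text \<open>Every edge has two half-edges, and every half-edge two flags.\<close>

lemma card_Fl_edges: "card Fl = 4 * card Ed"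
proof -
  have "Fl = (\<Union>h\<in>Ed \<times> UNIV. {x \<in> Fl. half x = h})"
  proof (intro equalityI subsetI)
    fix x assume x: "x \<in> Fl"
    then have "half x \<in> Ed \<times> UNIV" using half_Ed by (simp add: mem_Times_iff)
    then show "x \<in> (\<Union>h\<in>Ed \<times> UNIV. {x \<in> Fl. half x = h})" using x by (intro UN_I) simp_all
  qed blast
  then have "card Fl = card (\<Union>h\<in>Ed \<times> UNIV. {x \<in> Fl. half x = h})" by simp
  also have "\<dots> = (\<Sum>h\<in>Ed \<times> UNIV. card {x \<in> Fl. half x = h})"
    by (rule card_UN_disjoint) (use finite_Ed flags_over_half in auto)
  also have "\<dots> = (\<Sum>h\<in>Ed \<times> (UNIV :: bool set). 2)"
    by (rule sum.cong) (use card_flags_over_half in auto)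
  also have "\<dots> = 4 * card Ed" by (simp add: card_cartesian_product)
  finally show ?thesis .
qed

lemma card_Fl_faces: "card Fl = (\<Sum>C\<in>F. 2 * n C)"
proof -
  have "Fl = Sigma F (\<lambda>C. {..<n C} \<times> UNIV)" by (auto simp: Fl_def flags_def)
  then have "card Fl = (\<Sum>C\<in>F. card ({..<n C} \<times> (UNIV :: bool set)))"
    using card_SigmaI[OF finite_F, of "\<lambda>C. {..<n C} \<times> (UNIV :: bool set)"] by simp
  then show ?thesis by (simp add: card_cartesian_product mult.commute)
qed

lemma card_face_flags:
  assumes "C \<in> F" shows "card {x \<in> Fl. fst x = C} = 2 * n C"
proof -
  have "{x \<in> Fl. fst x = C} = {C} \<times> ({..<n C} \<times> UNIV)" using assms by (auto simp: Fl_def flags_def)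
  then show ?thesis by (simp add: card_cartesian_product)
qed

text \<open>\<open>H\<close> consists of the half-edges issuing from \<open>v\<close>, each carrying
  two flags; a loop contributes both of its halves, as in \<open>valency\<close>.\<close>

lemma card_vertex_flags: "card {x \<in> Fl. vx x = v} = 2 * valency \<Gamma> v"
proof -
  define H where "H = {e \<in> Ed. e 0 = v} \<times> {False} \<union> {e \<in> Ed. e 1 = v} \<times> {True}"
  have finH: "finite H" unfolding H_def using finite_Ed by simp
  have H: "h \<in> H \<longleftrightarrow> fst h \<in> Ed \<and> traverse (fst h) (snd h) 0 = v" for h
    by (cases h; cases "snd h") (auto simp: H_def traverse_def)
  have "{x \<in> Fl. vx x = v} = (\<Union>h\<in>H. {x \<in> Fl. half x = h})"
  proof (intro equalityI subsetI)
    fix x assume x: "x \<in> {x \<in> Fl. vx x = v}"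
    then have "half x \<in> H" using H[of "half x"] half_Ed[of x] unfolding vx_def by blast
    then show "x \<in> (\<Union>h\<in>H. {x \<in> Fl. half x = h})" using x by (intro UN_I) simp_all
  next
    fix x assume "x \<in> (\<Union>h\<in>H. {x \<in> Fl. half x = h})"
    then have "x \<in> Fl" "half x \<in> H" by auto
    then show "x \<in> {x \<in> Fl. vx x = v}" using H[of "half x"] unfolding vx_def by blast
  qed
  then have "card {x \<in> Fl. vx x = v} = card (\<Union>h\<in>H. {x \<in> Fl. half x = h})" by simp
  also have "\<dots> = (\<Sum>h\<in>H. card {x \<in> Fl. half x = h})"
    by (rule card_UN_disjoint) (use finH flags_over_half in auto)
  also have "\<dots> = (\<Sum>h\<in>H. 2)"
  proof (rule sum.cong)
    fix h assume "h \<in> H"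
    then show "card {x \<in> Fl. half x = h} = 2" using H[of h] card_flags_over_half[of "fst h" "snd h"] by simp
  qed simp
  also have "\<dots> = 2 * card H" by simp
  also have "card H = valency \<Gamma> v"
    unfolding H_def valency_def using finite_Ed
    by (subst card_Un_disjoint) (auto simp: card_cartesian_product)
  finally show ?thesis .
qed

lemma sum_valency: "(\<Sum>v\<in>V. valency \<Gamma> v) = 2 * card Ed"
proof -
  have "card Fl = card (\<Union>v\<in>V. {x \<in> Fl. vx x = v})"
    by (rule arg_cong[where f = card]) (use vx_V in auto)
  also have "\<dots> = (\<Sum>v\<in>V. card {x \<in> Fl. vx x = v})"
    by (rule card_UN_disjoint) (use finite_V finite_Fl in auto)
  also have "\<dots> = 2 * (\<Sum>v\<in>V. valency \<Gamma> v)" by (simp add: card_vertex_flags sum_distrib_left)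
  finally show ?thesis using card_Fl_edges by simp
qed

text \<open>A symmetry determines its lift to a polygon, first on the open disc and then by continuity.\<close>

lemma lift_unique:
  assumes CD: "C \<in> F" "D \<in> F" "D = h ` C"
    and g: "homeomorphic_map (top_of_set (cball 0 1)) (top_of_set (cball 0 1)) g" "\<forall>z\<in>cball 0 1. h (\<Phi> C z) = \<Phi> D (g z)"
    and g': "homeomorphic_map (top_of_set (cball 0 1)) (top_of_set (cball 0 1)) g'" "\<forall>z\<in>cball 0 1. h (\<Phi> C z) = \<Phi> D (g' z)"
    and z: "z \<in> cball 0 1"
  shows "g z = g' z"
proof -
  have c: "continuous_on (cball 0 1) g" "g ` cball 0 1 \<subseteq> cball 0 1"
      "continuous_on (cball 0 1) g'" "g' ` cball 0 1 \<subseteq> cball 0 1"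
    using homeomorphic_imp_continuous_map[OF g(1)] homeomorphic_imp_continuous_map[OF g'(1)]
    by (auto simp: continuous_map_in_subtopology)
  have ball: "g w = g' w" if w: "w \<in> ball 0 1" for w
  proof -
    have wc: "w \<in> cball 0 1" using w by auto
    have gw: "g w \<in> cball 0 1" "g' w \<in> cball 0 1" using c wc by blast+
    have "h (\<Phi> C w) \<in> D" using CD(3) \<Phi>_ball[OF CD(1) w] by blast
    then have "\<Phi> D (g w) \<in> D" using g(2) wc by auto
    then have "g w \<in> ball 0 1" using \<Phi>_mem_face_iff[OF CD(2,2) gw(1)] by blast
    moreover have "\<Phi> D (g w) = \<Phi> D (g' w)" using g(2) g'(2) wc by auto
    ultimately show ?thesis using \<Phi>_eqD[OF CD(2,2) _ gw(2)] by blast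
  qed
  have "z \<in> closure (ball 0 1)" using z by simp
  have "continuous_on (closure (ball 0 1)) (\<lambda>w. g w - g' w)"
    using c by (auto intro!: continuous_intros)
  then have "g z - g' z = 0"
    by (rule continuous_constant_on_closure[of "ball 0 1"]) (use ball \<open>z \<in> closure (ball 0 1)\<close> in auto)
  then show ?thesis by simp
qed

section \<open>The action of one symmetry on the flags and its compatibility with the three
  involutions\<close>

context
  fixes h :: "'a \<Rightarrow> 'a" and \<pi> :: "'a flag \<Rightarrow> 'a flag"
  assumes sym: "is_symmetry X \<Gamma> h" and ind: "induces_on_flags X \<Gamma> n \<Phi> h \<pi>"
begin

lemma \<pi>_Fl: "x \<in> Fl \<Longrightarrow> \<pi> x \<in> Fl"
  using ind unfolding induces_on_flags_def Fl_def by blast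

lemma h_inj: "inj_on h (topspace X)"
  using sym homeomorphic_imp_injective_map unfolding is_symmetry_def by blast

text \<open>The lift \<open>g\<close> is obtained separately for each flag; that it depends on the
  face alone is the content of \<open>good_eq\<close>.\<close>

definition good where
  "good x g \<tau> \<longleftrightarrow> homeomorphic_map (top_of_set (cball 0 1)) (top_of_set (cball 0 1)) g \<and>
     (\<forall>z\<in>cball 0 1. h (\<Phi> (fst x) z) = \<Phi> (fst (\<pi> x)) (g z)) \<and>
     strict_mono_on {0..1} \<tau> \<and> \<tau> ` {0..1} = {0..1} \<and> (\<forall>t\<in>{0..1}. g (fpt x t) = fpt (\<pi> x) (\<tau> t))"

lemma \<pi>_good:
  assumes x: "x \<in> Fl"
  shows "fst (\<pi> x) = h ` fst x" "\<exists>g \<tau>. good x g \<tau>"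
proof -
  have m: "maps_flag n \<Phi> h x (\<pi> x)" using ind x unfolding induces_on_flags_def Fl_def by blast
  obtain C i b where xx: "x = (C, i, b)" by (cases x)
  obtain D j c where yy: "\<pi> x = (D, j, c)" by (cases "\<pi> x")
  show "fst (\<pi> x) = h ` fst x" using m unfolding maps_flag_def yy by (simp add: xx)
  show "\<exists>g \<tau>. good x g \<tau>" using m unfolding maps_flag_def good_def xx yy[unfolded xx] prod.case fst_conv fpt.simps by blast
qed

lemma good_eq:
  assumes x: "x \<in> Fl" "y \<in> Fl" "fst x = fst y" and g: "good x g \<tau>" "good y g' \<tau>'" and t: "z \<in> cball 0 1"
  shows "g z = g' z"
proof (rule lift_unique[OF Fl_face[OF x(1)] Fl_face[OF \<pi>_Fl[OF x(1)]] \<pi>_good(1)[OF x(1)] _ _ _ _ t])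
  have "fst (\<pi> y) = fst (\<pi> x)" using \<pi>_good(1)[OF x(1)] \<pi>_good(1)[OF x(2)] x(3) by simp
  then show "\<forall>z\<in>cball 0 1. h (\<Phi> (fst x) z) = \<Phi> (fst (\<pi> x)) (g' z)" using g(2) x(3) unfolding good_def by simp
qed (use g in \<open>simp_all add: good_def\<close>)

lemma fpt_cball: "fpt x t \<in> cball 0 1" by (simp del: fpt.simps)

lemma r0_neq: "r0 x \<noteq> x" and r1_neq: "r1 x \<noteq> x" by (cases x, auto)+

text \<open>Equal images come from the same face, where both flags use the same lift. Matching the
  image of a midpoint shows that the flags lie on one side, and \<open>y = r0 x\<close> is
  impossible since its trace runs backwards while \<open>\<tau>\<close> and \<open>\<tau>'\<close>
  both increase.\<close>

lemma \<pi>_inj: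
  assumes x: "x \<in> Fl" "y \<in> Fl" "\<pi> x = \<pi> y" shows "x = y"
proof -
  have "h ` fst x = h ` fst y" using \<pi>_good(1)[OF x(1)] \<pi>_good(1)[OF x(2)] x(3) by simp
  then have f: "fst x = fst y"
    using inj_on_image_eq_iff[OF h_inj] face_sub[OF Fl_face[OF x(1)]] face_sub[OF Fl_face[OF x(2)]] by blast
  obtain g \<tau> where g: "good x g \<tau>" using \<pi>_good(2)[OF x(1)] by blast
  obtain g' \<tau>' where g': "good y g' \<tau>'" using \<pi>_good(2)[OF x(2)] by blast
  have \<tau>: "strict_mono_on {0..1} \<tau>" "\<tau> ` {0..1} = {0..1}" and \<tau>': "strict_mono_on {0..1} \<tau>'" "\<tau>' ` {0..1} = {0..1}"
    using g g' unfolding good_def by blast+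
  have gi: "inj_on g (cball 0 1)" using g homeomorphic_imp_injective_map unfolding good_def by fastforce
  have gx: "g (fpt x t) = fpt (\<pi> x) (\<tau> t)" if "t \<in> {0..1}" for t using g that unfolding good_def by blast
  have gy: "g (fpt y t) = fpt (\<pi> x) (\<tau>' t)" if "t \<in> {0..1}" for t
    using g' that good_eq[OF x(1,2) f g g' fpt_cball] x(3) unfolding good_def by auto
  have "\<tau> (1/2) \<in> \<tau>' ` {0..1}" using strict_mono_unit_interval(2)[OF \<tau>, of "1/2"] \<tau>'(2) by simp
  then obtain t where t: "t \<in> {0..1}" "\<tau> (1/2) = \<tau>' t" by blast
  have "g (fpt x (1/2)) = g (fpt y t)" using gx[of "1/2"] gy[OF t(1)] t(2) by simp
  then have "fpt x (1/2) = fpt y t" using inj_onD[OF gi _ fpt_cball fpt_cball] by blast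
  from fpt_interior_eqD[OF x(1,2) f _ t(1) this] have "x = y \<or> y = r0 x" by auto
  moreover have "y \<noteq> r0 x"
  proof
    assume y: "y = r0 x"
    have eq: "\<tau> t = \<tau>' (1 - t)" if t: "t \<in> {0<..<1}" for t
    proof -
      have "fpt x t = fpt y (1 - t)" using y by (simp add: fpt_r0 del: fpt.simps)
      then have "fpt (\<pi> x) (\<tau> t) = fpt (\<pi> x) (\<tau>' (1 - t))" using gx[of t] gy[of "1 - t"] t by simp
      from fpt_interior_eqD[OF \<pi>_Fl[OF x(1)] \<pi>_Fl[OF x(1)] refl _ _ this] show ?thesis
        using strict_mono_unit_interval(3)[OF \<tau> t] strict_mono_unit_interval(2)[OF \<tau>', of "1 - t"] t r0_neq[of "\<pi> x"] by auto
    qed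
    have "\<tau> (1/4) < \<tau> (3/4)" "\<tau>' (1/4) < \<tau>' (3/4)"
      by (rule strict_mono_onD[OF \<tau>(1)], simp_all) (rule strict_mono_onD[OF \<tau>'(1)], simp_all)
    then show False using eq[of "1/4"] eq[of "3/4"] by simp
  qed
  ultimately show ?thesis by blast
qed

text \<open>The midpoint of the side shared by \<open>x\<close> and \<open>r0 x\<close> is lifted to
  an interior point of a side, so both images lie on that side; injectivity excludes that they
  coincide.\<close>

lemma \<pi>_r0:
  assumes x: "x \<in> Fl" shows "\<pi> (r0 x) = r0 (\<pi> x)"
proof -
  obtain g \<tau> where g: "good x g \<tau>" using \<pi>_good(2)[OF x] by blast
  obtain g' \<tau>' where g': "good (r0 x) g' \<tau>'" using \<pi>_good(2)[OF r0_Fl[OF x]] by blast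
  have \<tau>: "strict_mono_on {0..1} \<tau>" "\<tau> ` {0..1} = {0..1}" and \<tau>': "strict_mono_on {0..1} \<tau>'" "\<tau>' ` {0..1} = {0..1}"
    using g g' unfolding good_def by blast+
  have "fpt (r0 x) (1/2) = fpt x (1/2)" by (simp add: fpt_r0 del: fpt.simps)
  moreover have "g (fpt x (1/2)) = fpt (\<pi> x) (\<tau> (1/2))" using g unfolding good_def by simp
  moreover have "g' (fpt (r0 x) (1/2)) = fpt (\<pi> (r0 x)) (\<tau>' (1/2))" using g' unfolding good_def by simp
  moreover have "g (fpt x (1/2)) = g' (fpt x (1/2))"
    by (rule good_eq[OF x r0_Fl[OF x] _ g g' fpt_cball]) simp
  ultimately have eq: "fpt (\<pi> x) (\<tau> (1/2)) = fpt (\<pi> (r0 x)) (\<tau>' (1/2))" by simp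
  have "fst (\<pi> x) = fst (\<pi> (r0 x))" using \<pi>_good(1)[OF x] \<pi>_good(1)[OF r0_Fl[OF x]] by simp
  from fpt_interior_eqD[OF \<pi>_Fl[OF x] \<pi>_Fl[OF r0_Fl[OF x]] this _ _ eq]
  have "\<pi> x = \<pi> (r0 x) \<or> \<pi> (r0 x) = r0 (\<pi> x)"
    using strict_mono_unit_interval(3)[OF \<tau>, of "1/2"] strict_mono_unit_interval(2)[OF \<tau>', of "1/2"] by auto
  then show ?thesis using \<pi>_inj[OF x r0_Fl[OF x]] r0_neq[of x] by auto
qed

text \<open>Reparametrizations fix 0, so the corner shared by \<open>x\<close> and
  \<open>r1 x\<close> goes to a corner shared by the images; injectivity leaves only
  \<open>r1\<close>.\<close>

lemma \<pi>_r1: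
  assumes x: "x \<in> Fl" shows "\<pi> (r1 x) = r1 (\<pi> x)"
proof -
  obtain g \<tau> where g: "good x g \<tau>" using \<pi>_good(2)[OF x] by blast
  obtain g' \<tau>' where g': "good (r1 x) g' \<tau>'" using \<pi>_good(2)[OF r1_Fl[OF x]] by blast
  have \<tau>: "strict_mono_on {0..1} \<tau>" "\<tau> ` {0..1} = {0..1}" and \<tau>': "strict_mono_on {0..1} \<tau>'" "\<tau>' ` {0..1} = {0..1}"
    using g g' unfolding good_def by blast+
  have "g (fpt x 0) = fpt (\<pi> x) (\<tau> 0)" using g unfolding good_def by simp
  moreover have "g' (fpt (r1 x) 0) = fpt (\<pi> (r1 x)) (\<tau>' 0)" using g' unfolding good_def by simp
  moreover have "g (fpt x 0) = g' (fpt x 0)"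
    by (rule good_eq[OF x r1_Fl[OF x] _ g g' fpt_cball]) simp
  ultimately have eq: "fpt (\<pi> x) 0 = fpt (\<pi> (r1 x)) 0"
    using fpt_r1[OF x] strict_mono_unit_interval(1)[OF \<tau>] strict_mono_unit_interval(1)[OF \<tau>'] by simp
  have "fst (\<pi> x) = fst (\<pi> (r1 x))" using \<pi>_good(1)[OF x] \<pi>_good(1)[OF r1_Fl[OF x]] by simp
  from fpt_eqD[OF \<pi>_Fl[OF x] \<pi>_Fl[OF r1_Fl[OF x]] this _ _ eq]
  have "\<pi> x = \<pi> (r1 x) \<or> \<pi> (r1 x) = r1 (\<pi> x)" by auto
  then show ?thesis using \<pi>_inj[OF x r1_Fl[OF x]] r1_neq[of x] by auto
qed

text \<open>\<open>x\<close> and \<open>r2 x\<close> trace the same half-edge from two polygon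
  sides, so the images are compared in \<open>X\<close> through \<open>h\<close> and not through a
  common lift. Monotonicity excludes that they run along their edge in opposite directions.\<close>

lemma \<pi>_r2:
  assumes x: "x \<in> Fl" shows "\<pi> (r2 x) = r2 (\<pi> x)"
proof -
  define y where "y = r2 x"
  have y: "y \<in> Fl" "half y = half x" "y \<noteq> x" using r2[OF x] unfolding y_def by blast+
  obtain g \<tau> where g: "good x g \<tau>" using \<pi>_good(2)[OF x] by blast
  obtain g' \<tau>' where g': "good y g' \<tau>'" using \<pi>_good(2)[OF y(1)] by blast
  have \<tau>: "strict_mono_on {0..1} \<tau>" "\<tau> ` {0..1} = {0..1}" and \<tau>': "strict_mono_on {0..1} \<tau>'" "\<tau>' ` {0..1} = {0..1}"
    using g g' unfolding good_def by blast+
  have img: "h (half_edge w t) = half_edge (\<pi> w) (\<sigma> t)"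
    if w: "w \<in> Fl" and k: "good w k \<sigma>" and t: "t \<in> {0..1}" for w k \<sigma> t
  proof -
    have s: "strict_mono_on {0..1} \<sigma>" "\<sigma> ` {0..1} = {0..1}" using k unfolding good_def by blast+
    have "h (\<Phi> (fst w) (fpt w t)) = \<Phi> (fst (\<pi> w)) (k (fpt w t))" using k fpt_cball[of w t] unfolding good_def by blast
    also have "k (fpt w t) = fpt (\<pi> w) (\<sigma> t)" using k t unfolding good_def by blast
    finally show ?thesis using \<Phi>_fpt[OF w t] \<Phi>_fpt[OF \<pi>_Fl[OF w] strict_mono_unit_interval(2)[OF s t]] by simp
  qed
  have eq: "half_edge (\<pi> x) (\<tau> t) = half_edge (\<pi> y) (\<tau>' t)"
    if "t \<in> {0..1}" for t using img[OF x g that] img[OF y(1) g' that] y(2) by simp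
  have D: "fst (half (\<pi> x)) = fst (half (\<pi> y)) \<and>
      \<tau>' t = (if snd (half (\<pi> x)) = snd (half (\<pi> y)) then \<tau> t else 1 - \<tau> t)" if t: "t \<in> {0<..<1}" for t
  proof -
    have t': "t \<in> {0..1}" using t by auto
    show ?thesis
      using traverse_eqD[OF half_Ed[OF \<pi>_Fl[OF x]] half_Ed[OF \<pi>_Fl[OF y(1)]] strict_mono_unit_interval(3)[OF \<tau> t]
        strict_mono_unit_interval(2)[OF \<tau>' t'] eq[OF t']] by blast
  qed
  have "snd (half (\<pi> x)) = snd (half (\<pi> y))"
  proof (rule ccontr)
    assume "\<not> ?thesis"
    then have "\<tau>' (1/4) = 1 - \<tau> (1/4)" "\<tau>' (3/4) = 1 - \<tau> (3/4)" using D[of "1/4"] D[of "3/4"] by auto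
    moreover have "\<tau> (1/4) < \<tau> (3/4)" "\<tau>' (1/4) < \<tau>' (3/4)"
      by (rule strict_mono_onD[OF \<tau>(1)], simp_all) (rule strict_mono_onD[OF \<tau>'(1)], simp_all)
    ultimately show False by simp
  qed
  moreover have "fst (half (\<pi> x)) = fst (half (\<pi> y))" using D[of "1/2"] by simp
  ultimately have "half (\<pi> y) = half (\<pi> x)" by (simp add: prod_eq_iff)
  then have "\<pi> y = \<pi> x \<or> \<pi> y = r2 (\<pi> x)" by (rule r2(4)[OF \<pi>_Fl[OF x] \<pi>_Fl[OF y(1)]])
  then show ?thesis using \<pi>_inj[OF y(1) x] y(3) unfolding y_def by blast
qed

lemma card_face_mono:
  assumes x: "x \<in> Fl" shows "n (fst x) \<le> n (fst (\<pi> x))"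
proof -
  have "inj_on \<pi> {w \<in> Fl. fst w = fst x}" using \<pi>_inj by (intro inj_onI) blast
  moreover have "\<pi> ` {w \<in> Fl. fst w = fst x} \<subseteq> {w \<in> Fl. fst w = fst (\<pi> x)}"
    using \<pi>_Fl \<pi>_good(1)[OF x] \<pi>_good(1) by auto
  moreover have "finite {w \<in> Fl. fst w = fst (\<pi> x)}" using finite_Fl by simp
  ultimately have "card {w \<in> Fl. fst w = fst x} \<le> card {w \<in> Fl. fst w = fst (\<pi> x)}" by (rule card_inj_on_le)
  then show ?thesis using card_face_flags Fl_face[OF x] Fl_face[OF \<pi>_Fl[OF x]] by simp
qed

end

end

section \<open>Orientability\<close>

text \<open>The squared norm is \<open>(1 - u)^2 + u^2 + 2 u (1 - u) (A \<bullet> B)\<close>, and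
  distinct unit vectors have inner product below 1.\<close>

lemma norm_segment_less:
  fixes A B :: complex
  assumes "norm A = 1" "norm B = 1" "A \<noteq> B" "u \<in> {0<..<1}"
  shows "norm ((1 - u) *\<^sub>R A + u *\<^sub>R B) < 1"
proof -
  have sq: "(norm (A - B))\<^sup>2 = 2 - 2 * (A \<bullet> B)"
    using assms(1,2) by (simp add: power2_norm_eq_inner inner_diff inner_commute norm_eq_1)
  have "(norm (A - B))\<^sup>2 > 0" using assms(3) by simp
  then have AB: "A \<bullet> B < 1" using sq by simp
  have "(norm ((1 - u) *\<^sub>R A + u *\<^sub>R B))\<^sup>2 = (1 - u)\<^sup>2 + u\<^sup>2 + 2 * (u * (1 - u)) * (A \<bullet> B)"
    using assms(1,2) unfolding power2_norm_eq_inner norm_eq_1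
    by (simp add: inner_add inner_commute power2_eq_square algebra_simps)
  also have "\<dots> < (1 - u)\<^sup>2 + u\<^sup>2 + 2 * (u * (1 - u)) * 1"
  proof -
    have "2 * (u * (1 - u)) > 0" using assms(4) by simp
    then show ?thesis using AB by (intro add_strict_left_mono mult_strict_left_mono)
  qed
  also have "\<dots> = 1\<^sup>2" by (simp add: power2_eq_square algebra_simps)
  finally show ?thesis by (rule power2_less_imp_less) simp
qed

text \<open>Chords joining two sides of a polygon, traversed in opposite directions, are parallel.\<close>

lemma parallel_chords:
  assumes p: "p \<ge> 1" and ij: "i < p" "j < p" "i \<noteq> j" and e: "\<bar>e\<bar> = (1::real)"
    and t: "t \<in> {-1..1}" "t' \<in> {-1..1}"
    and eq: "(1 - u) *\<^sub>R polygon_side p j (1/2 - e * t/4) + u *\<^sub>R polygon_side p i (1/2 + e * t/4) =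
      (1 - u') *\<^sub>R polygon_side p j (1/2 - e * t'/4) + u' *\<^sub>R polygon_side p i (1/2 + e * t'/4)"
  shows "t = t'"
proof -
  \<comment> \<open>Multiplication by \<open>\<delta>\<close> rotates the bisector of the two sides
    to the real axis: the ends of the chord become \<open>cis (- \<theta> t)\<close> and
    \<open>cis (\<theta> t)\<close>, so it is vertical with real part
    \<open>cos (\<theta> t)\<close>.\<close>
  define \<delta> where "\<delta> = cis (- (pi * (real i + real j + 1) / real p))"
  define \<theta> where "\<theta> t = pi * (real i - real j + e * t / 2) / real p" for t
  have p0: "real p > 0" using p by simp
  have R: "Re (((1 - u) *\<^sub>R polygon_side p j (1/2 - e * t/4) + u *\<^sub>R polygon_side p i (1/2 + e * t/4)) * \<delta>) = cos (\<theta> t)" for u t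
  proof -
    have "polygon_side p j (1/2 - e * t/4) * \<delta> = cis (- \<theta> t)"
      unfolding polygon_side_def \<delta>_def \<theta>_def cis_mult using p0
      by (intro arg_cong[where f = cis]) (simp add: field_simps)
    moreover have "polygon_side p i (1/2 + e * t/4) * \<delta> = cis (\<theta> t)"
      unfolding polygon_side_def \<delta>_def \<theta>_def cis_mult using p0
      by (intro arg_cong[where f = cis]) (simp add: field_simps)
    ultimately have "((1 - u) *\<^sub>R polygon_side p j (1/2 - e * t/4) + u *\<^sub>R polygon_side p i (1/2 + e * t/4)) * \<delta>
       = (1 - u) *\<^sub>R cis (- \<theta> t) + u *\<^sub>R cis (\<theta> t)" by (simp add: distrib_right)
    then have "Re (((1 - u) *\<^sub>R polygon_side p j (1/2 - e * t/4) + u *\<^sub>R polygon_side p i (1/2 + e * t/4)) * \<delta>)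
       = Re ((1 - u) *\<^sub>R cis (- \<theta> t) + u *\<^sub>R cis (\<theta> t))" by (rule arg_cong)
    also have "\<dots> = cos (\<theta> t)" by (simp add: left_diff_distrib)
    finally show ?thesis .
  qed
  have cc: "cos (\<theta> t) = cos (\<theta> t')" using R[of u t] R[of u' t'] eq by simp
  have small: "\<bar>e * t / 2\<bar> < 1" "\<bar>e * t' / 2\<bar> < 1" using e t by (auto simp: abs_mult)
  \<comment> \<open>The sign \<open>s\<close> places the angle in [0, pi], where \<open>cos\<close>
    is injective; distinct indices differ by at least 1 and at most \<open>p - 1\<close>.\<close>
  define s where "s = (if j < i then 1 else - 1 :: real)"
  have rng: "0 \<le> s * \<theta> v \<and> s * \<theta> v \<le> pi" if "\<bar>e * v / 2\<bar> < 1" for v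
  proof -
    have "1 \<le> s * (real i - real j)" "s * (real i - real j) \<le> real p - 1" using ij by (auto simp: s_def)
    moreover have "\<bar>s * (e * v / 2)\<bar> < 1" using that by (simp add: s_def)
    ultimately have "0 \<le> s * (real i - real j + e * v / 2)" "s * (real i - real j + e * v / 2) \<le> real p"
      unfolding distrib_left by linarith+
    then have "0 \<le> s * (real i - real j + e * v / 2) / real p" "s * (real i - real j + e * v / 2) / real p \<le> 1"
      using p0 by (simp_all add: divide_le_eq)
    moreover have "s * \<theta> v = pi * (s * (real i - real j + e * v / 2) / real p)" by (simp add: \<theta>_def)
    ultimately show ?thesis using mult_left_le[of "s * (real i - real j + e * v / 2) / real p" pi] pi_ge_zero
      by (metis mult_nonneg_nonneg)
  qed
  have "cos (s * \<theta> t) = cos (s * \<theta> t')" using cc by (simp add: s_def)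
  then have "s * \<theta> t = s * \<theta> t'" using cos_inj_pi rng[OF small(1)] rng[OF small(2)] by blast
  then have "\<theta> t = \<theta> t'" by (simp add: s_def split: if_splits)
  then have "e * t = e * t'" using p0 unfolding \<theta>_def by simp
  then show ?thesis using e by auto
qed

context tess
begin

text \<open>In the orientation double cover of the dual graph, the nodes are oriented faces, and a flag is
  an arrow from \<open>src\<close> of itself to \<open>src\<close> of its reverse.\<close>

fun src :: "'a flag \<Rightarrow> 'a set \<times> bool" where "src (C, i, b) = (C, b)"

definition rev :: "'a flag \<Rightarrow> 'a flag" where "rev x = r0 (r2 x)"

lemma rev_Fl: "x \<in> Fl \<Longrightarrow> rev x \<in> Fl" unfolding rev_def by (intro r0_Fl r2)

lemma rev_rev:
  assumes x: "x \<in> Fl" shows "rev (rev x) = x"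
  unfolding rev_def r0_r2[OF r2(1)[OF x], symmetric] r2_r2[OF x] r0_r0 ..

lemma fst_src [simp]: "fst (src x) = fst x" by (cases x) auto

lemma src_r0: "src (r0 x) = (fst x, \<not> snd (src x))" and src_r1: "src (r1 x) = (fst x, \<not> snd (src x))"
  by (cases x, auto)+

lemma src_eq: "src x = (fst x, snd (src x))" by (cases x) auto

definition arr :: "(('a set \<times> bool) \<times> ('a set \<times> bool)) set" where
  "arr = (\<lambda>x. (src x, src (rev x))) ` Fl"

lemma arr_sym:
  assumes "(a, b) \<in> arr" shows "(b, a) \<in> arr"
proof -
  obtain x where x: "x \<in> Fl" "a = src x" "b = src (rev x)" using assms unfolding arr_def by blast
  have "(b, a) = (src (rev x), src (rev (rev x)))" unfolding x(2,3) rev_rev[OF x(1)] ..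
  then show ?thesis unfolding arr_def using rev_Fl[OF x(1)] by (rule image_eqI)
qed

lemma arr_rtrancl_sym: "(a, b) \<in> arr\<^sup>* \<Longrightarrow> (b, a) \<in> arr\<^sup>*"
  by (rule symD[OF sym_rtrancl]) (auto intro!: symI arr_sym)

text \<open>\<open>\<kappa>\<close> marks the flags whose oriented face is reachable from that of a
  fixed flag. \<open>r0\<close> and \<open>r1\<close> reverse the orientation and \<open>rev\<close>
  follows an arrow, so \<open>r2\<close>, which is \<open>rev\<close> followed by \<open>r0\<close>,
  switches the colour as well.\<close>

lemma colouring_if_no_reversal:
  assumes inc: "\<And>v. v \<in> V \<Longrightarrow> \<exists>x\<in>Fl. vx x = v" and ne: "Fl \<noteq> {}"
    and no: "\<And>C b. ((C, b), (C, \<not> b)) \<notin> arr\<^sup>*"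
  shows "\<exists>\<kappa> :: 'a flag \<Rightarrow> bool. \<forall>x\<in>Fl. \<kappa> (r0 x) \<noteq> \<kappa> x \<and> \<kappa> (r1 x) \<noteq> \<kappa> x \<and> \<kappa> (r2 x) \<noteq> \<kappa> x"
proof -
  obtain x0 where x0: "x0 \<in> Fl" using ne by blast
  define \<kappa> where "\<kappa> x \<longleftrightarrow> (src x0, src x) \<in> arr\<^sup>*" for x
  have step: "\<kappa> (rev x)" if "x \<in> Fl" "\<kappa> x" for x
  proof -
    have "(src x, src (rev x)) \<in> arr" using that(1) unfolding arr_def by blast
    then show ?thesis using that(2) unfolding \<kappa>_def by (rule rtrancl_into_rtrancl[rotated])
  qed
  have once: "\<not> (\<kappa> x \<and> \<kappa> y)" if "src y = (fst x, \<not> snd (src x))" for x y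
  proof
    assume "\<kappa> x \<and> \<kappa> y"
    then have "(src x, src x0) \<in> arr\<^sup>*" "(src x0, src y) \<in> arr\<^sup>*"
      unfolding \<kappa>_def using arr_rtrancl_sym[of "src x0" "src x"] by blast+
    then have "(src x, src y) \<in> arr\<^sup>*" by (rule rtrancl_trans)
    then have "((fst x, snd (src x)), (fst x, \<not> snd (src x))) \<in> arr\<^sup>*" using that src_eq[of x] by simp
    then show False using no by blast
  qed
  have same: "\<kappa> x = \<kappa> y" if "src x = src y" for x y using that unfolding \<kappa>_def by simp
  \<comment> \<open>The flags whose face is reached in some orientation; connectedness makes this
    all of \<open>Fl\<close>.\<close>
  define A where "A = {x \<in> Fl. \<kappa> x \<or> \<kappa> (r0 x)}"
  have srcr10: "src (r0 (r1 x)) = src x" "src (r1 x) = src (r0 x)" for x by (cases x, simp)+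
  have "A = Fl"
  proof (rule flags_connected[OF inc])
    show "A \<noteq> {}" using x0 unfolding A_def \<kappa>_def by blast
    fix w assume w: "w \<in> A"
    then have wF: "w \<in> Fl" and k: "\<kappa> w \<or> \<kappa> (r0 w)" unfolding A_def by auto
    show "r0 w \<in> A" using wF k r0_Fl[OF wF] unfolding A_def by (auto simp: r0_r0)
    show "r1 w \<in> A" using k r1_Fl[OF wF] same[OF srcr10(1)[of w]] same[OF srcr10(2)[of w]] unfolding A_def by auto
    have "\<kappa> w \<Longrightarrow> \<kappa> (r0 (r2 w))" using step[OF wF] unfolding rev_def .
    moreover have "\<kappa> (r0 w) \<Longrightarrow> \<kappa> (r2 w)"
      using step[OF r0_Fl[OF wF]] unfolding rev_def r0_r2[OF wF, symmetric] r0_r0 .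
    ultimately show "r2 w \<in> A" using k r2(1)[OF wF] unfolding A_def by auto
  qed (auto simp: A_def)
  then have one: "\<kappa> x \<or> \<kappa> (r0 x)" if "x \<in> Fl" for x using that unfolding A_def by blast
  have r0k: "\<kappa> (r0 x) \<noteq> \<kappa> x" if "x \<in> Fl" for x using one[OF that] once[OF src_r0, of x] by blast
  have r1k: "\<kappa> (r1 x) \<noteq> \<kappa> x" if "x \<in> Fl" for x using r0k[OF that] same[OF srcr10(2)[of x]] by simp
  have r2k: "\<kappa> (r2 x) \<noteq> \<kappa> x" if x: "x \<in> Fl" for x
  proof -
    have "\<kappa> (rev x) = \<kappa> x" using step[OF x] step[OF rev_Fl[OF x]] rev_rev[OF x] by auto
    then show ?thesis using r0k[OF r2(1)[OF x]] unfolding rev_def by simp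
  qed
  show ?thesis by (intro exI[of _ \<kappa>] ballI conjI r0k r1k r2k)
qed

text \<open>A shortest path reversing the orientation of a face visits every face only once.\<close>

lemma minimal_reversing_path:
  assumes "((C, b), (C, \<not> b)) \<in> arr\<^sup>*"
  obtains k x where "k \<ge> 1" "\<And>i. i < k \<Longrightarrow> x i \<in> Fl" "\<And>i. Suc i < k \<Longrightarrow> src (x (Suc i)) = src (rev (x i))"
    "src (rev (x (k - 1))) = (fst (x 0), \<not> snd (src (x 0)))"
    "\<And>i j. i < j \<Longrightarrow> j < k \<Longrightarrow> fst (x i) \<noteq> fst (x j)"
proof -
  define P where "P k \<longleftrightarrow> (\<exists>C b. ((C, b), (C, \<not> b)) \<in> arr ^^ k)" for k
  have "\<exists>k. P k" using assms rtrancl_imp_relpow unfolding P_def by blast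
  define k where "k = (LEAST k. P k)"
  have Pk: "P k" unfolding k_def using \<open>\<exists>k. P k\<close> by (rule LeastI_ex)
  have min: "\<not> P l" if "l < k" for l using that unfolding k_def by (rule not_less_Least)
  obtain C b where path: "((C, b), (C, \<not> b)) \<in> arr ^^ k" using Pk unfolding P_def by blast
  then obtain f where f: "f 0 = (C, b)" "f k = (C, \<not> b)" "\<And>i. i < k \<Longrightarrow> (f i, f (Suc i)) \<in> arr"
    unfolding relpow_fun_conv by blast
  have sub: "(f i, f j) \<in> arr ^^ (j - i)" if "i \<le> j" "j \<le> k" for i j
    unfolding relpow_fun_conv
    by (rule exI[of _ "\<lambda>l. f (i + l)"]) (use that f(3) in auto)
  have k1: "k \<ge> 1"
  proof (rule ccontr)
    assume "\<not> k \<ge> 1"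
    then have "k = 0" by simp
    then have "(C, b) = (C, \<not> b)" using f(1,2) by simp
    then show False by simp
  qed
  define x where "x i = (SOME y. y \<in> Fl \<and> src y = f i \<and> src (rev y) = f (Suc i))" for i
  have x: "x i \<in> Fl \<and> src (x i) = f i \<and> src (rev (x i)) = f (Suc i)" if i: "i < k" for i
  proof -
    obtain y where "y \<in> Fl" "(f i, f (Suc i)) = (src y, src (rev y))" using f(3)[OF i] unfolding arr_def by (rule imageE)
    then have "y \<in> Fl \<and> src y = f i \<and> src (rev y) = f (Suc i)" by simp
    then show ?thesis unfolding x_def by (rule someI)
  qed
  have x0: "src (x 0) = (C, b)" using x[of 0] k1 f(1) by simp
  show ?thesis
  proof (rule that[OF k1, of x])
    show "src (x (Suc i)) = src (rev (x i))" if "Suc i < k" for i using x[of i] x[of "Suc i"] that by simp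
    have "src (rev (x (k - 1))) = f k" using x[of "k - 1"] k1 by simp
    then show "src (rev (x (k - 1))) = (fst (x 0), \<not> snd (src (x 0)))"
      unfolding f(2) fst_src[symmetric] x0 by simp
    fix i j assume ij: "i < j" "j < k"
    show "fst (x i) \<noteq> fst (x j)"
    proof
      assume eq: "fst (x i) = fst (x j)"
      have fij: "f i = (fst (x i), snd (f i))" "f j = (fst (x i), snd (f j))"
        using x[of i] x[of j] ij src_eq[of "x i"] src_eq[of "x j"] eq by simp_all
      show False
      proof (cases "snd (f i) = snd (f j)")
        case True
        \<comment> \<open>Same orientation: the loop between \<open>i\<close> and \<open>j\<close>
          can be cut out.\<close>
        then have "f i = f j" using fij by simp
        then have "(f 0, f j) \<in> arr ^^ i" "(f j, f k) \<in> arr ^^ (k - j)"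
          using sub[of 0 i] sub[of j k] ij by simp_all
        then have "(f 0, f k) \<in> arr ^^ (i + (k - j))" unfolding relpow_add by (rule relcompI)
        then have "P (i + (k - j))" using f(1,2) unfolding P_def by auto
        moreover have "i + (k - j) < k" using ij by linarith
        ultimately show False using min by blast
      next
        case False
        \<comment> \<open>Opposite orientation: the piece between \<open>i\<close> and
          \<open>j\<close> is itself a shorter reversing path.\<close>
        then have "((fst (x i), snd (f i)), (fst (x i), \<not> snd (f i))) \<in> arr ^^ (j - i)"
          using sub[of i j] ij fij by (cases "snd (f i)"; cases "snd (f j)") simp_all
        then have "P (j - i)" unfolding P_def by blast
        moreover have "j - i < k" using ij by linarith
        ultimately show False using min by blast
      qed
    qed
  qed (use x in blast)
qed

text \<open>A face is entered at \<open>a\<close> and left at \<open>x\<close>. The parameters stay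
  in [1/4, 3/4], away from the vertices, and run oppositely because flags with equal
  \<open>src\<close> trace their sides in the same sense around the disc; this keeps the chords from
  crossing.\<close>

definition chord :: "'a flag \<Rightarrow> 'a flag \<Rightarrow> real \<Rightarrow> real \<Rightarrow> complex" where
  "chord a x u t = (1 - u) *\<^sub>R fpt a (1/2 - t/4) + u *\<^sub>R fpt x (1/2 + t/4)"

text \<open>Equal \<open>src\<close> and \<open>a \<noteq> x\<close> mean different sides, so the
  ends of a chord differ and its inside lies in the open disc by strict convexity. Chords with
  different \<open>t\<close> are disjoint because they are parallel.\<close>

lemma chord:
  assumes ax: "a \<in> Fl" "x \<in> Fl" "src a = src x" "a \<noteq> x" and t: "t \<in> {-1..1}" "t' \<in> {-1..1}"
  shows "u \<in> {0<..<1} \<Longrightarrow> chord a x u t \<in> ball 0 1" "u \<in> {0..1} \<Longrightarrow> chord a x u t \<in> cball 0 1"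
    "chord a x u t = chord a x u' t' \<Longrightarrow> u = u' \<and> t = t'"
proof -
  have "x \<noteq> r0 a" using ax(3) src_r0[of a] src_eq[of a] by (metis snd_conv)
  have f: "fst a = fst x" using ax(3) fst_src by metis
  have ne: "fpt a (1/2 - t/4) \<noteq> fpt x (1/2 + t/4)" if "t \<in> {-1..1}" for t
    using fpt_interior_eqD[OF ax(1,2) f, of "1/2 - t/4" "1/2 + t/4"] ax(4) \<open>x \<noteq> r0 a\<close> that by auto
  show "chord a x u t \<in> ball 0 1" if "u \<in> {0<..<1}"
    using norm_segment_less[OF norm_fpt norm_fpt ne[OF t(1)] that] unfolding chord_def by simp
  show "chord a x u t \<in> cball 0 1" if "u \<in> {0..1}"
  proof -
    have "norm (chord a x u t) \<le> norm ((1 - u) *\<^sub>R fpt a (1/2 - t/4)) + norm (u *\<^sub>R fpt x (1/2 + t/4))"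
      unfolding chord_def by (rule norm_triangle_ineq)
    also have "\<dots> = 1" using that by (simp del: fpt.simps)
    finally show ?thesis by simp
  qed
  assume eq: "chord a x u t = chord a x u' t'"
  obtain C j b where a: "a = (C, j, b)" by (cases a)
  obtain i where x: "x = (C, i, b)" using ax(3) a by (cases x) auto
  \<comment> \<open>Converts the position along a flag into the position along its side, which runs
    backwards for \<open>b = True\<close>.\<close>
  define e where "e = (if b then -1 else 1 :: real)"
  have fp: "fpt (C, l, b) s = ps C l (1/2 + e * (s - 1/2))" for l s
    by (simp add: e_def traverse_def)
  have CF: "C \<in> F" "i < n C" "j < n C" "i \<noteq> j" using ax(1,2,4) a x by auto
  have ch: "chord a x v s = (1 - v) *\<^sub>R ps C j (1/2 - e * s/4) + v *\<^sub>R ps C i (1/2 + e * s/4)" for v s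
    unfolding chord_def a x fp by simp
  have "t = t'"
    by (rule parallel_chords[OF n_ge_1[OF CF(1)] CF(2,3,4) _ t, of e u u']) (use eq in \<open>simp_all add: ch e_def\<close>)
  moreover have "u = u'"
  proof -
    have "(u - u') *\<^sub>R (fpt x (1/2 + t/4) - fpt a (1/2 - t/4)) = chord a x u t - chord a x u' t"
      unfolding chord_def by (simp add: algebra_simps)
    also have "\<dots> = 0" using eq unfolding \<open>t = t'\<close> by simp
    finally show ?thesis using ne[OF t(1)] by (simp del: fpt.simps)
  qed
  ultimately show "u = u' \<and> t = t'" by simp
qed

text \<open>The rectangle is divided into \<open>k\<close> strips, the \<open>i\<close>-th mapped by
  chords across the face of \<open>x i\<close>. Between consecutive strips the half-edges are
  opposite, which compensates the sign in \<open>1/2 - t/4\<close>; at the end \<open>half_0\<close>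
  has equal half-edges, so the sign survives and \<open>(1, t)\<close> is glued to
  \<open>(0, - t)\<close>. Distinct faces and distinct edges exclude further
  identifications.\<close>

lemma moebius_band_from_strips:
  assumes k: "k \<ge> (1::nat)" and xF: "\<And>i. i < k \<Longrightarrow> x i \<in> Fl" and aF: "\<And>i. i < k \<Longrightarrow> a i \<in> Fl"
    and src: "\<And>i. i < k \<Longrightarrow> src (a i) = src (x i)" and ax: "\<And>i. i < k \<Longrightarrow> a i \<noteq> x i"
    and faces_inj: "\<And>i j. i < k \<Longrightarrow> j < k \<Longrightarrow> fst (x i) = fst (x j) \<Longrightarrow> i = j"
    and edges_inj: "\<And>i j. i < k \<Longrightarrow> j < k \<Longrightarrow> fst (half (a i)) = fst (half (a j)) \<Longrightarrow> i = j"
    and half_Suc: "\<And>i. Suc i < k \<Longrightarrow> half (a (Suc i)) = (fst (half (x i)), \<not> snd (half (x i)))"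
    and half_0: "half (a 0) = half (x (k - 1))"
  shows "\<exists>m. moebius_band_in X m"
proof -
  define G where "G i p = \<Phi> (fst (x i)) (chord (a i) (x i) (real k * fst p - real i) (snd p))" for i and p :: "real \<times> real"
  define T where "T i = {p \<in> {0..1::real} \<times> {-1..1::real}. real i \<le> real k * fst p \<and> real k * fst p \<le> real i + 1}" for i
  let ?R = "{0..1::real} \<times> {-1..1::real}"
  have k0: "real k > 0" using k by simp
  have L: "G i (s, t) = half_edge (a i) (1/2 - t/4)"
    if i: "i < k" and s: "real k * s = real i" and t: "t \<in> {-1..1}" for i s t
  proof -
    have "fst (x i) = fst (a i)" using src[OF i] fst_src by metis
    then have "G i (s, t) = \<Phi> (fst (a i)) (fpt (a i) (1/2 - t/4))" unfolding G_def chord_def by (simp add: s del: fpt.simps)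
    also have "\<dots> = half_edge (a i) (1/2 - t/4)"
      by (rule \<Phi>_fpt[OF aF[OF i]]) (use t in auto)
    finally show ?thesis .
  qed
  have R: "G i (s, t) = half_edge (x i) (1/2 + t/4)"
    if i: "i < k" and s: "real k * s = real i + 1" and t: "t \<in> {-1..1}" for i s t
  proof -
    have "G i (s, t) = \<Phi> (fst (x i)) (fpt (x i) (1/2 + t/4))" unfolding G_def chord_def by (simp add: s del: fpt.simps)
    also have "\<dots> = half_edge (x i) (1/2 + t/4)"
      by (rule \<Phi>_fpt[OF xF[OF i]]) (use t in auto)
    finally show ?thesis .
  qed
  have glue: "G i (s, t) = G (Suc i) (s, t)" if i: "Suc i < k" and s: "real k * s = real i + 1" and t: "t \<in> {-1..1}" for i s t
  proof -
    have "G i (s, t) = half_edge (x i) (1/2 + t/4)" by (rule R) (use i s t in auto)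
    moreover have "G (Suc i) (s, t) = half_edge (a (Suc i)) (1/2 - t/4)"
      by (rule L) (use i s t in auto)
    ultimately show ?thesis unfolding half_Suc[OF i] by (simp add: traverse_flip)
  qed
  have Tdisj: "i = j \<or> (j = Suc i \<and> real k * fst p = real i + 1) \<or> (i = Suc j \<and> real k * fst p = real j + 1)"
    if "p \<in> T i" "p \<in> T j" for i j p
  proof -
    have "real i \<le> real j + 1" "real j \<le> real i + 1" using that unfolding T_def by auto
    then have "i = j \<or> j = Suc i \<or> i = Suc j" by linarith
    then show ?thesis using that unfolding T_def by auto
  qed
  obtain m where m: "continuous_map (top_of_set ?R) X m"
    and mG: "\<And>p i. i \<in> {..<k} \<Longrightarrow> p \<in> topspace (top_of_set ?R) \<inter> T i \<Longrightarrow> m p = G i p"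
  proof (rule pasting_lemma_exists_closed[where X = "top_of_set ?R" and Y = X and I = "{..<k}" and T = T and f = G])
    show "topspace (top_of_set ?R) \<subseteq> \<Union> (T ` {..<k})"
    proof
      fix p assume p: "p \<in> topspace (top_of_set ?R)"
      define i where "i = (if fst p = 1 then k - 1 else nat \<lfloor>real k * fst p\<rfloor>)"
      have p01: "0 \<le> fst p" "fst p \<le> 1" using p by auto
      have "i < k \<and> real i \<le> real k * fst p \<and> real k * fst p \<le> real i + 1"
      proof (cases "fst p = 1")
        case True then show ?thesis using k by (simp add: i_def of_nat_diff)
      next
        case False
        have *: "0 \<le> real k * fst p" "real k * fst p < real k" using p01 False k0 by auto
        then have "real i = of_int \<lfloor>real k * fst p\<rfloor>" using False by (simp add: i_def)
        then have "real i \<le> real k * fst p" "real k * fst p \<le> real i + 1" by linarith+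
        moreover have "i < k" using * \<open>real i \<le> real k * fst p\<close> by linarith
        ultimately show ?thesis by simp
      qed
      then show "p \<in> \<Union> (T ` {..<k})" using p unfolding T_def by auto
    qed
    show "closedin (top_of_set ?R) (T i)" for i
    proof -
      have "T i = ?R \<inter> ({p. real i \<le> real k * fst p} \<inter> {p. real k * fst p \<le> real i + 1})" unfolding T_def by auto
      moreover have "closed ({p :: real \<times> real. real i \<le> real k * fst p} \<inter> {p. real k * fst p \<le> real i + 1})"
        by (intro closed_Int closed_Collect_le continuous_intros)
      ultimately show ?thesis using closedin_closed_Int by metis
    qed
    show "continuous_map (subtopology (top_of_set ?R) (T i)) X (G i)" if i: "i \<in> {..<k}" for i
    proof -
      have i: "i < k" using i by simp
      have "chord (a i) (x i) (real k * fst p - real i) (snd p) \<in> cball 0 1" if "p \<in> ?R \<inter> T i" for p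
        by (rule chord(2)[OF aF[OF i] xF[OF i] src[OF i] ax[OF i], of _ 0]) (use that in \<open>auto simp: T_def\<close>)
      moreover have "continuous_on (?R \<inter> T i) (\<lambda>p. chord (a i) (x i) (real k * fst p - real i) (snd p))"
        unfolding chord_def by (intro continuous_intros) simp_all
      ultimately have "continuous_map (top_of_set (?R \<inter> T i)) (top_of_set (cball 0 1))
          (\<lambda>p. chord (a i) (x i) (real k * fst p - real i) (snd p))"
        unfolding continuous_map_in_subtopology by auto
      from continuous_map_compose[OF this \<Phi>_cont[OF Fl_face[OF xF[OF i]]]]
      show ?thesis unfolding subtopology_subtopology G_def[abs_def] comp_def .
    qed
    show "G i p = G j p" if ij: "i \<in> {..<k}" "j \<in> {..<k}" and p: "p \<in> topspace (top_of_set ?R) \<inter> T i \<inter> T j" for i j p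
    proof -
      obtain s t where st: "p = (s, t)" by (cases p)
      have t: "t \<in> {-1..1}" using p st by auto
      from Tdisj[of p i j] p consider "i = j" | "j = Suc i" "real k * s = real i + 1" | "i = Suc j" "real k * s = real j + 1"
        unfolding st by auto
      then show ?thesis
      proof cases
        case 2 then show ?thesis using glue[of i s t] ij t unfolding st by simp
      next
        case 3 then show ?thesis using glue[of j s t] ij t unfolding st by simp
      qed simp
    qed
  qed auto
  have wrap: "m (1, t) = m (0, - t)" if t: "t \<in> {-1..1}" for t
  proof -
    have "m (1, t) = G (k - 1) (1, t)" by (rule mG) (use k t in \<open>auto simp: T_def of_nat_diff\<close>)
    also have "\<dots> = half_edge (x (k - 1)) (1/2 + t/4)"
      by (rule R) (use k t in \<open>auto simp: of_nat_diff\<close>)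
    also have "\<dots> = G 0 (0, - t)" using L[of 0 0 "- t"] k t half_0 by simp
    also have "\<dots> = m (0, - t)" by (rule mG[symmetric]) (use k t in \<open>auto simp: T_def\<close>)
    finally show ?thesis .
  qed
  \<comment> \<open>Rounding down assigns a point on a dividing line to the strip that starts there,
    hence \<open>u < 1\<close>.\<close>
  have coord: "\<exists>i<k. \<exists>u\<in>{0..<1}. s = (real i + u) / real k \<and> m (s, t) = \<Phi> (fst (x i)) (chord (a i) (x i) u t)"
    if s: "s \<in> {0..<1}" and t: "t \<in> {-1..1}" for s t
  proof -
    define i where "i = nat \<lfloor>real k * s\<rfloor>"
    have *: "0 \<le> real k * s" "real k * s < real k" using s k0 by auto
    then have "real i = of_int \<lfloor>real k * s\<rfloor>" by (simp add: i_def)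
    then have i: "real i \<le> real k * s" "real k * s < real i + 1" by linarith+
    then have ik: "i < k" using * by linarith
    have "m (s, t) = G i (s, t)" by (rule mG) (use ik i s t in \<open>auto simp: T_def\<close>)
    moreover have "s = (real i + (real k * s - real i)) / real k" using k0 by simp
    ultimately show ?thesis using ik i unfolding G_def fst_conv snd_conv by (intro exI[of _ i] conjI bexI[of _ "real k * s - real i"]) auto
  qed
  have inj: "s = s' \<and> t = t'" if s: "s \<in> {0..<1}" "s' \<in> {0..<1}" and t: "t \<in> {-1..1}" "t' \<in> {-1..1}"
    and eq: "m (s, t) = m (s', t')" for s t s' t'
  proof -
    obtain i u where i: "i < k" "u \<in> {0..<1}" "s = (real i + u) / real k" "m (s, t) = \<Phi> (fst (x i)) (chord (a i) (x i) u t)"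
      using coord[OF s(1) t(1)] by blast
    obtain j w where j: "j < k" "w \<in> {0..<1}" "s' = (real j + w) / real k" "m (s', t') = \<Phi> (fst (x j)) (chord (a j) (x j) w t')"
      using coord[OF s(2) t(2)] by blast
    note ci = chord[OF aF[OF i(1)] xF[OF i(1)] src[OF i(1)] ax[OF i(1)]]
    note cj = chord[OF aF[OF j(1)] xF[OF j(1)] src[OF j(1)] ax[OF j(1)]]
    have eq': "\<Phi> (fst (x i)) (chord (a i) (x i) u t) = \<Phi> (fst (x j)) (chord (a j) (x j) w t')"
      using eq i(4) j(4) by simp
    have interior: "i = j \<and> u = w \<and> t = t'" if b: "chord (a i) (x i) u t \<in> ball 0 1 \<or> chord (a j) (x j) w t' \<in> ball 0 1"
    proof -
      have cb: "chord (a i) (x i) u t \<in> cball 0 1" "chord (a j) (x j) w t' \<in> cball 0 1"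
        by (rule ci(2)[OF t(1) t(2)], use i(2) in simp) (rule cj(2)[OF t(2) t(1)], use j(2) in simp)
      from b have fc: "fst (x i) = fst (x j) \<and> chord (a i) (x i) u t = chord (a j) (x j) w t'"
      proof
        assume "chord (a i) (x i) u t \<in> ball 0 1"
        then show ?thesis by (rule \<Phi>_eqD[OF Fl_face[OF xF[OF i(1)]] Fl_face[OF xF[OF j(1)]] _ cb(2) eq'])
      next
        assume "chord (a j) (x j) w t' \<in> ball 0 1"
        then have "fst (x j) = fst (x i) \<and> chord (a j) (x j) w t' = chord (a i) (x i) u t"
          by (rule \<Phi>_eqD[OF Fl_face[OF xF[OF j(1)]] Fl_face[OF xF[OF i(1)]] _ cb(1) eq'[symmetric]])
        from conjunct1[OF this, symmetric] conjunct2[OF this, symmetric] show ?thesis by (rule conjI)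
      qed
      then have ij: "i = j" using faces_inj[OF i(1) j(1)] by blast
      have "chord (a i) (x i) u t = chord (a i) (x i) w t'" using fc unfolding ij by blast
      then show ?thesis using ci(3)[OF t] ij by blast
    qed
    have "i = j \<and> u = w \<and> t = t'"
    proof (cases "u = 0 \<and> w = 0")
      case False
      then have "u \<in> {0<..<1} \<or> w \<in> {0<..<1}" using i(2) j(2) by auto
      then have "chord (a i) (x i) u t \<in> ball 0 1 \<or> chord (a j) (x j) w t' \<in> ball 0 1"
        using ci(1)[OF t] cj(1)[OF t(2) t(1)] by blast
      then show ?thesis by (rule interior)
    next
      \<comment> \<open>Both points lie on the edges where their strips begin, outside the open
        faces; here the distinctness of the edges decides.\<close>
      case True
      have "m (s, t) = G i (s, t)" unfolding i(4) G_def using i(3) k0 True by simp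
      moreover have "m (s', t') = G j (s', t')" unfolding j(4) G_def using j(3) k0 True by simp
      ultimately have tr: "half_edge (a i) (1/2 - t/4) =
          half_edge (a j) (1/2 - t'/4)"
        using L[OF i(1) _ t(1), of s] L[OF j(1) _ t(2), of s'] eq i(3) j(3) k0 True by simp
      from traverse_eqD[OF half_Ed[OF aF[OF i(1)]] half_Ed[OF aF[OF j(1)]] _ _ tr] t
      have *: "fst (half (a i)) = fst (half (a j))"
        "1/2 - t'/4 = (if snd (half (a i)) = snd (half (a j)) then 1/2 - t/4 else 1 - (1/2 - t/4))" by auto
      then have "i = j" using edges_inj[OF i(1) j(1)] by blast
      then show ?thesis using *(2) True by simp
    qed
    then show ?thesis using i(3) j(3) by simp
  qed
  have "moebius_band_in X m"
    unfolding moebius_band_in_def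
  proof (intro conjI ballI m)
    fix s t s' t' :: real
    assume s: "s \<in> {0..1}" and t: "t \<in> {-1..1}" and s': "s' \<in> {0..1}" and t': "t' \<in> {-1..1}"
    \<comment> \<open>\<open>c\<close> and \<open>d\<close> move a point with \<open>s = 1\<close>
      to its partner with \<open>s = 0\<close>, which reduces the claim to
      \<open>inj\<close>.\<close>
    define c where "c s = (if s = 1 then 0 else s)" for s :: real
    define d where "d s t = (if s = 1 then - t else t)" for s t :: real
    have norm: "m (s, t) = m (c s, d s t) \<and> c s \<in> {0..<1} \<and> d s t \<in> {-1..1}" if "s \<in> {0..1}" "t \<in> {-1..1}" for s t
      using wrap[OF that(2)] that by (auto simp: c_def d_def)
    have "m (s, t) = m (s', t') \<longleftrightarrow> m (c s, d s t) = m (c s', d s' t')"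
      using norm[OF s t] norm[OF s' t'] by simp
    also have "\<dots> \<longleftrightarrow> c s = c s' \<and> d s t = d s' t'"
      using inj[of "c s" "c s'" "d s t" "d s' t'"] norm[OF s t] norm[OF s' t'] by auto
    also have "\<dots> \<longleftrightarrow> (s = s' \<and> t = t') \<or> (\<bar>s - s'\<bar> = 1 \<and> t' = - t)"
      using s s' by (auto simp: c_def d_def)
    finally show "m (s, t) = m (s', t') \<longleftrightarrow> (s = s' \<and> t = t') \<or> (\<bar>s - s'\<bar> = 1 \<and> t' = - t)" .
  qed
  then show ?thesis by blast
qed

text \<open>In a shortest reversing chain let \<open>a i\<close> be the flag through which face
  \<open>i\<close> is entered. The faces are distinct already; it remains that a face is left by
  another side than it was entered, where chains of one or two faces are delicate, and that no edge
  is crossed twice.\<close>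

lemma moebius_band_if_reversal:
  assumes "((C, b), (C, \<not> b)) \<in> arr\<^sup>*"
  shows "\<exists>m. moebius_band_in X m"
proof -
  obtain k x where k: "k \<ge> 1" and x: "\<And>i. i < k \<Longrightarrow> x i \<in> Fl"
    and succ: "\<And>i. Suc i < k \<Longrightarrow> src (x (Suc i)) = src (rev (x i))"
    and last: "src (rev (x (k - 1))) = (fst (x 0), \<not> snd (src (x 0)))"
    and dist: "\<And>i j. i < j \<Longrightarrow> j < k \<Longrightarrow> fst (x i) \<noteq> fst (x j)"
    using minimal_reversing_path[OF assms] by blast
  define prev where "prev i = (if i = 0 then k - 1 else i - 1)" for i
  \<comment> \<open>At the closing step the orientations disagree, so \<open>r2\<close> replaces
    \<open>rev\<close> to give \<open>a 0\<close> the same \<open>src\<close> as \<open>x 0\<close>;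
    this missing flip is the twist of the band.\<close>
  define a where "a i = (if i = 0 then r2 (x (prev i)) else rev (x (prev i)))" for i
  have prev: "prev i < k" if "i < k" for i using that k by (auto simp: prev_def)
  have finj: "i = j" if "i < k" "j < k" "fst (x i) = fst (x j)" for i j
    using dist[of i j] dist[of j i] that by (cases i j rule: linorder_cases) auto
  have aF: "a i \<in> Fl" if "i < k" for i
    using r2(1)[OF x[OF prev[OF that]]] rev_Fl[OF x[OF prev[OF that]]] unfolding a_def by presburger
  have src0: "src (r2 (x (k - 1))) = src (x 0)"
  proof -
    have "src (rev (x (k - 1))) = (fst (r2 (x (k - 1))), \<not> snd (src (r2 (x (k - 1)))))"
      unfolding rev_def src_r0 by simp
    then show ?thesis using last by (simp add: prod_eq_iff)
  qed
  have src: "src (a i) = src (x i)" if "i < k" for i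
  proof (cases i)
    case 0 then show ?thesis using src0 by (simp add: a_def prev_def)
  next
    case (Suc l) then show ?thesis using succ[of l] that by (simp add: a_def prev_def)
  qed
  have r2a: "r2 (a i) = x (prev i) \<or> r2 (a i) = r0 (x (prev i))" if i: "i < k" for i
  proof (cases "i = 0")
    case True
    then have "a i = r2 (x (prev i))" unfolding a_def by presburger
    then show ?thesis using r2_r2[OF x[OF prev[OF i]]] by simp
  next
    case False
    have "r2 (rev (x (prev i))) = r0 (x (prev i))"
      unfolding rev_def r0_r2[OF r2(1)[OF x[OF prev[OF i]]], symmetric] r2_r2[OF x[OF prev[OF i]]] ..
    moreover have "a i = rev (x (prev i))" using False unfolding a_def by presburger
    ultimately show ?thesis by simp
  qed
  have nx: "fst (r2 (x i)) = fst (x (if Suc i = k then 0 else Suc i))" if i: "i < k" for i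
  proof -
    have r: "fst (r2 (x i)) = fst (src (rev (x i)))" by (simp add: rev_def)
    show ?thesis
    proof (cases "Suc i = k")
      case True
      then have "i = k - 1" by simp
      then have "fst (src (rev (x i))) = fst (x 0)" using arg_cong[OF last, of fst] by simp
      then show ?thesis using r True by simp
    next
      case False
      then have "src (x (Suc i)) = src (rev (x i))" using succ i by simp
      from arg_cong[OF this, of fst] show ?thesis using r False by simp
    qed
  qed
  have ax: "a i \<noteq> x i" if i: "i < k" for i
  proof
    assume eq: "a i = x i"
    \<comment> \<open>Entering and leaving by the same side means that the previous and the next
      face coincide, so \<open>k\<close> is 1 or 2.\<close>
    have "fst (x (prev i)) = fst (x (if Suc i = k then 0 else Suc i))"
    proof -
      have "fst (r2 (a i)) = fst (x (prev i))" using r2a[OF i] fst_r0[of "x (prev i)"] by (elim disjE) simp_all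
      then show ?thesis using nx[OF i] unfolding eq by simp
    qed
    then have "prev i = (if Suc i = k then 0 else Suc i)" using finj[OF prev[OF i]] k i by auto
    then consider "k = 1" "i = 0" | "k = 2" "i = 0" | "k = 2" "i = 1"
      using i unfolding prev_def by (auto split: if_splits)
    then show False
    proof cases
      case 1 then show False using eq r2(3)[OF x[OF i]] by (simp add: a_def prev_def)
    next
      case 2
      then have "x 0 = r2 (x 1)" "k - 1 = 1" using eq by (simp_all add: a_def prev_def)
      then have "x 1 = r2 (x 0)" using r2_r2[OF x[of 1]] 2 by simp
      then have "src (rev (x 0)) = src (r2 (x 0))" using succ[of 0] 2 by simp
      then show False unfolding rev_def src_r0 by (simp add: prod_eq_iff)
    next
      case 3
      then have "rev (x 0) = x 1" using eq by (simp add: a_def prev_def)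
      then have r1: "rev (x 1) = x 0" using rev_rev[OF x[of 0]] 3 by simp
      have "k - 1 = 1" using 3 by simp
      then have "src (x 0) = (fst (x 0), \<not> snd (src (x 0)))" using last r1 by simp
      from arg_cong[OF this, of snd] show False by simp
    qed
  qed
  have einj: "i = j" if i: "i < k" and j: "j < k" and e: "fst (half (a i)) = fst (half (a j))" for i j
  proof (rule ccontr)
    assume ij: "i \<noteq> j"
    have fa: "fst (a l) = fst (x l)" if "l < k" for l using arg_cong[OF src[OF that], of fst] by simp
    have aij: "fst (a i) \<noteq> fst (a j)" using fa[OF i] fa[OF j] finj[OF i j] ij by auto
    have "half (a j) = half (a i) \<or> half (r0 (a j)) = half (a i)" using e by (auto simp: prod_eq_iff half_r0 simp del: half.simps)
    then have "a j = a i \<or> a j = r2 (a i) \<or> r0 (a j) = a i \<or> r0 (a j) = r2 (a i)"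
      using r2(4)[OF aF[OF i] aF[OF j]] r2(4)[OF aF[OF i] r0_Fl[OF aF[OF j]]] by blast
    \<comment> \<open>Of the flags over the edge, \<open>a i\<close> and \<open>r0 (a i)\<close>
      belong to the face of \<open>a i\<close>, and different indices have different faces.\<close>
    then have *: "a j = r2 (a i) \<or> a j = r0 (r2 (a i))"
    proof (elim disjE)
      assume "a j = a i" then show ?thesis using aij by simp
    next
      assume "r0 (a j) = a i" then show ?thesis using aij fst_r0[of "a j"] by simp
    next
      assume "r0 (a j) = r2 (a i)"
      from arg_cong[OF this, of r0] show ?thesis unfolding r0_r0 ..
    qed simp
    have c: "a j = x (prev i) \<or> a j = r0 (x (prev i))"
    proof (cases "r2 (a i) = x (prev i)")
      case True then show ?thesis using * by simp
    next
      case False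
      then have "r2 (a i) = r0 (x (prev i))" using r2a[OF i] by blast
      then show ?thesis using * by (simp add: r0_r0 disj_commute)
    qed
    then have "fst (a j) = fst (x (prev i))" using fst_r0[of "x (prev i)"] by (elim disjE) simp_all
    \<comment> \<open>Face \<open>j\<close> would be entered and left by the same edge:
      \<open>a j = x j\<close> contradicts \<open>ax\<close>, and \<open>a j = r0 (x j)\<close>
      contradicts the equality of \<open>src\<close>.\<close>
    then have j: "j = prev i" using finj[OF j prev[OF i]] fa[OF j] by simp
    then have "a j = r0 (x j)" using c ax[OF \<open>j < k\<close>] by blast
    then have "src (x j) = src (r0 (x j))" using src[OF \<open>j < k\<close>] by simp
    then show False unfolding src_r0 by (simp add: prod_eq_iff)
  qed
  show ?thesis
  proof (rule moebius_band_from_strips[OF k x aF src ax finj einj])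
    show "half (a (Suc i)) = (fst (half (x i)), \<not> snd (half (x i)))" if "Suc i < k" for i
      using r2(2)[OF x[of i]] that by (simp add: a_def prev_def rev_def half_r0 del: half.simps)
    show "half (a 0) = half (x (k - 1))"
      using r2(2)[OF x[of "k - 1"]] k by (simp add: a_def prev_def del: half.simps)
  qed
qed

section \<open>The theorem\<close>

text \<open>\<open>p\<close> enters only through a flag count because the polygons
  \<open>\<Phi>\<close> of regularity have their own side numbers \<open>n\<close>. Transitivity
  makes \<open>n\<close> constant, and counting flags identifies it with \<open>p\<close>.\<close>

lemma regular_type_False:
  assumes reg: "\<And>x y. x \<in> Fl \<Longrightarrow> y \<in> Fl \<Longrightarrow> \<exists>h \<pi>. is_symmetry X \<Gamma> h \<and> induces_on_flags X \<Gamma> n \<Phi> h \<pi> \<and> \<pi> x = y"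
    and p: "(\<Sum>C\<in>F. p) = 2 * card Ed" and q: "\<And>v. v \<in> V \<Longrightarrow> valency \<Gamma> v = q"
    and ori: "orientable_surface X" and eul: "int (card V) - int (card Ed) + int (card F) = -4"
    and pq: "(p, q) \<in> {(4, 5), (6, 5), (6, 9), (10, 3), (10, 5), (18, 3), (30, 3)}"
  shows False
proof -
  have pq0: "p > 0" "q > 0" using pq by auto
  \<comment> \<open>Positive valency puts a flag at every vertex, as \<open>flags_connected\<close>
    requires.\<close>
  have inc: "\<exists>x\<in>Fl. vx x = v" if "v \<in> V" for v
  proof -
    have "card {x \<in> Fl. vx x = v} \<noteq> 0" using card_vertex_flags[of v] q[OF that] pq0 by simp
    then show ?thesis by (metis (mono_tags, lifting) card.empty empty_Collect_eq)
  qed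
  have "V \<noteq> {}" using tes unfolding tessellation_def graph_in_def by blast
  then have ne: "Fl \<noteq> {}" using inc by blast
  have no: "((C, b), (C, \<not> b)) \<notin> arr\<^sup>*" for C b
    using moebius_band_if_reversal[of C b] ori unfolding orientable_surface_def by blast
  have "\<exists>\<kappa> :: 'a flag \<Rightarrow> bool. \<forall>x\<in>Fl. \<kappa> (r0 x) \<noteq> \<kappa> x \<and> \<kappa> (r1 x) \<noteq> \<kappa> x \<and> \<kappa> (r2 x) \<noteq> \<kappa> x"
    by (rule colouring_if_no_reversal[OF inc ne no])
  then obtain \<kappa> :: "'a flag \<Rightarrow> bool"
    where \<kappa>: "\<forall>x\<in>Fl. \<kappa> (r0 x) \<noteq> \<kappa> x \<and> \<kappa> (r1 x) \<noteq> \<kappa> x \<and> \<kappa> (r2 x) \<noteq> \<kappa> x"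
    by (elim exE)
  interpret R: regular_flags Fl r0 r1 r2 \<kappa>
  proof
    show "finite Fl" by (rule finite_Fl)
    show "A = Fl" if "A \<subseteq> Fl" "A \<noteq> {}" "\<And>w. w \<in> A \<Longrightarrow> r0 w \<in> A \<and> r1 w \<in> A \<and> r2 w \<in> A" for A
      by (rule flags_connected[OF inc that(1,2)]) (use that(3) in blast)+
    fix v w assume vw: "v \<in> Fl" "w \<in> Fl"
    obtain h \<pi> where h: "is_symmetry X \<Gamma> h" "induces_on_flags X \<Gamma> n \<Phi> h \<pi>" "\<pi> v = w" using reg[OF vw] by blast
    show "\<exists>\<pi>. (\<forall>u\<in>Fl. \<pi> u \<in> Fl \<and> \<pi> (r0 u) = r0 (\<pi> u) \<and> \<pi> (r1 u) = r1 (\<pi> u) \<and> \<pi> (r2 u) = r2 (\<pi> u)) \<and> \<pi> v = w"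
      by (intro exI[of _ \<pi>] conjI ballI h(3) \<pi>_Fl[OF h(1,2)] \<pi>_r0[OF h(1,2)] \<pi>_r1[OF h(1,2)] \<pi>_r2[OF h(1,2)])
  qed (use r0_Fl r1_Fl r2(1) r0_r0 r1_r1 r2_r2 r0_r2 \<kappa> in blast)+
  have flag0: "(C, 0, False) \<in> Fl" if "C \<in> F" for C using n_ge_1[OF that] that by simp
  have n_le: "n C \<le> n D" if CD: "C \<in> F" "D \<in> F" for C D
  proof -
    obtain h \<pi> where h: "is_symmetry X \<Gamma> h" "induces_on_flags X \<Gamma> n \<Phi> h \<pi>" "\<pi> (C, 0, False) = (D, 0, False)"
      using reg[OF flag0[OF CD(1)] flag0[OF CD(2)]] by blast
    show ?thesis using card_face_mono[OF h(1,2) flag0[OF CD(1)]] h(3) by simp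
  qed
  obtain x where x: "x \<in> Fl" using ne by blast
  obtain C i b where xx: "x = (C, i, b)" by (cases x)
  have C: "C \<in> F" "i < n C" using x xx by auto
  have nC: "n D = n C" if "D \<in> F" for D using n_le[OF that C(1)] n_le[OF C(1) that] by simp
  have "(\<Sum>D\<in>F. 2 * n D) = (\<Sum>D\<in>F. 2 * n C)" by (rule sum.cong) (use nC in auto)
  then have "card F * n C = 2 * card Ed" using card_Fl_faces card_Fl_edges by simp
  moreover have pF: "p * card F = 2 * card Ed" using p by (simp add: mult.commute)
  moreover have "card F > 0" using C(1) finite_F card_gt_0_iff by blast
  ultimately have np: "n C = p" by (metis mult.commute mult_left_cancel neq0_conv)
  have qV: "q * card V = 2 * card Ed" using sum_valency q by (simp add: mult.commute)
  have ordx: "group.ord R.Rot (R.rt r0 r1) = p"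
  proof -
    have "card {w \<in> Fl. fst w = C} = 2 * group.ord R.Rot (R.rt r0 r1)"
    proof (rule R.ord_component[where a = r0 and w = x])
      show "A = {w \<in> Fl. fst w = C}"
        if A: "A \<subseteq> {w \<in> Fl. fst w = C}" "x \<in> A" "\<And>u. u \<in> A \<Longrightarrow> r0 u \<in> A \<and> r1 u \<in> A" for A
      proof
        show "{w \<in> Fl. fst w = C} \<subseteq> A"
        proof
          fix w assume w: "w \<in> {w \<in> Fl. fst w = C}"
          then obtain j c where ww: "w = (C, j, c)" by (cases w) simp
          have "j < n C" using w unfolding ww by simp
          show "w \<in> A" unfolding ww
          proof (rule face_connected[OF _ _ _ C(2) \<open>j < n C\<close>])
            show "r0 u \<in> A" "r1 u \<in> A" if "u \<in> A" for u using A(3)[OF that] by blast+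
            show "(C, i, b) \<in> A" using A(2) unfolding xx .
          qed
        qed
      qed (rule A(1))
    qed (use x xx r0_Fl r1_Fl in auto)
    then show ?thesis using card_face_flags[OF C(1)] np by simp
  qed
  \<comment> \<open>\<open>ord_component\<close> selects the generator by comparing \<open>a\<close>
    with \<open>r0\<close> as functions, so the two must be known to differ.\<close>
  have r02: "r2 \<noteq> r0"
  proof
    assume "r2 = r0"
    then have "half (r0 x) = half x" using r2(2)[OF x] by simp
    then have "(fst (half x), \<not> snd (half x)) = half x" unfolding half_r0 .
    from arg_cong[OF this, of snd] show False by simp
  qed
  have ordy: "group.ord R.Rot (R.rt r1 r2) = q"
  proof -
    have "card {w \<in> Fl. vx w = vx x} = 2 * group.ord R.Rot (R.rt r1 r2)"
    proof (rule R.ord_component[where a = r2 and w = x])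
      show "R.rt r1 r2 = (if r2 = r0 then R.rt r0 r1 else R.rt r1 r2)" using r02 by simp
      show "A = {w \<in> Fl. vx w = vx x}"
        if A: "A \<subseteq> {w \<in> Fl. vx w = vx x}" "x \<in> A" "\<And>u. u \<in> A \<Longrightarrow> r2 u \<in> A \<and> r1 u \<in> A" for A
      proof
        show "{w \<in> Fl. vx w = vx x} \<subseteq> A"
        proof
          fix w assume "w \<in> {w \<in> Fl. vx w = vx x}"
          then have w: "w \<in> Fl" "vx w = vx x" by auto
          show "w \<in> A" by (rule vertex_connected[OF _ _ _ A(2) w]) (use A(1,3) in blast)+
        qed
      qed (rule A(1))
      show "r2 u \<in> {w \<in> Fl. vx w = vx x}" if "u \<in> {w \<in> Fl. vx w = vx x}" for u
        using that r2(1)[of u] vx_r2[of u] by simp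
      show "r1 u \<in> {w \<in> Fl. vx w = vx x}" if "u \<in> {w \<in> Fl. vx w = vx x}" for u
        using that r1_Fl[of u] vx_r1[of u] by simp
    qed (use x in auto)
    then show ?thesis using card_vertex_flags[of "vx x"] q[OF vx_V[OF x]] by simp
  qed
  show False by (rule R.excluded_types[OF ne card_Fl_edges pF qV eul ordx ordy pq])
qed

end

theorem mainTheorem2:
  fixes X :: "'a topology" and p q :: nat
  assumes "closed_orientable_surface_of_genus 3 X"
    and "(p, q) \<in> {(4, 5), (6, 5), (6, 9), (10, 3), (10, 5), (18, 3), (30, 3)}"
  shows "\<not> (\<exists>\<Gamma>. regular_tessellation X \<Gamma> \<and> has_type X \<Gamma> p q)"
proof
  assume "\<exists>\<Gamma>. regular_tessellation X \<Gamma> \<and> has_type X \<Gamma> p q"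
  then obtain \<Gamma> where \<Gamma>: "regular_tessellation X \<Gamma>" "has_type X \<Gamma> p q" by blast
  have surf: "closed_surface X" and ori: "orientable_surface X" and eul: "has_euler_characteristic X (- 4)"
    using assms(1) unfolding closed_orientable_surface_of_genus_def by auto
  have tes: "tessellation X \<Gamma>" using \<Gamma>(1) unfolding regular_tessellation_def by blast
  obtain n \<Phi> where par: "\<forall>C\<in>faces X \<Gamma>. polygon_param X \<Gamma> C (n C) (\<Phi> C)" and
    reg: "\<forall>x\<in>flags X \<Gamma> n. \<forall>y\<in>flags X \<Gamma> n. \<exists>h \<pi>. is_symmetry X \<Gamma> h \<and> induces_on_flags X \<Gamma> n \<Phi> h \<pi> \<and> \<pi> x = y"
    using \<Gamma>(1) unfolding regular_tessellation_def by blast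
  have "\<forall>C\<in>faces X \<Gamma>. \<exists>\<phi>. polygon_param X \<Gamma> C p \<phi>" using \<Gamma>(2) unfolding has_type_def is_gon_def by blast
  then obtain \<Psi> where \<Psi>: "\<forall>C\<in>faces X \<Gamma>. polygon_param X \<Gamma> C p (\<Psi> C)" using bchoice by meson
  \<comment> \<open>Two views of one tessellation: \<open>P\<close> with the \<open>p\<close>-gons
    of the type supplies the count of edges through \<open>p\<close>, and \<open>N\<close> with the
    polygons of regularity supplies the symmetries.\<close>
  interpret P: tess X \<Gamma> "\<lambda>_. p" \<Psi> by unfold_locales (use surf tes \<Psi> in auto)
  interpret N: tess X \<Gamma> n \<Phi> by unfold_locales (use surf tes par in auto)
  show False
  proof (rule N.regular_type_False)
    show "(\<Sum>C\<in>faces X \<Gamma>. p) = 2 * card (gedges \<Gamma>)"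
      using P.card_Fl_faces P.card_Fl_edges by simp
    show "int (card (gverts \<Gamma>)) - int (card (gedges \<Gamma>)) + int (card (faces X \<Gamma>)) = -4"
      using eul tes unfolding has_euler_characteristic_def by blast
    show "valency \<Gamma> v = q" if "v \<in> gverts \<Gamma>" for v using \<Gamma>(2) that unfolding has_type_def by blast
  qed (use reg ori assms(2) in \<open>simp_all add: N.Fl_def\<close>)
qed

end
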